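(* Let $\alpha>0$ be a constant and let $k$ be a fixed positive integer. Let $(G^{(n)})$ be a $k$-regular expander graph sequence, indexed by an infinite set of positive integers $n$, with $G^{(n)}$ having $n$ vertices and girth greater than $2\lceil\alpha\log_{k-1}n\rceil+1$. Run the third scheme on $G^{(n)}$. Then there is a constant $C$ such that, with probability tending to $1$ as $n\to\infty$, the maximum load after all $n$ balls have been placed satisfies $$\max_vQ_v(n)\le\log_2\log n+C.$$
   Context: All logarithms without base are natural. Expander graph sequence: a sequence of $k$-regular simple graphs $G^{(n)}$ on $n$ vertices such that, if $k=\lambda_1^{(n)}\ge\lambda_2^{(n)}\ge\dots\ge\lambda_n^{(n)}$ are the eigenvalues of the adjacency matrix of $G^{(n)}$ and $\lambda^{(n)}=\max\{\lambda_2^{(n)},|\lambda_n^{(n)}|\}$, then $\lambda:=\limsup_{n\to\infty}\lambda^{(n)}<k$. The third scheme on a $k$-regular graph $G=(V,E)$ with $|V|=n$: bins are the vertices of $G$. $W_1,W_2$ are two independent non-backtracking random walks on $G$ (never reset), started from independent uniformly random vertices: the first step goes to a uniformly random neighbour, and each later step goes to a uniformly random neighbour of the current vertex other than the vertex occupied at the previous time. Loads: $Q_v(0)=0$ for all $v\in V$. At each time $t=0,1,\dots,n-1$ one ball is added to whichever of the bins $W_1(t),W_2(t)$ has smaller load $Q_v(t)$, ties being broken by an arbitrary non-random rule; this gives $Q(t+1)$. *)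

theory Defs
  imports
    "HOL-Probability.Probability"
    "Graph_Theory.Pair_Digraph"
    "Jordan_Normal_Form.Char_Poly"
begin

text \<open>
  A finite simple graph is a \<^locale>\<open>pair_graph\<close>: each edge is represented by its two opposite arcs.
\<close>

definition regular_graph :: "nat \<Rightarrow> 'a pair_pre_digraph \<Rightarrow> bool" where
  "regular_graph k G \<longleftrightarrow> pair_graph G \<and> (\<forall>v\<in>pverts G. out_degree (with_proj G) v = k)"

text \<open>
  In a symmetric digraph the closed walk along an edge and back counts as a \<^const>\<open>pre_digraph.cycle\<close>
  of length 2; the cycles of the undirected graph are those of length at least 3.
  The girth of an acyclic graph is \<open>\<infinity>\<close>.
\<close>

definition girth :: "'a pair_pre_digraph \<Rightarrow> enat" where
  "girth G = Inf {enat (length p) | p. pre_digraph.cycle (with_proj G) p \<and> 3 \<le> length p}"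

text \<open>
  The enumeration of the vertices is arbitrary; the characteristic polynomial does not depend on it.
\<close>

definition adjacency_matrix :: "'a pair_pre_digraph \<Rightarrow> real mat" where
  "adjacency_matrix G =
    (let vs = (SOME vs. distinct vs \<and> set vs = pverts G)
     in Matrix.mat (card (pverts G)) (card (pverts G))
          (\<lambda>(i, j). if (vs ! i, vs ! j) \<in> parcs G then 1 else 0))"

text \<open>
  Eigenvalues with algebraic multiplicity, in nonincreasing order. The matrix is symmetric, so all
  complex roots of its characteristic polynomial are real and the list has length
  \<open>card (pverts G)\<close>.
\<close>

definition adjacency_eigenvalues :: "'a pair_pre_digraph \<Rightarrow> real list" where
  "adjacency_eigenvalues G =
    rev (sorted_list_of_multiset (proots (char_poly (adjacency_matrix G))))"

text \<open>
  List positions start at 0, so \<open>! 1\<close> is the second largest eigenvalue. It exists whenever there are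
  at least two vertices, in particular for \<open>k\<close>-regular graphs with \<open>k > 0\<close> and nonempty vertex set.
\<close>

definition expansion :: "'a pair_pre_digraph \<Rightarrow> real" where
  "expansion G = max (adjacency_eigenvalues G ! 1) \<bar>last (adjacency_eigenvalues G)\<bar>"

text \<open>
  The sequence is indexed by the set \<open>N\<close>; limits for \<open>n \<rightarrow> \<infinity>\<close> are taken within \<open>N\<close>.
\<close>

definition expander_sequence ::
    "nat \<Rightarrow> nat set \<Rightarrow> (nat \<Rightarrow> 'a pair_pre_digraph) \<Rightarrow> bool" where
  "expander_sequence k N G \<longleftrightarrow>
    (\<forall>n\<in>N. regular_graph k (G n) \<and> card (pverts (G n)) = n) \<and>
    Limsup (inf sequentially (principal N)) (\<lambda>n. ereal (expansion (G n))) < ereal (real k)"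

text \<open>
  A trajectory is a nonempty list of vertices in chronological order.
\<close>

definition nb_steps :: "'a pair_pre_digraph \<Rightarrow> 'a list \<Rightarrow> 'a set" where
  "nb_steps G xs = {v. (last xs, v) \<in> parcs G} -
     (if 2 \<le> length xs then {xs ! (length xs - 2)} else {})"

text \<open>
  Law of the positions at times \<open>0, \<dots>, t\<close>. The sets passed to \<^const>\<open>pmf_of_set\<close> are finite and
  nonempty for \<open>k\<close>-regular graphs with \<open>k \<ge> 2\<close> and nonempty vertex set.
\<close>

primrec nb_walk :: "'a pair_pre_digraph \<Rightarrow> nat \<Rightarrow> 'a list pmf" where
  "nb_walk G 0 = map_pmf (\<lambda>v. [v]) (pmf_of_set (pverts G))"
| "nb_walk G (Suc t) =
     bind_pmf (nb_walk G t) (\<lambda>xs. map_pmf (\<lambda>v. xs @ [v]) (pmf_of_set (nb_steps G xs)))"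

text \<open>
  Loads when the walks follow the trajectories \<open>w1\<close> and \<open>w2\<close>. The tie-breaking rule is an arbitrary
  deterministic function of the positions of both walks up to and including the current time
  (which determine the time and all loads); \<open>True\<close> selects the first walk.
\<close>

primrec load ::
    "(('a \<times> 'a) list \<Rightarrow> bool) \<Rightarrow> 'a list \<Rightarrow> 'a list \<Rightarrow> nat \<Rightarrow> 'a \<Rightarrow> nat" where
  "load tie w1 w2 0 = (\<lambda>v. 0)"
| "load tie w1 w2 (Suc t) =
    (let q = load tie w1 w2 t; a = w1 ! t; b = w2 ! t;
         c = (if q a < q b then a
              else if q b < q a then b
              else if tie (take (Suc t) (zip w1 w2)) then a else b)
     in q(c := q c + 1))"

definition max_load ::
    "'a pair_pre_digraph \<Rightarrow> (('a \<times> 'a) list \<Rightarrow> bool) \<Rightarrow> 'a list \<Rightarrow> 'a list \<Rightarrow> nat" where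
  "max_load G tie w1 w2 = Max (load tie w1 w2 (card (pverts G)) ` pverts G)"

text \<open>
  Joint law of the two walks at the times \<open>0, \<dots>, n - 1\<close>, where \<open>n\<close> is the number of vertices.
\<close>

definition two_walks :: "'a pair_pre_digraph \<Rightarrow> ('a list \<times> 'a list) pmf" where
  "two_walks G =
    pair_pmf (nb_walk G (card (pverts G) - 1)) (nb_walk G (card (pverts G) - 1))"

end

(*
Let L be a large multiple of log n and l = ceiling (alpha log_(k-1) n). After L steps each walk is nearly
uniform (each vertex has probability at most C/n): the numbers of non-backtracking paths of length t are the
entries of p_t(A) for polynomials p_t with |p_t| = O((sigma (k-1))^t), sigma < 1, on the nontrivial spectrum,
and the Frobenius norm of p_t(A) minus its rank-one part is controlled by these values. By the girth
condition a walk cannot return within l steps and hits a given vertex after l steps with probability at most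
(k-1)^(-l).

A bin reaches load i+1 only when both walks sit in bins of load at least i. If at most b n bins had such a load
L steps ago, this has conditional probability of order b^2, up to errors of order n^(-min(alpha,1)) times a
power of log n. Exponential moments along residue classes modulo L give concentration, so the fraction of bins
of load at least i is squared (up to a constant) when i increases by one, until after log_2 log n + O(1) levels
it drops below a power n^(-delta). From there on, a bin that gains 2K more balls is visited at K times that are
pairwise at least l apart while the other walk is in a heavily loaded bin; each further such visit costs a
factor n^(-delta'), so for a large constant K no such bin exists.
*)
theory Submission
  imports Defs "Jordan_Normal_Form.Schur_Decomposition" "HOL-Real_Asymp.Real_Asymp"
begin


section \<open>Spectral bounds\<close>

text \<open>The degree is only assumed positive, whereas the path-count bounds and the base k-1 of
  the logarithm call for k >= 3. Degrees 1 and 2 are ruled out by the spectral gap: a matrix with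
  natural entries has squared Frobenius norm at least its entry sum.

  The main obstacle is adaptivity: the heavy set at time t depends on both walks, so it is not
  independent of where they stand. It is therefore frozen L steps earlier. A bin that became heavy
  since then lies on one of the two recent trajectories, which gives the three terms of
  \<open>eta\<close>. The event that the first walk meets the recent path of the second involves
  both walks; it is split off and costs L * q instead of entering the square. That few bins were
  heavy L steps ago is made part of each counted event, so that the conditional bounds hold for
  every past; this loses nothing, because heavy sets only grow.

  Estimating a single matrix entry by the whole Frobenius norm wastes a factor sqrt n, which the
  exponential decay of the path polynomials absorbs at a time of order log n. For that norm a
  triangular form of the adjacency matrix is enough.\<close>

text \<open>For a complex eigenvector x with eigenvalue a, the form x* A x is real by symmetry and
  equals a times the squared norm of x, so a is real. The complex factorization then descends to the
  reals because the coefficient embedding is injective.\<close>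

lemma symmetric_char_poly_splits:
  fixes A :: "real mat"
  assumes A: "A \<in> carrier_mat n n" and sym: "\<And>i j. i < n \<Longrightarrow> j < n \<Longrightarrow> A $$ (i, j) = A $$ (j, i)"
  shows "\<exists>es. char_poly A = (\<Prod>e\<leftarrow>es. [:- e, 1:]) \<and> length es = n"
proof -
  let ?c = "complex_of_real"
  interpret ph: map_poly_inj_idom_hom ?c ..
  define Ac where "Ac = map_mat ?c A"
  have Ac: "Ac \<in> carrier_mat n n" using A by (simp add: Ac_def)
  obtain as where as: "char_poly Ac = (\<Prod>a\<leftarrow>as. [:- a, 1:])" "length as = n"
    using char_poly_factorized[OF Ac] by blast
  have cp: "char_poly Ac = map_poly ?c (char_poly A)"
    unfolding Ac_def using of_real_hom.char_poly_hom[OF A] by simp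
  have real: "Im a = 0" if "a \<in> set as" for a
  proof -
    have "poly (char_poly Ac) a = 0"
      using that unfolding as(1) poly_prod_list by (force simp: prod_list_zero_iff)
    then have "eigenvalue Ac a" using eigenvalue_root_char_poly[OF Ac] by simp
    then obtain v where v: "v \<in> carrier_vec n" "v \<noteq> 0\<^sub>v n" "Ac *\<^sub>v v = a \<cdot>\<^sub>v v"
      using Ac unfolding eigenvalue_def eigenvector_def by auto
    define x where "x i = vec_index v i" for i
    have eq: "(\<Sum>j<n. ?c (A $$ (i,j)) * x j) = a * x i" if "i < n" for i
    proof -
      have "vec_index (Ac *\<^sub>v v) i = vec_index (a \<cdot>\<^sub>v v) i" using v(3) by simp
      then show ?thesis using that v(1) A unfolding x_def Ac_def
        by (simp add: scalar_prod_def lessThan_atLeast0)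
    qed
    define s where "s = (\<Sum>i<n. \<Sum>j<n. cnj (x i) * ?c (A $$ (i,j)) * x j)"
    define r where "r = (\<Sum>i<n. (cmod (x i))\<^sup>2)"
    have "s = (\<Sum>i<n. cnj (x i) * (a * x i))"
      unfolding s_def by (intro sum.cong refl) (simp add: eq[symmetric] sum_distrib_left mult.assoc)
    also have "\<dots> = a * ?c r"
      unfolding r_def by (simp add: sum_distrib_left complex_norm_square mult_ac del: of_real_power)
    finally have s1: "s = a * ?c r" .
    have "cnj s = (\<Sum>i<n. \<Sum>j<n. x i * ?c (A $$ (i,j)) * cnj (x j))"
      unfolding s_def by simp
    also have "\<dots> = (\<Sum>j<n. \<Sum>i<n. x i * ?c (A $$ (i,j)) * cnj (x j))" by (rule sum.swap)
    also have "\<dots> = s" unfolding s_def by (intro sum.cong refl) (auto simp: sym mult_ac)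
    finally have "Im s = 0" by (simp add: complex_eq_iff)
    then have "Im a * r = 0" using s1 by simp
    moreover have "r \<noteq> 0"
    proof
      assume "r = 0"
      then have "\<And>i. i < n \<Longrightarrow> x i = 0" unfolding r_def by (subst (asm) sum_nonneg_eq_0_iff) auto
      then have "v = 0\<^sub>v n" using v(1) unfolding x_def by auto
      with v(2) show False by simp
    qed
    ultimately show ?thesis by simp
  qed
  define es where "es = map Re as"
  have "as = map ?c es" unfolding es_def map_map
    by (rule nth_equalityI) (auto simp: complex_eq_iff real)
  then have "char_poly Ac = map_poly ?c (\<Prod>e\<leftarrow>es. [:- e, 1:])"
    unfolding as(1) by (simp add: ph.hom_prod_list o_def)
  then have "char_poly A = (\<Prod>e\<leftarrow>es. [:- e, 1:])"
    unfolding cp by simp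
  moreover have "length es = n" using as(2) by (simp add: es_def)
  ultimately show ?thesis by blast
qed

text \<open>\<open>mat_fun n A f M\<close>: the matrix \<open>M\<close> is \<open>f(A)\<close> for the polynomial function \<open>f\<close>.\<close>

inductive mat_fun :: "nat \<Rightarrow> real mat \<Rightarrow> (real \<Rightarrow> real) \<Rightarrow> real mat \<Rightarrow> bool" for n A where
  one: "mat_fun n A (\<lambda>_. 1) (1\<^sub>m n)"
| mult: "mat_fun n A f M \<Longrightarrow> mat_fun n A (\<lambda>x. x * f x) (A * M)"
| lin: "mat_fun n A f M \<Longrightarrow> mat_fun n A g M' \<Longrightarrow>
    mat_fun n A (\<lambda>x. f x - c * g x) (M - c \<cdot>\<^sub>m M')"

lemma mat_fun_carrier: "mat_fun n A f M \<Longrightarrow> A \<in> carrier_mat n n \<Longrightarrow> M \<in> carrier_mat n n"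
  by (induction rule: mat_fun.induct) (auto intro!: minus_carrier_mat)

lemma mat_fun_commute:
  "mat_fun n A f M \<Longrightarrow> A \<in> carrier_mat n n \<Longrightarrow> A * M = M * A"
proof (induction rule: mat_fun.induct)
  case (mult f M)
  note M = mat_fun_carrier[OF mult.hyps mult.prems]
  have "A * (A * M) = A * (M * A)" using mult by simp
  also have "\<dots> = A * M * A" using mult.prems M by simp
  finally show ?case .
next
  case (lin f M g M' c)
  note M = mat_fun_carrier[OF lin.hyps(1) lin.prems] mat_fun_carrier[OF lin.hyps(2) lin.prems]
  have "A * (M - c \<cdot>\<^sub>m M') = A * M - A * (c \<cdot>\<^sub>m M')"
    using M lin.prems by (intro mult_minus_distrib_mat) auto
  also have "\<dots> = M * A - (c \<cdot>\<^sub>m M') * A"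
    using M lin.prems lin.IH by (simp add: mult_smult_distrib mult_smult_assoc_mat)
  also have "\<dots> = (M - c \<cdot>\<^sub>m M') * A"
    using M lin.prems by (intro minus_mult_distrib_mat[symmetric]) auto
  finally show ?case .
qed simp

lemma mat_fun_symmetric:
  "mat_fun n A f M \<Longrightarrow> A \<in> carrier_mat n n \<Longrightarrow> transpose_mat A = A \<Longrightarrow> transpose_mat M = M"
proof (induction rule: mat_fun.induct)
  case (mult f M)
  note M = mat_fun_carrier[OF mult.hyps mult.prems(1)]
  have "transpose_mat (A * M) = M * A"
    using mult.prems M mult.IH[OF mult.prems] by (subst transpose_mult[of A n n M n]) auto
  then show ?case using mat_fun_commute[OF mult.hyps mult.prems(1)] by simp
next
  case (lin f M g M' c)
  note M = mat_fun_carrier[OF lin.hyps(1) lin.prems(1)] mat_fun_carrier[OF lin.hyps(2) lin.prems(1)]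
  have e: "M $$ (j, i) = M $$ (i, j)" "M' $$ (j, i) = M' $$ (i, j)" if "i < n" "j < n" for i j
    using arg_cong[OF lin.IH(1)[OF lin.prems], of "\<lambda>X. X $$ (i, j)"]
      arg_cong[OF lin.IH(2)[OF lin.prems], of "\<lambda>X. X $$ (i, j)"] that M by auto
  show ?case using M by (intro eq_matI) (auto simp: e)
qed auto

text \<open>Constant row sums say that the all-ones vector is an eigenvector, and f(A) acts on it as
  f(k).\<close>

lemma mat_fun_row_sum:
  assumes "mat_fun n A f M" "A \<in> carrier_mat n n" "\<And>i. i < n \<Longrightarrow> (\<Sum>j<n. A $$ (i, j)) = k" "i < n"
  shows "(\<Sum>j<n. M $$ (i, j)) = f k"
  using assms
proof (induction arbitrary: i rule: mat_fun.induct)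
  case one
  have "(\<Sum>j<n. 1\<^sub>m n $$ (i, j)) = (\<Sum>j<n. if j = i then 1 else (0::real))"
    using one by (intro sum.cong) auto
  then show ?case using one by simp
next
  case (mult f M)
  note M = mat_fun_carrier[OF mult.hyps mult.prems(1)]
  have "(\<Sum>j<n. (A * M) $$ (i, j)) = (\<Sum>j<n. \<Sum>l<n. A $$ (i, l) * M $$ (l, j))"
    using M mult.prems by (intro sum.cong refl) (simp add: scalar_prod_def lessThan_atLeast0)
  also have "\<dots> = (\<Sum>l<n. A $$ (i, l) * (\<Sum>j<n. M $$ (l, j)))"
    by (subst sum.swap) (simp add: sum_distrib_left)
  also have "\<dots> = (\<Sum>l<n. A $$ (i, l) * f k)"
    using mult.IH[OF mult.prems(1,2)] by (intro sum.cong refl) simp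
  also have "\<dots> = k * f k" using mult.prems by (simp add: sum_distrib_right[symmetric])
  finally show ?case .
next
  case (lin f M g M' c)
  note M = mat_fun_carrier[OF lin.hyps(1) lin.prems(1)] mat_fun_carrier[OF lin.hyps(2) lin.prems(1)]
  show ?case using M lin.prems lin.IH(1)[OF lin.prems] lin.IH(2)[OF lin.prems]
    by (simp add: sum_subtractf sum_distrib_left[symmetric])
qed

text \<open>One conjugation serves all polynomials in A at once, and on upper triangular matrices
  the diagonal is multiplicative. The diagonal of T therefore carries f of the eigenvalues.\<close>

lemma mat_fun_triangularize:
  assumes "mat_fun n A f M" and A: "A \<in> carrier_mat n n" and wit: "similar_mat_wit A B P Q"
    and ut: "upper_triangular B"
  shows "\<exists>T. T \<in> carrier_mat n n \<and> upper_triangular T \<and> M = P * T * Q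
           \<and> (\<forall>i<n. T $$ (i, i) = f (B $$ (i, i)))"
  using assms(1)
proof (induction rule: mat_fun.induct)
  have c: "B \<in> carrier_mat n n" "P \<in> carrier_mat n n" "Q \<in> carrier_mat n n"
    and PQ: "P * Q = 1\<^sub>m n" "Q * P = 1\<^sub>m n" and AP: "A = P * B * Q"
    using similar_mat_witD2[OF A wit] by auto
  {
    case one
    show ?case using c PQ by (intro exI[of _ "1\<^sub>m n"]) auto
  next
    case (mult f M)
    then obtain T where T: "T \<in> carrier_mat n n" "upper_triangular T" "M = P * T * Q"
      "\<forall>i<n. T $$ (i, i) = f (B $$ (i, i))" by blast
    have ix: "(B * T) $$ (i, j) = (\<Sum>l<n. B $$ (i, l) * T $$ (l, j))" if "i < n" "j < n" for i j
      using that c T(1) by (simp add: scalar_prod_def lessThan_atLeast0)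
    have z: "B $$ (i, l) = 0" "T $$ (i, l) = 0" if "l < i" "i < n" for i l
      using ut T(1,2) c that unfolding upper_triangular_def by auto
    have "upper_triangular (B * T)"
      unfolding upper_triangular_def
    proof (intro allI impI)
      fix i j assume "i < dim_row (B * T)" "j < i"
      then have ij: "i < n" "j < n" "j < i" using c by auto
      show "(B * T) $$ (i, j) = 0" unfolding ix[OF ij(1,2)]
        by (rule sum.neutral) (metis ij z lessThan_iff mult_eq_0_iff not_less_iff_gr_or_eq less_trans)
    qed
    moreover have "(B * T) $$ (i, i) = B $$ (i, i) * f (B $$ (i, i))" if "i < n" for i
    proof -
      have "(B * T) $$ (i, i) = (\<Sum>l<n. if l = i then B $$ (i, l) * T $$ (l, i) else 0)"
        unfolding ix[OF that that]
        by (rule sum.cong) (use z that in \<open>auto simp: not_less_iff_gr_or_eq neq_iff\<close>)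
      then show ?thesis using that T(4) by simp
    qed
    moreover have "A * M = P * (B * T) * Q"
    proof -
      have "A * M = (P * B * Q) * (P * T * Q)" using AP T(3) by simp
      also have "\<dots> = P * B * (Q * P) * T * Q"
        using c T(1) by (simp add: assoc_mult_mat[of _ n n _ n _ n])
      also have "\<dots> = P * (B * T) * Q"
        using c T(1) unfolding PQ by (simp add: assoc_mult_mat[of _ n n _ n _ n])
      finally show ?thesis .
    qed
    ultimately show ?case using c T(1) by (intro exI[of _ "B * T"]) auto
  next
    case (lin f M g M' e)
    then obtain T T' where T: "T \<in> carrier_mat n n" "upper_triangular T" "M = P * T * Q"
      "\<forall>i<n. T $$ (i, i) = f (B $$ (i, i))"
      and T': "T' \<in> carrier_mat n n" "upper_triangular T'" "M' = P * T' * Q"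
      "\<forall>i<n. T' $$ (i, i) = g (B $$ (i, i))" by blast
    have "P * (T - e \<cdot>\<^sub>m T') * Q = (P * T - P * (e \<cdot>\<^sub>m T')) * Q"
      using c T T' by (subst mult_minus_distrib_mat) auto
    also have "\<dots> = P * T * Q - P * (e \<cdot>\<^sub>m T') * Q"
      using c T T' by (subst minus_mult_distrib_mat) auto
    also have "P * (e \<cdot>\<^sub>m T') * Q = e \<cdot>\<^sub>m (P * T' * Q)"
      using c T T' by (simp add: mult_smult_distrib[of _ n n _ n] mult_smult_assoc_mat[of _ n n _ n] del: assoc_mult_mat)
    finally have "M - e \<cdot>\<^sub>m M' = P * (T - e \<cdot>\<^sub>m T') * Q" using T T' by simp
    moreover have "upper_triangular (T - e \<cdot>\<^sub>m T')"
      using T(1,2) T'(1,2) unfolding upper_triangular_def by auto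
    ultimately show ?case using T T' by (intro exI[of _ "T - e \<cdot>\<^sub>m T'"]) auto
  }
qed

lemma trace_mult_commute:
  fixes X Y :: "real mat"
  assumes "X \<in> carrier_mat n n" "Y \<in> carrier_mat n n"
  shows "(\<Sum>i<n. (X * Y) $$ (i, i)) = (\<Sum>i<n. (Y * X) $$ (i, i))"
proof -
  have "(\<Sum>i<n. (X * Y) $$ (i, i)) = (\<Sum>i<n. \<Sum>j<n. X $$ (i, j) * Y $$ (j, i))"
    using assms by (intro sum.cong refl) (simp add: scalar_prod_def lessThan_atLeast0)
  also have "\<dots> = (\<Sum>i<n. \<Sum>j<n. Y $$ (i, j) * X $$ (j, i))"
    by (subst sum.swap) (simp add: mult.commute)
  also have "\<dots> = (\<Sum>i<n. (Y * X) $$ (i, i))"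
    using assms by (intro sum.cong refl) (simp add: scalar_prod_def lessThan_atLeast0)
  finally show ?thesis .
qed

text \<open>Since M is symmetric, its squared norm is the trace of M * M. The trace is invariant
  under conjugation, and for T * T it sees only the diagonal of T, so orthogonality of the change of
  basis does not enter.\<close>

lemma mat_fun_frobenius:
  assumes M: "mat_fun n A f M" and A: "A \<in> carrier_mat n n" and sym: "transpose_mat A = A"
    and es: "char_poly A = (\<Prod>e\<leftarrow>es. [:- e, 1:])"
  shows "(\<Sum>i<n. \<Sum>j<n. (M $$ (i, j))\<^sup>2) = (\<Sum>e\<leftarrow>es. (f e)\<^sup>2)"
proof -
  obtain B P Q where BPQ: "schur_decomposition A es = (B, P, Q)" by (cases "schur_decomposition A es") auto
  note sd = schur_decomposition[OF A es BPQ]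
  then have wit: "similar_mat_wit A B P Q" and ut: "upper_triangular B" and dg: "diag_mat B = es" by auto
  have c: "B \<in> carrier_mat n n" "P \<in> carrier_mat n n" "Q \<in> carrier_mat n n"
    and PQ: "Q * P = 1\<^sub>m n"
    using similar_mat_witD2[OF A wit] by auto
  note Mc = mat_fun_carrier[OF M A]
  obtain T where T: "T \<in> carrier_mat n n" "upper_triangular T" "M = P * T * Q"
      "\<forall>i<n. T $$ (i, i) = f (B $$ (i, i))" using mat_fun_triangularize[OF M A wit ut] by blast
  have z: "T $$ (i, l) = 0" if "l < i" "i < n" for i l
    using T(1,2) that unfolding upper_triangular_def by auto
  have s: "M $$ (j, i) = M $$ (i, j)" if "i < n" "j < n" for i j
    using arg_cong[OF mat_fun_symmetric[OF M A sym], of "\<lambda>X. X $$ (i, j)"] that Mc by auto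
  have "(\<Sum>i<n. \<Sum>j<n. (M $$ (i, j))\<^sup>2) = (\<Sum>i<n. (M * M) $$ (i, i))"
    using Mc by (intro sum.cong refl) (simp add: scalar_prod_def lessThan_atLeast0 s power2_eq_square)
  also have "M * M = P * (T * T * Q)"
  proof -
    have "M * M = P * T * (Q * P) * T * Q"
      unfolding T(3) using c T(1) by (simp add: assoc_mult_mat[of _ n n _ n _ n])
    then show ?thesis unfolding PQ using c T(1) by (simp add: assoc_mult_mat[of _ n n _ n _ n])
  qed
  also have "(\<Sum>i<n. (P * (T * T * Q)) $$ (i, i)) = (\<Sum>i<n. (T * T * Q * P) $$ (i, i))"
    using c T(1) by (intro trace_mult_commute) auto
  also have "T * T * Q * P = T * T"
    using c T(1) by (simp add: assoc_mult_mat[of _ n n _ n _ n] PQ)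
  also have "(\<Sum>i<n. (T * T) $$ (i, i)) = (\<Sum>i<n. (f (B $$ (i, i)))\<^sup>2)"
  proof (intro sum.cong refl)
    fix i assume i: "i \<in> {..<n}"
    have "(T * T) $$ (i, i) = (\<Sum>l<n. T $$ (i, l) * T $$ (l, i))"
      using i T(1) by (simp add: scalar_prod_def lessThan_atLeast0)
    also have "\<dots> = (\<Sum>l<n. if l = i then T $$ (i, l) * T $$ (l, i) else 0)"
      by (rule sum.cong) (use z i in \<open>auto simp: neq_iff\<close>)
    finally show "(T * T) $$ (i, i) = (f (B $$ (i, i)))\<^sup>2"
      using i T(4) by (simp add: power2_eq_square)
  qed
  also have "\<dots> = (\<Sum>e\<leftarrow>es. (f e)\<^sup>2)"
    unfolding dg[symmetric] diag_mat_def using c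
    by (simp add: sum_list_sum_nth lessThan_atLeast0)
  finally show ?thesis .
qed


section \<open>Regular graphs and the spectrum of their adjacency matrix\<close>

lemma pair_graph_basics:
  assumes "pair_graph G"
  shows "finite (pverts G)" "finite (parcs G)" "(u, v) \<in> parcs G \<Longrightarrow> u \<in> pverts G"
    "(u, v) \<in> parcs G \<Longrightarrow> v \<in> pverts G" "(u, u) \<notin> parcs G"
    "(u, v) \<in> parcs G \<longleftrightarrow> (v, u) \<in> parcs G"
proof -
  interpret pair_graph G by fact
  show "finite (pverts G)" "finite (parcs G)" "(u, v) \<in> parcs G \<Longrightarrow> u \<in> pverts G"
    "(u, v) \<in> parcs G \<Longrightarrow> v \<in> pverts G"
    using wellformed' by auto
  show "(u, u) \<notin> parcs G" using no_loops by force
  show "(u, v) \<in> parcs G \<longleftrightarrow> (v, u) \<in> parcs G" using arcs_symmetric by auto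
qed

lemma regular_graph_neighbours:
  assumes "regular_graph k G" "u \<in> pverts G"
  shows "finite {v. (u, v) \<in> parcs G}" "card {v. (u, v) \<in> parcs G} = k"
proof -
  have G: "pair_graph G" "out_degree (with_proj G) u = k" using assms unfolding regular_graph_def by auto
  have e: "{v. (u, v) \<in> parcs G} = snd ` out_arcs (with_proj G) u"
    by (force simp: out_arcs_def)
  have "finite (out_arcs (with_proj G) u)"
    using pair_graph_basics(2)[OF G(1)] by (simp add: out_arcs_def)
  then show "finite {v. (u, v) \<in> parcs G}" unfolding e by simp
  have "inj_on snd (out_arcs (with_proj G) u)" by (auto simp: inj_on_def out_arcs_def)
  then show "card {v. (u, v) \<in> parcs G} = k" unfolding e using G(2)
    by (simp add: card_image out_degree_def)
qed

text \<open>This is the same choice term as inside \<open>adjacency_matrix\<close>, so both refer to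
  one enumeration.\<close>

definition vertex_list :: "'a pair_pre_digraph \<Rightarrow> 'a list" where
  "vertex_list G = (SOME vs. distinct vs \<and> set vs = pverts G)"

lemma vertex_list:
  assumes "pair_graph G"
  shows "distinct (vertex_list G)" "set (vertex_list G) = pverts G"
    "length (vertex_list G) = card (pverts G)"
    "bij_betw ((!) (vertex_list G)) {..<card (pverts G)} (pverts G)"
proof -
  have "\<exists>vs. distinct vs \<and> set vs = pverts G"
    using finite_distinct_list[OF pair_graph_basics(1)[OF assms]] by blast
  from someI_ex[OF this] show a: "distinct (vertex_list G)" "set (vertex_list G) = pverts G"
    unfolding vertex_list_def by auto
  then show b: "length (vertex_list G) = card (pverts G)" using distinct_card by metis
  show "bij_betw ((!) (vertex_list G)) {..<card (pverts G)} (pverts G)"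
    by (rule bij_betw_nth) (use a b in auto)
qed

lemma adjacency_matrix_index:
  "i < card (pverts G) \<Longrightarrow> j < card (pverts G) \<Longrightarrow>
    adjacency_matrix G $$ (i, j) = (if (vertex_list G ! i, vertex_list G ! j) \<in> parcs G then 1 else 0)"
  "adjacency_matrix G \<in> carrier_mat (card (pverts G)) (card (pverts G))"
  unfolding adjacency_matrix_def vertex_list_def Let_def by auto

lemma adjacency_matrix_row_sum:
  assumes "regular_graph k G" "i < card (pverts G)"
  shows "(\<Sum>j<card (pverts G). adjacency_matrix G $$ (i, j)) = real k"
proof -
  have G: "pair_graph G" using assms(1) by (simp add: regular_graph_def)
  let ?u = "vertex_list G ! i"
  have u: "?u \<in> pverts G" using vertex_list[OF G] assms(2) by (metis nth_mem)
  have "(\<Sum>j<card (pverts G). adjacency_matrix G $$ (i, j))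
      = (\<Sum>j<card (pverts G). if (?u, vertex_list G ! j) \<in> parcs G then 1 else 0)"
    using assms(2) by (intro sum.cong refl) (simp add: adjacency_matrix_index)
  also have "\<dots> = (\<Sum>v\<in>pverts G. if (?u, v) \<in> parcs G then 1 else 0)"
    by (rule sum.reindex_bij_betw[OF vertex_list(4)[OF G]])
  also have "\<dots> = real (card {v \<in> pverts G. (?u, v) \<in> parcs G})"
    using pair_graph_basics(1)[OF G] by (simp add: sum.If_cases Int_def)
  also have "{v \<in> pverts G. (?u, v) \<in> parcs G} = {v. (?u, v) \<in> parcs G}"
    using pair_graph_basics(4)[OF G] by blast
  finally show ?thesis using regular_graph_neighbours(2)[OF assms(1) u] by simp
qed

lemma proots_linear_factors: "proots (\<Prod>e\<leftarrow>es. [:- e, 1::real:]) = mset es"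
proof (induction es)
  case (Cons e es)
  have "(\<Prod>e\<leftarrow>es. [:- e, 1::real:]) \<noteq> 0" by (auto simp: prod_list_zero_iff)
  then have "proots ([:- e, 1:] * (\<Prod>e\<leftarrow>es. [:- e, 1::real:])) = add_mset e (mset es)"
    by (subst proots_mult) (use Cons in \<open>simp_all del: mult_pCons_left mult_pCons_right\<close>)
  then show ?case by (simp only: list.map prod_list.Cons mset.simps)
qed simp

text \<open>The eigenvalue k contributes the square of f(k) and the other n-1 eigenvalues at most
  the square of R each. Subtracting f(k)/n from every entry removes exactly the first contribution,
  because all row sums are f(k).\<close>

lemma regular_graph_frobenius_bound:
  assumes reg: "regular_graph k G" and n: "n = card (pverts G)" "n > 0"
    and lam: "expansion G \<le> lam" "lam < real k"
    and M: "mat_fun n (adjacency_matrix G) f M"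
    and R: "\<And>x. \<bar>x\<bar> \<le> lam \<Longrightarrow> \<bar>f x\<bar> \<le> R"
  shows "(\<Sum>i<n. \<Sum>j<n. (M $$ (i, j))\<^sup>2) \<le> (f (real k))\<^sup>2 + real n * R\<^sup>2"
    and "(\<Sum>i<n. \<Sum>j<n. (M $$ (i, j) - f (real k) / real n)\<^sup>2) \<le> real n * R\<^sup>2"
proof -
  let ?A = "adjacency_matrix G"
  have G: "pair_graph G" using reg by (simp add: regular_graph_def)
  have A: "?A \<in> carrier_mat n n" using adjacency_matrix_index(2) n by auto
  have s: "?A $$ (i, j) = ?A $$ (j, i)" if "i < n" "j < n" for i j
    using that pair_graph_basics(6)[OF G] n by (simp add: adjacency_matrix_index)
  have symm: "transpose_mat ?A = ?A" using A by (intro eq_matI) (auto simp: s)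
  have rs: "(\<Sum>j<n. ?A $$ (i, j)) = real k" if "i < n" for i
    using adjacency_matrix_row_sum[OF reg] that n by simp
  obtain es where es: "char_poly ?A = (\<Prod>e\<leftarrow>es. [:- e, 1:])" "length es = n"
    using symmetric_char_poly_splits[OF A s] by blast
  have "?A *\<^sub>v Matrix.vec n (\<lambda>_. 1) = real k \<cdot>\<^sub>v Matrix.vec n (\<lambda>_. 1)"
    using A rs by (intro eq_vecI) (auto simp: scalar_prod_def lessThan_atLeast0)
  moreover have "Matrix.vec n (\<lambda>_. 1) \<noteq> (0\<^sub>v n :: real vec)"
  proof
    assume "Matrix.vec n (\<lambda>_. 1) = (0\<^sub>v n :: real vec)"
    from arg_cong[OF this, of "\<lambda>v. vec_index v 0"] n(2) show False by simp
  qed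
  ultimately have "eigenvalue ?A (real k)"
    using A unfolding eigenvalue_def eigenvector_def
    by (intro exI[of _ "Matrix.vec n (\<lambda>_. 1)"]) auto
  then have "poly (char_poly ?A) (real k) = 0" using eigenvalue_root_char_poly[OF A] by simp
  then have k: "real k \<in> set es"
    unfolding es(1) poly_prod_list by (auto simp: prod_list_zero_iff)
  define ds where "ds = adjacency_eigenvalues G"
  have ds: "ds = rev (sort es)"
    unfolding ds_def adjacency_eigenvalues_def es(1) proots_linear_factors by simp
  have len: "length ds = n" using es(2) by (simp add: ds)
  have mono: "ds ! i \<ge> ds ! j" if "i \<le> j" "j < n" for i j
    using that len unfolding ds by (auto simp: rev_nth intro!: sorted_nth_mono)
  have e: "ds ! 1 \<le> lam" "\<bar>last ds\<bar> \<le> lam" using lam(1) unfolding expansion_def ds_def by auto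
  \<comment> \<open>From position 1 on, the sorted eigenvalues lie between the last and the second
    one, both controlled by \<open>expansion\<close>.\<close>
  have bnd: "\<bar>ds ! i\<bar> \<le> lam" if "1 \<le> i" "i < n" for i
  proof -
    have "ds ! i \<le> lam" using mono[of 1 i] that e by linarith
    moreover have "last ds = ds ! (n - 1)" using len that by (subst last_conv_nth) auto
    then have "ds ! i \<ge> - lam" using mono[of i "n - 1"] that e(2) by linarith
    ultimately show ?thesis by simp
  qed
  have "real k \<in> set ds" using k by (simp add: ds)
  then obtain j where j: "j < n" "ds ! j = real k" using len by (auto simp: in_set_conv_nth)
  \<comment> \<open>The eigenvalue k exceeds \<open>lam\<close>, so it can occupy no position but
    the first.\<close>
  have "j = 0" using bnd[of j] j lam(2) by (cases j) auto
  then have ds0: "ds ! 0 = real k" using j by simp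
  have "(\<Sum>e\<leftarrow>es. (f e)\<^sup>2) = (\<Sum>e\<in>#mset es. (f e)\<^sup>2)" by (metis mset_map sum_mset_sum_list)
  also have "mset es = mset ds" by (simp add: ds)
  also have "(\<Sum>e\<in>#mset ds. (f e)\<^sup>2) = (\<Sum>i<n. (f (ds ! i))\<^sup>2)"
    by (subst mset_map[symmetric], subst sum_mset_sum_list)
       (simp add: sum_list_sum_nth len lessThan_atLeast0)
  also have "\<dots> = (f (real k))\<^sup>2 + (\<Sum>i\<in>{..<n} - {0}. (f (ds ! i))\<^sup>2)"
    using n(2) by (subst sum.remove[of _ 0]) (auto simp: ds0)
  also have "(\<Sum>i\<in>{..<n} - {0}. (f (ds ! i))\<^sup>2) \<le> (\<Sum>i\<in>{..<n} - {0}. R\<^sup>2)"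
    using R[OF bnd] by (intro sum_mono) (auto simp: abs_le_square_iff[symmetric] intro: order.trans[OF _ abs_ge_self])
  also have "\<dots> \<le> real n * R\<^sup>2" using n(2) by (auto simp: algebra_simps)
  finally have E: "(\<Sum>e\<leftarrow>es. (f e)\<^sup>2) \<le> (f (real k))\<^sup>2 + real n * R\<^sup>2" by simp
  show F: "(\<Sum>i<n. \<Sum>j<n. (M $$ (i, j))\<^sup>2) \<le> (f (real k))\<^sup>2 + real n * R\<^sup>2"
    using E mat_fun_frobenius[OF M A symm es(1)] by simp
  let ?c = "f (real k) / real n"
  have r: "(\<Sum>j<n. M $$ (i, j)) = f (real k)" if "i < n" for i
    using mat_fun_row_sum[OF M A rs] that by simp
  have "(\<Sum>i<n. \<Sum>j<n. (M $$ (i, j) - ?c)\<^sup>2)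
      = (\<Sum>i<n. (\<Sum>j<n. (M $$ (i, j))\<^sup>2) - 2 * ?c * (\<Sum>j<n. M $$ (i, j)) + real n * ?c\<^sup>2)"
  proof (intro sum.cong refl)
    fix i
    have "(\<Sum>j<n. (M $$ (i, j) - ?c)\<^sup>2) = (\<Sum>j<n. (M $$ (i, j))\<^sup>2 - 2 * ?c * M $$ (i, j) + ?c\<^sup>2)"
      by (intro sum.cong refl) (simp add: power2_diff)
    then show "(\<Sum>j<n. (M $$ (i, j) - ?c)\<^sup>2)
        = (\<Sum>j<n. (M $$ (i, j))\<^sup>2) - 2 * ?c * (\<Sum>j<n. M $$ (i, j)) + real n * ?c\<^sup>2"
      by (simp only: sum.distrib sum_subtractf sum_distrib_left) simp
  qed
  also have "\<dots> = (\<Sum>i<n. (\<Sum>j<n. (M $$ (i, j))\<^sup>2) - 2 * ?c * f (real k) + real n * ?c\<^sup>2)"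
    by (intro sum.cong refl) (simp add: r)
  also have "\<dots> = (\<Sum>i<n. \<Sum>j<n. (M $$ (i, j))\<^sup>2) - (f (real k))\<^sup>2"
  proof -
    have "- (2 * ?c * f (real k)) + real n * ?c\<^sup>2 = - ((f (real k))\<^sup>2 / real n)"
      using n(2) by (simp add: power2_eq_square field_simps)
    then have "(\<Sum>j<n. (M $$ (i, j))\<^sup>2) - 2 * ?c * f (real k) + real n * ?c\<^sup>2
        = (\<Sum>j<n. (M $$ (i, j))\<^sup>2) - (f (real k))\<^sup>2 / real n" for i by linarith
    then show ?thesis using n(2) by (simp only: sum_subtractf) simp
  qed
  finally show "(\<Sum>i<n. \<Sum>j<n. (M $$ (i, j) - ?c)\<^sup>2) \<le> real n * R\<^sup>2" using F by linarith
qed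

section \<open>Polynomials of non-backtracking path counts\<close>

text \<open>Here d stands for k-1. The clause for t = 2 subtracts d+1 because a single step can be
  undone at each of the k neighbours; later only k-1 of them matter, and the recurrence has constant
  coefficients from t = 1 on.\<close>

fun nb_poly :: "real \<Rightarrow> nat \<Rightarrow> real \<Rightarrow> real" where
  "nb_poly d 0 x = 1"
| "nb_poly d (Suc 0) x = x"
| "nb_poly d (Suc (Suc 0)) x = x * x - (d + 1)"
| "nb_poly d (Suc (Suc (Suc t))) x = x * nb_poly d (Suc (Suc t)) x - d * nb_poly d (Suc t) x"

text \<open>The products such as \<open>A * 1\<^sub>m n\<close> are left unsimplified to match the
  constructors of \<open>mat_fun\<close> literally.\<close>

fun nb_mat :: "nat \<Rightarrow> real \<Rightarrow> real mat \<Rightarrow> nat \<Rightarrow> real mat" where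
  "nb_mat n d A 0 = 1\<^sub>m n"
| "nb_mat n d A (Suc 0) = A * 1\<^sub>m n"
| "nb_mat n d A (Suc (Suc 0)) = A * (A * 1\<^sub>m n) - (d + 1) \<cdot>\<^sub>m 1\<^sub>m n"
| "nb_mat n d A (Suc (Suc (Suc t))) = A * nb_mat n d A (Suc (Suc t)) - d \<cdot>\<^sub>m nb_mat n d A (Suc t)"

lemma mat_fun_nb: "mat_fun n A (nb_poly d t) (nb_mat n d A t)"
proof (induction n d A t rule: nb_mat.induct)
  case (1 n d A)
  have "nb_poly d 0 = (\<lambda>_. 1)" by auto
  then show ?case using mat_fun.one by simp
next
  case (2 n d A)
  have "mat_fun n A (\<lambda>x. x * 1) (A * 1\<^sub>m n)" by (intro mat_fun.intros)
  moreover have "nb_poly d (Suc 0) = (\<lambda>x. x * 1)" by auto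
  ultimately show ?case by simp
next
  case (3 n d A)
  have "mat_fun n A (\<lambda>x. x * (x * 1) - (d + 1) * 1) (A * (A * 1\<^sub>m n) - (d + 1) \<cdot>\<^sub>m 1\<^sub>m n)"
    by (intro mat_fun.intros)
  moreover have "nb_poly d (Suc (Suc 0)) = (\<lambda>x. x * (x * 1) - (d + 1) * 1)" by auto
  ultimately show ?case by simp
next
  case (4 n d A t)
  have "mat_fun n A (\<lambda>x. x * nb_poly d (Suc (Suc t)) x - d * nb_poly d (Suc t) x) (nb_mat n d A (Suc (Suc (Suc t))))"
    unfolding nb_mat.simps by (intro mat_fun.intros 4)
  then show ?case by simp
qed

text \<open>With d = k-1 this is k (k-1)^t, the number of all non-backtracking paths of length t+1
  from a vertex.\<close>

lemma nb_poly_eval: "nb_poly d (Suc t) (d + 1) = (d + 1) * d ^ t"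
  by (induction t rule: induct_nat_012) (auto simp: algebra_simps)

text \<open>The differences a(t+1) - z a(t) are multiplied by w in each step; bounding them and then
  unrolling gives the claim. The factor t+1 is the price of allowing a double root z = w.\<close>

lemma linear_recurrence_bound:
  fixes a :: "nat \<Rightarrow> complex"
  assumes rec: "\<And>t. a (Suc (Suc t)) = (z + w) * a (Suc t) - z * w * a t"
    and "cmod z \<le> r" "cmod w \<le> r" "r \<ge> 1"
  shows "cmod (a t) \<le> real (t + 1) * (cmod (a 1) + r * cmod (a 0)) * r ^ t"
proof -
  define M where "M = cmod (a 1) + r * cmod (a 0)"
  have M0: "M \<ge> 0" using assms by (simp add: M_def)
  have d: "cmod (a (Suc t) - z * a t) \<le> r ^ t * M" for t
  proof (induction t)
    case 0
    have "cmod (a 1 - z * a 0) \<le> cmod (a 1) + cmod z * cmod (a 0)"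
      by (metis norm_mult norm_triangle_ineq4)
    also have "\<dots> \<le> M" unfolding M_def using assms by (simp add: mult_right_mono)
    finally show ?case by simp
  next
    case (Suc t)
    have "a (Suc (Suc t)) - z * a (Suc t) = w * (a (Suc t) - z * a t)" by (simp add: rec algebra_simps)
    then have "cmod (a (Suc (Suc t)) - z * a (Suc t)) = cmod w * cmod (a (Suc t) - z * a t)"
      by (simp add: norm_mult)
    also have "\<dots> \<le> r * (r ^ t * M)" using Suc assms by (intro mult_mono) auto
    finally show ?case by simp
  qed
  have "cmod (a t) \<le> real (t + 1) * M * r ^ t"
  proof (induction t)
    case 0
    have "cmod (a 0) \<le> r * cmod (a 0)" using assms by (simp add: mult_le_cancel_right1)
    then have "cmod (a 0) \<le> cmod (a 1) + r * cmod (a 0)" by (simp add: add_increasing)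
    then show ?case by (simp add: M_def)
  next
    case (Suc t)
    have "cmod (a (Suc t)) \<le> cmod (a (Suc t) - z * a t) + cmod z * cmod (a t)"
      by (metis norm_mult norm_triangle_sub add.commute)
    also have "\<dots> \<le> r ^ t * M + r * (real (t + 1) * M * r ^ t)"
      using d Suc assms by (intro add_mono mult_mono) auto
    also have "r ^ t * M \<le> r ^ Suc t * M"
      using M0 assms by (intro mult_right_mono power_increasing) auto
    finally show ?case by (simp add: algebra_simps)
  qed
  then show ?thesis by (simp add: M_def)
qed

text \<open>A nonpositive discriminant gives a conjugate pair of modulus sqrt d. Otherwise the roots
  are real, and their modulus is at most the larger root belonging to the endpoint
  \<open>lam\<close>.\<close>

lemma real_quadratic_roots:
  assumes "d > 1" "2 * sqrt d \<le> lam" "\<bar>x\<bar> \<le> lam"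
  defines "r \<equiv> (lam + sqrt (lam\<^sup>2 - 4 * d)) / 2"
  shows "\<exists>z w. z + w = complex_of_real x \<and> z * w = complex_of_real d \<and> cmod z \<le> r \<and> cmod w \<le> r"
proof -
  have l2: "lam\<^sup>2 \<ge> 4 * d"
    using power_mono[OF assms(2), of 2] assms(1) by (simp add: power_mult_distrib)
  have x2: "x\<^sup>2 \<le> lam\<^sup>2" using assms(3) by (simp add: abs_le_square_iff[symmetric])
  define D where "D = 4 * d - x\<^sup>2"
  show ?thesis
  proof (cases "D \<ge> 0")
    case True
    define z where "z = Complex (x / 2) (sqrt D / 2)"
    have "(cmod z)\<^sup>2 = d" unfolding z_def cmod_power2 using True by (simp add: D_def power_divide field_simps)
    then have cz: "cmod z = sqrt d" by (metis norm_ge_zero real_sqrt_unique)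
    have "z * cnj z = complex_of_real d"
      using cz assms(1) by (metis complex_norm_square \<open>(cmod z)\<^sup>2 = d\<close>)
    moreover have "z + cnj z = complex_of_real x" by (simp add: z_def complex_eq_iff)
    moreover have "sqrt d \<le> r" unfolding r_def using assms(2) l2 by (simp add: add_increasing2)
    ultimately show ?thesis using cz by (intro exI[of _ z] exI[of _ "cnj z"]) auto
  next
    case False
    define s where "s = sqrt (x\<^sup>2 - 4 * d)"
    have s2: "s\<^sup>2 = x\<^sup>2 - 4 * d" using False by (simp add: s_def D_def)
    have s0: "s \<ge> 0" "s \<le> sqrt (lam\<^sup>2 - 4 * d)" using False x2 by (auto simp: s_def D_def)
    have "(x + s) / 2 + (x - s) / 2 = x" by (simp add: field_simps)
    moreover have "(x + s) / 2 * ((x - s) / 2) = d"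
      using s2 by (simp add: field_simps power2_eq_square)
    moreover have "\<bar>(x + s) / 2\<bar> \<le> r" "\<bar>(x - s) / 2\<bar> \<le> r"
    proof -
      have "\<bar>x + s\<bar> \<le> lam + sqrt (lam\<^sup>2 - 4 * d)" "\<bar>x - s\<bar> \<le> lam + sqrt (lam\<^sup>2 - 4 * d)"
        using s0 assms(3) by linarith+
      then show "\<bar>(x + s) / 2\<bar> \<le> r" "\<bar>(x - s) / 2\<bar> \<le> r" by (simp_all add: r_def)
    qed
    ultimately show ?thesis
      by (intro exI[of _ "complex_of_real ((x + s) / 2)"] exI[of _ "complex_of_real ((x - s) / 2)"] conjI)
         (simp_all only: norm_of_real of_real_add[symmetric] of_real_mult[symmetric])
  qed
qed

text \<open>The characteristic roots at x have modulus at most r, the larger root at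
  \<open>lam'\<close>, and r < d is equivalent to the gap \<open>lam'\<close> < d+1. Raising
  \<open>lam\<close> to at least 2 sqrt d keeps r real.\<close>

lemma nb_poly_bound:
  assumes d: "d > 1" and lam: "lam < d + 1"
  shows "\<exists>C \<sigma>. 0 < \<sigma> \<and> \<sigma> < 1 \<and> C > 0 \<and>
     (\<forall>t x. \<bar>x\<bar> \<le> lam \<longrightarrow> \<bar>nb_poly d t x\<bar> \<le> C * \<sigma> ^ t * d ^ t)"
proof -
  define lam' where "lam' = max lam (2 * sqrt d)"
  have "(sqrt d - 1)\<^sup>2 > 0" using d by simp
  then have "2 * sqrt d < d + 1" using d by (simp add: power2_diff)
  then have lam': "lam' < d + 1" "2 * sqrt d \<le> lam'" "lam \<le> lam'" using lam by (auto simp: lam'_def)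
  have l0: "lam' > 0" using lam' d by (smt (verit) real_sqrt_gt_0_iff)
  define r where "r = (lam' + sqrt (lam'\<^sup>2 - 4 * d)) / 2"
  have l2: "lam'\<^sup>2 \<ge> 4 * d"
    using power_mono[OF lam'(2), of 2] d by (simp add: power_mult_distrib)
  have r1: "r \<ge> 1"
  proof -
    have "sqrt d \<ge> 1" using d by simp
    then have "lam' \<ge> 2" using lam' by linarith
    moreover have "sqrt (lam'\<^sup>2 - 4 * d) \<ge> 0" using l2 by simp
    ultimately have "2 \<le> lam' + sqrt (lam'\<^sup>2 - 4 * d)" by linarith
    then show ?thesis by (simp add: r_def)
  qed
  have "lam'\<^sup>2 - 4 * d < (2 * d - lam')\<^sup>2"
  proof -
    \<comment> \<open>After expanding the squares the claim is just \<open>lam'\<close> <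
      d+1.\<close>
    have "d * lam' < d * (d + 1)" using lam'(1) d by simp
    then show ?thesis by (simp add: power2_eq_square algebra_simps)
  qed
  then have "sqrt (lam'\<^sup>2 - 4 * d) < \<bar>2 * d - lam'\<bar>" by (metis real_sqrt_abs real_sqrt_less_iff)
  then have "lam' + sqrt (lam'\<^sup>2 - 4 * d) < 2 * d" using lam'(1) d by linarith
  then have rd: "r < d" by (simp add: r_def)
  \<comment> \<open>Half of the decay is sacrificed: (r/d)^t is \<sigma>^t times \<sigma>^t, and one
    of the two factors absorbs t+1.\<close>
  define \<sigma> where "\<sigma> = sqrt (r / d)"
  have s: "0 < \<sigma>" "\<sigma> < 1" using rd r1 d by (auto simp: \<sigma>_def)
  have s2: "\<sigma>\<^sup>2 = r / d" using r1 d by (simp add: \<sigma>_def)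
  define M where "M = (d + 1) * (d + 1) + (d + 1) + r * (d + 1)"
  have M0: "M > 0" using d r1 by (simp add: M_def add_pos_pos)
  have geo: "real (t + 1) * \<sigma> ^ t \<le> 1 / (1 - \<sigma>)" for t
  proof -
    have "real (t + 1) * \<sigma> ^ t = (\<Sum>i<Suc t. \<sigma> ^ t)" by simp
    also have "\<dots> \<le> (\<Sum>i<Suc t. \<sigma> ^ i)" using s by (intro sum_mono power_decreasing) auto
    also have "\<dots> = (1 - \<sigma> ^ Suc t) / (1 - \<sigma>)" using s by (subst sum_gp_strict) auto
    also have "\<dots> \<le> 1 / (1 - \<sigma>)" using s by (intro divide_right_mono) auto
    finally show ?thesis .
  qed
  have main: "\<bar>nb_poly d (Suc t) x\<bar> \<le> M / (1 - \<sigma>) * \<sigma> ^ t * d ^ t" if x: "\<bar>x\<bar> \<le> lam" for t x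
  proof -
    have xl: "\<bar>x\<bar> \<le> lam'" using x lam' by simp
    obtain z w where zw: "z + w = complex_of_real x" "z * w = complex_of_real d" "cmod z \<le> r" "cmod w \<le> r"
      using real_quadratic_roots[OF d lam'(2) xl] unfolding r_def by blast
    have "cmod (complex_of_real (nb_poly d (Suc t) x)) \<le>
      real (t + 1) * (cmod (complex_of_real (nb_poly d (Suc 1) x)) + r * cmod (complex_of_real (nb_poly d (Suc 0) x))) * r ^ t"
      by (rule linear_recurrence_bound[OF _ zw(3,4) r1]) (simp add: zw(1,2))
    also have "\<dots> = real (t + 1) * (\<bar>x * x - (d + 1)\<bar> + r * \<bar>x\<bar>) * r ^ t" by (simp del: of_real_diff of_real_mult)
    also have "\<dots> \<le> real (t + 1) * M * r ^ t"
    proof -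
      have x1: "\<bar>x\<bar> \<le> d + 1" using xl lam' by linarith
      have "\<bar>x * x\<bar> \<le> (d + 1) * (d + 1)" unfolding abs_mult using x1 by (intro mult_mono) auto
      then have "\<bar>x * x - (d + 1)\<bar> \<le> (d + 1) * (d + 1) + (d + 1)" using d by linarith
      moreover have "r * \<bar>x\<bar> \<le> r * (d + 1)" using x1 r1 by simp
      ultimately have "\<bar>x * x - (d + 1)\<bar> + r * \<bar>x\<bar> \<le> M" unfolding M_def by linarith
      then show ?thesis using r1 by (intro mult_right_mono mult_left_mono) auto
    qed
    also have "r ^ t = \<sigma> ^ t * \<sigma> ^ t * d ^ t"
    proof -
      have "r = \<sigma> * \<sigma> * d" using s2 d by (simp add: power2_eq_square)
      then show ?thesis by (simp add: power_mult_distrib)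
    qed
    also have "real (t + 1) * M * (\<sigma> ^ t * \<sigma> ^ t * d ^ t) = M * (real (t + 1) * \<sigma> ^ t) * (\<sigma> ^ t * d ^ t)" by simp
    also have "\<dots> \<le> M * (1 / (1 - \<sigma>)) * (\<sigma> ^ t * d ^ t)"
      using geo[of t] M0 s d by (intro mult_right_mono mult_left_mono) auto
    finally show ?thesis by (simp add: field_simps)
  qed
  \<comment> \<open>Division by \<sigma> d shifts the bound from exponent t to t+1; the summand 1
    covers t = 0.\<close>
  define C where "C = M / (1 - \<sigma>) / (\<sigma> * d) + 1"
  have C: "C > 0" "C \<ge> 1" "C \<ge> M / (1 - \<sigma>) / (\<sigma> * d)" using M0 s d by (auto simp: C_def intro!: add_nonneg_pos)
  have "\<bar>nb_poly d t x\<bar> \<le> C * \<sigma> ^ t * d ^ t" if x: "\<bar>x\<bar> \<le> lam" for t x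
  proof (cases t)
    case 0
    then show ?thesis using C by simp
  next
    case (Suc u)
    have "M / (1 - \<sigma>) * \<sigma> ^ u * d ^ u = M / (1 - \<sigma>) / (\<sigma> * d) * (\<sigma> ^ t * d ^ t)"
      using s d Suc by simp
    also have "\<dots> \<le> C * (\<sigma> ^ t * d ^ t)" using C s d by (intro mult_right_mono) auto
    finally show ?thesis using main[OF x, of u] Suc by simp
  qed
  then show ?thesis using s C by blast
qed


section \<open>Loads\<close>

declare load.simps(2) [simp del]

lemma load_step:
  "\<exists>c\<in>{w1 ! t, w2 ! t}. load tie w1 w2 (Suc t) = (load tie w1 w2 t)(c := Suc (load tie w1 w2 t c)) \<and>
     load tie w1 w2 t c \<le> load tie w1 w2 t (w1 ! t) \<and> load tie w1 w2 t c \<le> load tie w1 w2 t (w2 ! t)"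
  by (auto simp: Let_def not_less load.simps(2))

lemma load_Suc_cases:
  obtains c where "c = w1 ! t \<or> c = w2 ! t"
    "\<And>v. load tie w1 w2 (Suc t) v = (if v = c then Suc (load tie w1 w2 t v) else load tie w1 w2 t v)"
    "load tie w1 w2 t c \<le> load tie w1 w2 t (w1 ! t)" "load tie w1 w2 t c \<le> load tie w1 w2 t (w2 ! t)"
  using load_step[of w1 t w2 tie] by fastforce

lemma load_mono: "s \<le> t \<Longrightarrow> load tie w1 w2 s v \<le> load tie w1 w2 t v"
proof (induction t rule: dec_induct)
  case (step t)
  have "load tie w1 w2 t v \<le> load tie w1 w2 (Suc t) v"
    by (rule load_Suc_cases[of w1 t w2 tie]) simp
  then show ?case using step.IH by linarith
qed simp

lemma load_crossing:
  assumes "m < load tie w1 w2 t v"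
  obtains s where "s < t" "load tie w1 w2 s v = m" "load tie w1 w2 (Suc s) v = Suc m"
proof -
  have "\<exists>s<t. load tie w1 w2 s v = m \<and> load tie w1 w2 (Suc s) v = Suc m"
    using assms
  proof (induction t)
    case (Suc t)
    show ?case
    proof (cases "m < load tie w1 w2 t v")
      case True
      then show ?thesis using Suc.IH less_SucI by blast
    next
      case False
      have "load tie w1 w2 (Suc t) v \<le> Suc (load tie w1 w2 t v)"
        by (rule load_Suc_cases[of w1 t w2 tie]) simp
      then have "load tie w1 w2 t v = m" "load tie w1 w2 (Suc t) v = Suc m"
        using False Suc.prems by linarith+
      then show ?thesis by blast
    qed
  qed simp
  then show ?thesis using that by blast
qed

lemma load_increase:
  assumes "load tie w1 w2 (Suc t) v \<noteq> load tie w1 w2 t v"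
  shows "v = w1 ! t \<or> v = w2 ! t"
    "load tie w1 w2 t v \<le> load tie w1 w2 t (w1 ! t)" "load tie w1 w2 t v \<le> load tie w1 w2 t (w2 ! t)"
proof -
  obtain c where c: "c = w1 ! t \<or> c = w2 ! t"
    "load tie w1 w2 (Suc t) v = (if v = c then Suc (load tie w1 w2 t v) else load tie w1 w2 t v)"
    "load tie w1 w2 t c \<le> load tie w1 w2 t (w1 ! t)" "load tie w1 w2 t c \<le> load tie w1 w2 t (w2 ! t)"
    by (rule load_Suc_cases[of w1 t w2 tie]) blast
  then have "v = c" using assms by metis
  with c show "v = w1 ! t \<or> v = w2 ! t" "load tie w1 w2 t v \<le> load tie w1 w2 t (w1 ! t)"
    "load tie w1 w2 t v \<le> load tie w1 w2 t (w2 ! t)" by auto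
qed

lemma load_cong:
  assumes "take t w1 = take t w1'" "take t w2 = take t w2'"
    "t \<le> length w1" "t \<le> length w2" "t \<le> length w1'" "t \<le> length w2'"
  shows "load tie w1 w2 t = load tie w1' w2' t"
  using assms
proof (induction t)
  case (Suc t)
  have "take t w1 = take t w1'" "take t w2 = take t w2'"
    using arg_cong[OF Suc.prems(1), of "take t"] arg_cong[OF Suc.prems(2), of "take t"]
    by (simp_all add: min_def)
  then have "load tie w1 w2 t = load tie w1' w2' t" using Suc by simp
  moreover have "w1 ! t = w1' ! t" "w2 ! t = w2' ! t"
    using arg_cong[OF Suc.prems(1), of "\<lambda>xs. xs ! t"] arg_cong[OF Suc.prems(2), of "\<lambda>xs. xs ! t"]
    by simp_all
  moreover have "take (Suc t) (zip w1 w2) = take (Suc t) (zip w1' w2')"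
    using Suc.prems(1,2) by (simp add: take_zip)
  ultimately show ?case by (simp only: load.simps Let_def)
qed simp

lemma sum_load_le: "finite F \<Longrightarrow> (\<Sum>v\<in>F. load tie w1 w2 t v) \<le> t"
proof (induction t)
  case (Suc t)
  obtain c where c: "\<And>v. load tie w1 w2 (Suc t) v = (if v = c then Suc (load tie w1 w2 t v) else load tie w1 w2 t v)"
    by (rule load_Suc_cases[of w1 t w2 tie]) blast
  have "(\<Sum>v\<in>F. load tie w1 w2 (Suc t) v) = (\<Sum>v\<in>F. load tie w1 w2 t v + (if v = c then 1 else 0))"
    by (intro sum.cong refl) (subst c, simp)
  also have "\<dots> \<le> (\<Sum>v\<in>F. load tie w1 w2 t v) + 1"
    using Suc.prems by (simp add: sum.distrib)
  finally show ?case using Suc by linarith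
qed simp

definition heavy :: "(('a \<times> 'a) list \<Rightarrow> bool) \<Rightarrow> nat \<Rightarrow> nat \<Rightarrow> 'a list \<Rightarrow> 'a list \<Rightarrow> 'a set" where
  "heavy tie i t w1 w2 = {v. i \<le> load tie w1 w2 t v}"

lemma heavy_mono: "s \<le> t \<Longrightarrow> heavy tie i s w1 w2 \<subseteq> heavy tie i t w1 w2"
  unfolding heavy_def by (auto intro: le_trans[OF _ load_mono])

text \<open>The ball that lifts the load of v from i-1 to i must fall into the window. This is what
  permits freezing the heavy set at an earlier time.\<close>

lemma heavy_new:
  assumes "v \<in> heavy tie i t w1 w2" "v \<notin> heavy tie i s w1 w2"
  shows "\<exists>j. s \<le> j \<and> j < t \<and> (v = w1 ! j \<or> v = w2 ! j)"
proof -
  have s: "load tie w1 w2 s v < i" and t: "i - 1 < load tie w1 w2 t v"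
    using assms unfolding heavy_def by auto
  obtain j where j: "j < t" "load tie w1 w2 j v = i - 1" "load tie w1 w2 (Suc j) v = Suc (i - 1)"
    by (rule load_crossing[OF t])
  have "s \<le> j"
  proof (rule ccontr)
    assume "\<not> s \<le> j"
    then have "load tie w1 w2 (Suc j) v \<le> load tie w1 w2 s v" by (intro load_mono) simp
    with j(3) s show False by linarith
  qed
  moreover have "v = w1 ! j \<or> v = w2 ! j" using load_increase(1)[of tie w1 w2 j v] j by simp
  ultimately show ?thesis using j(1) by blast
qed

lemma finite_heavy:
  assumes "i > 0" shows "finite (heavy tie i t w1 w2)"
proof (rule finite_subset)
  show "heavy tie i t w1 w2 \<subseteq> (\<lambda>j. w1 ! j) ` {..<t} \<union> (\<lambda>j. w2 ! j) ` {..<t}"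
  proof
    fix v assume "v \<in> heavy tie i t w1 w2"
    moreover have "v \<notin> heavy tie i 0 w1 w2" using assms by (simp add: heavy_def)
    ultimately show "v \<in> (\<lambda>j. w1 ! j) ` {..<t} \<union> (\<lambda>j. w2 ! j) ` {..<t}" using heavy_new by fastforce
  qed
qed simp

lemma card_heavy_le:
  assumes "i > 0" shows "i * card (heavy tie i t w1 w2) \<le> t"
proof -
  have "i * card (heavy tie i t w1 w2) = (\<Sum>v\<in>heavy tie i t w1 w2. i)" by simp
  also have "\<dots> \<le> (\<Sum>v\<in>heavy tie i t w1 w2. load tie w1 w2 t v)"
    by (intro sum_mono) (simp add: heavy_def)
  also have "\<dots> \<le> t" by (rule sum_load_le[OF finite_heavy[OF assms]])
  finally show ?thesis .
qed

text \<open>When a bin receives its ball number i+1 it has load i and is the less loaded of the two,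
  so both walks sit in bins of load at least i. Each time serves only one bin, so distinct bins use
  distinct times.\<close>

lemma card_heavy_Suc_le:
  "card (heavy tie (Suc i) t w1 w2)
     \<le> card {s. s < t \<and> w1 ! s \<in> heavy tie i s w1 w2 \<and> w2 ! s \<in> heavy tie i s w1 w2}"
proof -
  let ?T = "{s. s < t \<and> w1 ! s \<in> heavy tie i s w1 w2 \<and> w2 ! s \<in> heavy tie i s w1 w2}"
  have "\<exists>c. \<forall>v. load tie w1 w2 (Suc s) v = (if v = c then Suc (load tie w1 w2 s v) else load tie w1 w2 s v)" for s
    by (rule load_Suc_cases[of w1 s w2 tie]) blast
  then obtain c where c: "\<And>s v. load tie w1 w2 (Suc s) v = (if v = c s then Suc (load tie w1 w2 s v) else load tie w1 w2 s v)"
    by metis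
  have "heavy tie (Suc i) t w1 w2 \<subseteq> c ` ?T"
  proof
    fix v assume "v \<in> heavy tie (Suc i) t w1 w2"
    then have "i < load tie w1 w2 t v" by (simp add: heavy_def)
    then obtain s where s: "s < t" "load tie w1 w2 s v = i" "load tie w1 w2 (Suc s) v = Suc i"
      using load_crossing by metis
    then have "v = c s" using c[of s v] by (metis n_not_Suc_n)
    moreover have "s \<in> ?T"
      using load_increase(2,3)[of tie w1 w2 s v] s unfolding heavy_def mem_Collect_eq by linarith
    ultimately show "v \<in> c ` ?T" by blast
  qed
  then have "card (heavy tie (Suc i) t w1 w2) \<le> card (c ` ?T)" by (intro card_mono) auto
  also have "\<dots> \<le> card ?T" by (intro card_image_le) auto
  finally show ?thesis .
qed

definition high_visit :: "(('a \<times> 'a) list \<Rightarrow> bool) \<Rightarrow> nat \<Rightarrow> 'a \<Rightarrow> nat \<Rightarrow> 'a list \<Rightarrow> 'a list \<Rightarrow> bool" where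
  "high_visit tie i v t w1 w2 \<longleftrightarrow>
     (w1 ! t = v \<and> w2 ! t \<in> heavy tie i t w1 w2) \<or> (w2 ! t = v \<and> w1 ! t \<in> heavy tie i t w1 w2)"

text \<open>Index j means j+1 times satisfying Y, the last one at t and successive ones at least l
  apart. The recursion peels off the last time, which suits conditioning on the past.\<close>

primrec visit_chain :: "nat \<Rightarrow> (nat \<Rightarrow> bool) \<Rightarrow> nat \<Rightarrow> nat \<Rightarrow> bool" where
  "visit_chain l Y 0 t \<longleftrightarrow> Y t"
| "visit_chain l Y (Suc j) t \<longleftrightarrow> Y t \<and> (\<exists>s. s + l \<le> t \<and> visit_chain l Y j s)"

text \<open>Among three consecutive balls in a bin two are brought by the same walk, which needs at least
  \<open>l\<close> steps to return.\<close>

lemma load_imp_visit_chain: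
  assumes gap: "\<And>j j'. j < j' \<Longrightarrow> j' < n \<Longrightarrow> w1 ! j = w1 ! j' \<Longrightarrow> j + l \<le> j'"
      "\<And>j j'. j < j' \<Longrightarrow> j' < n \<Longrightarrow> w2 ! j = w2 ! j' \<Longrightarrow> j + l \<le> j'"
    and "i + 2 * K < load tie w1 w2 n v"
  shows "\<exists>t<n. visit_chain l (\<lambda>t. high_visit tie i v t w1 w2) K t"
proof -
  have ball: "v = w1 ! t \<or> v = w2 ! t" "i \<le> load tie w1 w2 t v \<Longrightarrow> high_visit tie i v t w1 w2"
    if "load tie w1 w2 (Suc t) v = Suc (load tie w1 w2 t v)" for t
    using load_increase[of tie w1 w2 t v] that
    unfolding high_visit_def heavy_def by auto
  have "visit_chain l (\<lambda>t. high_visit tie i v t w1 w2) j t"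
    if "t < n" "load tie w1 w2 t v = i + 2 * j" "load tie w1 w2 (Suc t) v = Suc (i + 2 * j)" for j t
    using that
  proof (induction j arbitrary: t)
    case 0
    then show ?case using ball(2)[of t] by simp
  next
    case (Suc j)
    have "Suc (i + 2 * j) < load tie w1 w2 t v" using Suc.prems by simp
    then obtain t2 where t2: "t2 < t" "load tie w1 w2 t2 v = Suc (i + 2 * j)"
      "load tie w1 w2 (Suc t2) v = Suc (Suc (i + 2 * j))" using load_crossing by metis
    have "i + 2 * j < load tie w1 w2 t2 v" using t2 by simp
    then obtain t1 where t1: "t1 < t2" "load tie w1 w2 t1 v = i + 2 * j"
      "load tie w1 w2 (Suc t1) v = Suc (i + 2 * j)" using load_crossing by metis
    have c: "visit_chain l (\<lambda>t. high_visit tie i v t w1 w2) j t1"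
      using t1 t2 Suc.prems by (intro Suc.IH) auto
    have v: "v = w1 ! t \<or> v = w2 ! t" "v = w1 ! t2 \<or> v = w2 ! t2" "v = w1 ! t1 \<or> v = w2 ! t1"
      using ball(1)[of t] ball(1)[of t1] ball(1)[of t2] t1 t2 Suc.prems by simp_all
    have lt: "t1 < t2" "t2 < t" "t1 < t" "t < n" "t2 < n" using t1 t2 Suc.prems by auto
    have "t1 + l \<le> t"
    proof -
      have "t1 + l \<le> t2 \<or> t2 + l \<le> t \<or> t1 + l \<le> t"
        using v gap(1)[OF lt(1,5)] gap(1)[OF lt(2,4)] gap(1)[OF lt(3,4)]
          gap(2)[OF lt(1,5)] gap(2)[OF lt(2,4)] gap(2)[OF lt(3,4)] by metis
      then show ?thesis using lt by linarith
    qed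
    moreover have "high_visit tie i v t w1 w2" using Suc.prems by (intro ball(2)) auto
    ultimately show ?case using c by auto
  qed
  moreover obtain t where "t < n" "load tie w1 w2 t v = i + 2 * K" "load tie w1 w2 (Suc t) v = Suc (i + 2 * K)"
    using load_crossing[OF assms(3)] by metis
  ultimately show ?thesis by blast
qed

section \<open>Pairs of walks\<close>

lemma prob_bind_le:
  assumes "\<And>x. x \<in> set_pmf M \<Longrightarrow> P x \<Longrightarrow> measure_pmf.prob (f x) X \<le> c"
    "\<And>x. x \<in> set_pmf M \<Longrightarrow> \<not> P x \<Longrightarrow> measure_pmf.prob (f x) X = 0" "c \<ge> 0"
  shows "measure_pmf.prob (bind_pmf M f) X \<le> c * measure_pmf.prob M {x. P x}"
proof -
  have "emeasure (bind_pmf M f) X = (\<integral>\<^sup>+x. emeasure (f x) X \<partial>M)" by simp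
  also have "\<dots> \<le> (\<integral>\<^sup>+x. ennreal c * indicator {x. P x} x \<partial>M)"
  proof (intro nn_integral_mono_AE AE_pmfI)
    fix x assume "x \<in> set_pmf M"
    then show "emeasure (f x) X \<le> ennreal c * indicator {x. P x} x"
      using assms(1,2)[of x] by (cases "P x") (auto simp: measure_pmf.emeasure_eq_measure intro: ennreal_leI)
  qed
  also have "\<dots> = ennreal c * emeasure M {x. P x}" by (simp add: nn_integral_cmult)
  also have "\<dots> = ennreal (c * measure_pmf.prob M {x. P x})"
    using assms(3) by (simp add: measure_pmf.emeasure_eq_measure ennreal_mult)
  finally show ?thesis using assms(3) by (simp add: measure_pmf.emeasure_eq_measure)
qed

lemma prob_bind_le_const:
  assumes "\<And>x. x \<in> set_pmf M \<Longrightarrow> measure_pmf.prob (f x) X \<le> c"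
  shows "measure_pmf.prob (bind_pmf M f) X \<le> c"
proof -
  have "c \<ge> 0" using assms set_pmf_not_empty[of M] measure_nonneg order.trans by blast
  then show ?thesis using prob_bind_le[of M "\<lambda>_. True" f X c] assms by simp
qed

lemma prob_pair_le:
  assumes "\<And>x. x \<in> set_pmf M \<Longrightarrow> P x \<Longrightarrow> measure_pmf.prob N {y. Q x y} \<le> c" "c \<ge> 0"
  shows "measure_pmf.prob (pair_pmf M N) {(x, y). P x \<and> Q x y} \<le> c * measure_pmf.prob M {x. P x}"
proof -
  have "pair_pmf M N = bind_pmf M (\<lambda>x. map_pmf (Pair x) N)"
    by (simp add: pair_pmf_def map_pmf_def)
  moreover have "measure_pmf.prob (bind_pmf M (\<lambda>x. map_pmf (Pair x) N)) {(x, y). P x \<and> Q x y}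
      \<le> c * measure_pmf.prob M {x. P x}"
    by (rule prob_bind_le) (use assms in \<open>auto simp: vimage_def\<close>)
  ultimately show ?thesis by simp
qed

lemma prob_pair_swap:
  "measure_pmf.prob (pair_pmf M N) {(x, y). R x y} = measure_pmf.prob (pair_pmf N M) {(y, x). R x y}"
  by (subst pair_commute_pmf) (auto simp: vimage_def case_prod_beta intro!: arg_cong[where f = "measure_pmf.prob _"])

lemma pair_pmf_bind:
  "pair_pmf (bind_pmf A f) (bind_pmf B g) = bind_pmf (pair_pmf A B) (\<lambda>(x, y). pair_pmf (f x) (g y))"
  unfolding pair_pmf_def
proof -
  have "bind_pmf (bind_pmf A f) (\<lambda>x. bind_pmf (bind_pmf B g) (\<lambda>y. return_pmf (x, y)))
      = bind_pmf A (\<lambda>a. bind_pmf (f a) (\<lambda>x. bind_pmf B (\<lambda>b. bind_pmf (g b) (\<lambda>y. return_pmf (x, y)))))"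
    by (simp only: bind_assoc_pmf)
  also have "\<dots> = bind_pmf A (\<lambda>a. bind_pmf B (\<lambda>b. bind_pmf (f a) (\<lambda>x. bind_pmf (g b) (\<lambda>y. return_pmf (x, y)))))"
    by (subst bind_commute_pmf) (rule refl)
  also have "\<dots> = bind_pmf (bind_pmf A (\<lambda>a. bind_pmf B (\<lambda>b. return_pmf (a, b))))
      (\<lambda>(a, b). bind_pmf (f a) (\<lambda>x. bind_pmf (g b) (\<lambda>y. return_pmf (x, y))))"
    by (simp only: bind_assoc_pmf bind_return_pmf prod.case)
  finally show "bind_pmf (bind_pmf A f) (\<lambda>x. bind_pmf (bind_pmf B g) (\<lambda>y. return_pmf (x, y)))
    = bind_pmf (bind_pmf A (\<lambda>x. bind_pmf B (\<lambda>y. return_pmf (x, y))))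
       (\<lambda>(x, y). bind_pmf (f x) (\<lambda>x. bind_pmf (g y) (\<lambda>y. return_pmf (x, y))))" .
qed

lemma prob_Un_le: "measure_pmf.prob M {x. P x \<or> Q x} \<le> measure_pmf.prob M {x. P x} + measure_pmf.prob M {x. Q x}"
proof -
  have "{x. P x \<or> Q x} = {x. P x} \<union> {x. Q x}" by auto
  then show ?thesis by (simp add: measure_Un_le)
qed

lemma prob_Ex_le:
  assumes "finite I" "\<And>i. i \<in> I \<Longrightarrow> measure_pmf.prob M {x. P i x} \<le> c"
  shows "measure_pmf.prob M {x. \<exists>i\<in>I. P i x} \<le> real (card I) * c"
proof -
  have "{x. \<exists>i\<in>I. P i x} = (\<Union>i\<in>I. {x. P i x})" by auto
  then have "measure_pmf.prob M {x. \<exists>i\<in>I. P i x} \<le> (\<Sum>i\<in>I. measure_pmf.prob M {x. P i x})"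
    using measure_pmf.finite_measure_subadditive_finite[OF assms(1), of "\<lambda>i. {x. P i x}" M] by simp
  also have "\<dots> \<le> real (card I) * c" using assms(2) by (intro sum_bounded_above) auto
  finally show ?thesis .
qed

lemma prob_mono_support:
  assumes "\<And>x. x \<in> set_pmf M \<Longrightarrow> P x \<Longrightarrow> Q x"
  shows "measure_pmf.prob M {x. P x} \<le> measure_pmf.prob M {x. Q x}"
  by (rule measure_pmf.finite_measure_mono_AE) (use assms in \<open>auto intro!: AE_pmfI\<close>)

section \<open>Laws of trajectories and events determined by their past\<close>

primrec walk_ext :: "('a list \<Rightarrow> 'a pmf) \<Rightarrow> nat \<Rightarrow> 'a list \<Rightarrow> 'a list pmf" where
  "walk_ext st 0 xs = return_pmf xs"
| "walk_ext st (Suc r) xs = bind_pmf (walk_ext st r xs) (\<lambda>ys. map_pmf (\<lambda>v. ys @ [v]) (st ys))"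

lemma walk_ext_add: "walk_ext st (r + s) xs = bind_pmf (walk_ext st r xs) (walk_ext st s)"
  by (induction s) (simp_all add: bind_assoc_pmf bind_return_pmf')

lemma walk_ext_prefix:
  "zs \<in> set_pmf (walk_ext st r xs) \<Longrightarrow> length zs = length xs + r \<and> take (length xs) zs = xs"
proof (induction r arbitrary: zs)
  case (Suc r)
  then obtain ys v where "ys \<in> set_pmf (walk_ext st r xs)" "zs = ys @ [v]" by auto
  then show ?case using Suc.IH[of ys] by auto
qed simp


text \<open>This replaces a filtration: the truth of P depends only on the first t positions, that
  is, on times 0 to t-1. Information up to and including time t is
  \<open>determined (Suc t)\<close>.\<close>

definition determined :: "nat \<Rightarrow> ('a list \<Rightarrow> 'a list \<Rightarrow> bool) \<Rightarrow> bool" where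
  "determined t P \<longleftrightarrow> (\<forall>xs ys xs' ys'. t \<le> length xs \<longrightarrow> t \<le> length ys \<longrightarrow> t \<le> length xs' \<longrightarrow> t \<le> length ys' \<longrightarrow>
     take t xs = take t xs' \<longrightarrow> take t ys = take t ys' \<longrightarrow> P xs ys = P xs' ys')"

lemma determinedD:
  "determined t P \<Longrightarrow> t \<le> length xs \<Longrightarrow> t \<le> length ys \<Longrightarrow> t \<le> length xs' \<Longrightarrow> t \<le> length ys' \<Longrightarrow>
     take t xs = take t xs' \<Longrightarrow> take t ys = take t ys' \<Longrightarrow> P xs ys = P xs' ys'"
  unfolding determined_def by blast

lemma determined_mono: 
  assumes "determined s P" "s \<le> t" shows "determined t P"
  unfolding determined_def
proof (intro allI impI)
  fix xs ys xs' ys' :: "'a list"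
  assume a: "t \<le> length xs" "t \<le> length ys" "t \<le> length xs'" "t \<le> length ys'"
    "take t xs = take t xs'" "take t ys = take t ys'"
  have "take s xs = take s xs'" "take s ys = take s ys'"
    using arg_cong[OF a(5), of "take s"] arg_cong[OF a(6), of "take s"] assms(2)
    by (simp_all add: min_def split: if_splits)
  then show "P xs ys = P xs' ys'" using determinedD[OF assms(1)] a assms(2) by simp
qed

lemma determined_conj: "determined t P \<Longrightarrow> determined t Q \<Longrightarrow> determined t (\<lambda>x y. P x y \<and> Q x y)"
  and determined_neg: "determined t P \<Longrightarrow> determined t (\<lambda>x y. \<not> P x y)"
  and determined_ex: "(\<And>i. determined t (R i)) \<Longrightarrow> determined t (\<lambda>x y. \<exists>i. R i x y)"
  and determined_const: "determined t (\<lambda>x y. b)"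
  unfolding determined_def by meson+

text \<open>Loads at time t count the balls placed before t, so they depend on t positions only; the
  visits made at time t need one position more.\<close>

lemma determined_heavy: "determined t (\<lambda>x y. F (heavy tie i t x y))"
  unfolding determined_def heavy_def
proof (intro allI impI)
  fix xs ys xs' ys' :: "'a list"
  assume "t \<le> length xs" "t \<le> length ys" "t \<le> length xs'" "t \<le> length ys'"
    "take t xs = take t xs'" "take t ys = take t ys'"
  then have "load tie xs ys t = load tie xs' ys' t" by (intro load_cong)
  then show "F {v. i \<le> load tie xs ys t v} = F {v. i \<le> load tie xs' ys' t v}" by simp
qed

lemma determined_nth:
  assumes "j < t"
  shows "determined t (\<lambda>x y. F (x ! j) (y ! j))"
  unfolding determined_def
proof (intro allI impI)
  fix xs ys xs' ys' :: "'a list"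
  assume a: "t \<le> length xs" "t \<le> length ys" "t \<le> length xs'" "t \<le> length ys'"
    "take t xs = take t xs'" "take t ys = take t ys'"
  have "xs ! j = xs' ! j" "ys ! j = ys' ! j"
    using nth_take[OF assms, of xs] nth_take[OF assms, of xs'] nth_take[OF assms, of ys] nth_take[OF assms, of ys'] a(5,6)
    by simp_all
  then show "F (xs ! j) (ys ! j) = F (xs' ! j) (ys' ! j)" by simp
qed

lemma determined_both_heavy: "determined (Suc t) (\<lambda>x y. x ! t \<in> heavy tie i t x y \<and> y ! t \<in> heavy tie i t x y)"
  and determined_high_visit: "determined (Suc t) (high_visit tie i v t)"
proof -
  have *: "determined (Suc t) (\<lambda>x y. F (x ! t) (y ! t) (heavy tie i t x y))" for F :: "'a \<Rightarrow> 'a \<Rightarrow> 'a set \<Rightarrow> bool"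
    unfolding determined_def
  proof (intro allI impI)
    fix xs ys xs' ys' :: "'a list"
    assume a: "Suc t \<le> length xs" "Suc t \<le> length ys" "Suc t \<le> length xs'" "Suc t \<le> length ys'"
      "take (Suc t) xs = take (Suc t) xs'" "take (Suc t) ys = take (Suc t) ys'"
    have "F (xs ! t) (ys ! t) S = F (xs' ! t) (ys' ! t) S" for S
      using determinedD[OF determined_nth[of t "Suc t" "\<lambda>x y. F x y S"] a] by simp
    moreover have "heavy tie i t xs ys = heavy tie i t xs' ys'"
      using determinedD[OF determined_mono[OF determined_heavy[of t "\<lambda>S. S = heavy tie i t xs' ys'" tie i] le_SucI[OF order.refl]] a] by simp
    ultimately show "F (xs ! t) (ys ! t) (heavy tie i t xs ys) = F (xs' ! t) (ys' ! t) (heavy tie i t xs' ys')" by simp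
  qed
  show "determined (Suc t) (\<lambda>x y. x ! t \<in> heavy tie i t x y \<and> y ! t \<in> heavy tie i t x y)"
    by (rule *)
  show "determined (Suc t) (high_visit tie i v t)"
    unfolding high_visit_def[abs_def] using *[of "\<lambda>x y S. (x = v \<and> y \<in> S) \<or> (y = v \<and> x \<in> S)"] by simp
qed

lemma determined_visit_chain:
  assumes "\<And>t. determined (Suc t) (Y t)" "l > 0"
  shows "determined (Suc t) (\<lambda>x y. visit_chain l (\<lambda>t. Y t x y) j t)"
proof (induction j arbitrary: t)
  case 0
  then show ?case using assms by simp
next
  case (Suc j)
  have "determined (Suc t) (\<lambda>x y. s + l \<le> t \<and> visit_chain l (\<lambda>t. Y t x y) j s)" for s
  proof (cases "s + l \<le> t")
    case True
    then show ?thesis using determined_mono[OF Suc, of s "Suc t"] by simp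
  qed (simp add: determined_const)
  from determined_conj[OF assms(1) determined_ex[OF this]] show ?case by simp
qed

text \<open>All that the load analysis uses about the graph: a bounds hitting a vertex after l steps
  (from the girth), q after L steps (from mixing), and no return happens in fewer than l steps.
  Every bound is conditional on an entire reachable trajectory.\<close>

locale walk_pair =
  fixes st :: "'a list \<Rightarrow> 'a pmf" and init :: "'a list pmf" and tie :: "('a \<times> 'a) list \<Rightarrow> bool"
    and l L :: nat and a q :: real
  assumes init_length: "xs \<in> set_pmf init \<Longrightarrow> length xs = 1"
    and hit_l: "xs \<in> set_pmf (bind_pmf init (walk_ext st t)) \<Longrightarrow>
      measure_pmf.prob (walk_ext st l xs) {zs. last zs = v} \<le> a"
    and hit_L: "xs \<in> set_pmf (bind_pmf init (walk_ext st t)) \<Longrightarrow>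
      measure_pmf.prob (walk_ext st L xs) {zs. last zs = v} \<le> q"
    and gap: "xs \<in> set_pmf (bind_pmf init (walk_ext st t)) \<Longrightarrow> j < j' \<Longrightarrow> j' \<le> t \<Longrightarrow> xs ! j = xs ! j' \<Longrightarrow> j + l \<le> j'"
    and pos: "l > 0" "L > 0" "a \<ge> 0" "q \<ge> 0"
begin

abbreviation "walk t \<equiv> bind_pmf init (walk_ext st t)"

definition "W t = pair_pmf (walk t) (walk t)"

definition "W_ext r xs ys = pair_pmf (walk_ext st r xs) (walk_ext st r ys)"

lemma walk_add: "walk (t + r) = bind_pmf (walk t) (walk_ext st r)"
  unfolding bind_assoc_pmf by (intro bind_pmf_cong refl walk_ext_add)

lemma walk_length: "xs \<in> set_pmf (walk t) \<Longrightarrow> length xs = Suc t"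
  using init_length walk_ext_prefix by fastforce

lemma walk_ext_walk: "xs \<in> set_pmf (walk t) \<Longrightarrow> zs \<in> set_pmf (walk_ext st r xs) \<Longrightarrow> zs \<in> set_pmf (walk (t + r))"
  unfolding walk_add by auto

lemma W_add: "W (t + r) = bind_pmf (W t) (\<lambda>(xs, ys). W_ext r xs ys)"
  unfolding W_def W_ext_def walk_add by (rule pair_pmf_bind)

lemma W_ext_determined:
  assumes "xs \<in> set_pmf (walk t)" "ys \<in> set_pmf (walk t)" "(x, y) \<in> set_pmf (W_ext r xs ys)" "determined (Suc t) A"
  shows "A x y = A xs ys"
proof -
  have x: "length x = length xs + r" "take (length xs) x = xs" "length y = length ys + r" "take (length ys) y = ys"
    using assms(3) walk_ext_prefix unfolding W_ext_def by fastforce+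
  have "length xs = Suc t" "length ys = Suc t" using walk_length assms by auto
  then show ?thesis using x by (intro determinedD[OF assms(4)]) auto
qed

text \<open>The tower rule: A is constant on all extensions of a given pair of trajectories, so it
  factors out of the conditional probability.\<close>

lemma prob_W_cond:
  assumes A: "determined (Suc t) A" and "c \<ge> 0"
    and B: "\<And>xs ys. xs \<in> set_pmf (walk t) \<Longrightarrow> ys \<in> set_pmf (walk t) \<Longrightarrow> A xs ys \<Longrightarrow>
      measure_pmf.prob (W_ext r xs ys) {(x, y). B x y} \<le> c"
  shows "measure_pmf.prob (W (t + r)) {(x, y). A x y \<and> B x y} \<le> c * measure_pmf.prob (W t) {(x, y). A x y}"
proof -
  have "measure_pmf.prob (W (t + r)) {(x, y). A x y \<and> B x y} \<le> c * measure_pmf.prob (W t) {w. case w of (x, y) \<Rightarrow> A x y}"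
    unfolding W_add
  proof (rule prob_bind_le[OF _ _ assms(2)])
    fix w assume "w \<in> set_pmf (W t)" "case w of (x, y) \<Rightarrow> A x y"
    then obtain xs ys where w: "w = (xs, ys)" "xs \<in> set_pmf (walk t)" "ys \<in> set_pmf (walk t)" "A xs ys"
      unfolding W_def by (cases w) auto
    have "measure_pmf.prob (W_ext r xs ys) {(x, y). A x y \<and> B x y} \<le> measure_pmf.prob (W_ext r xs ys) {(x, y). B x y}"
      by (intro measure_pmf.finite_measure_mono) auto
    then show "measure_pmf.prob (case w of (xs, ys) \<Rightarrow> W_ext r xs ys) {(x, y). A x y \<and> B x y} \<le> c"
      using B[OF w(2-4)] w(1) by simp
  next
    fix w assume "w \<in> set_pmf (W t)" "\<not> (case w of (x, y) \<Rightarrow> A x y)"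
    then obtain xs ys where w: "w = (xs, ys)" "xs \<in> set_pmf (walk t)" "ys \<in> set_pmf (walk t)" "\<not> A xs ys"
      unfolding W_def by (cases w) auto
    then have "set_pmf (W_ext r xs ys) \<inter> {(x, y). A x y \<and> B x y} = {}"
      using W_ext_determined[OF w(2,3) _ A] by auto
    then show "measure_pmf.prob (case w of (xs, ys) \<Rightarrow> W_ext r xs ys) {(x, y). A x y \<and> B x y} = 0"
      using w(1) by (simp add: measure_pmf_zero_iff)
  qed
  then show ?thesis by simp
qed

text \<open>\<open>prob_W_cond\<close> with c = 1 gives one inequality for A and one for its
  negation; complements turn the second into the missing direction.\<close>

lemma prob_W_marginal:
  assumes A: "determined (Suc t) A"
  shows "measure_pmf.prob (W (t + r)) {(x, y). A x y} = measure_pmf.prob (W t) {(x, y). A x y}"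
proof -
  have le: "measure_pmf.prob (W (t + r)) {(x, y). A x y} \<le> measure_pmf.prob (W t) {(x, y). A x y}"
    if "determined (Suc t) A" for A
    using prob_W_cond[OF that, of 1 r "\<lambda>_ _. True"] by simp
  have c: "measure_pmf.prob (W t) {(x, y). \<not> A x y} = 1 - measure_pmf.prob (W t) {(x, y). A x y}" for t
  proof -
    have "{(x, y). \<not> A x y} = UNIV - {(x, y). A x y}" by auto
    then show ?thesis using measure_pmf.prob_compl[of "{(x, y). A x y}" "W t"] by simp
  qed
  show ?thesis using le[OF A] le[OF determined_neg[OF A]] unfolding c by linarith
qed

lemma prob_W_marginal_le:
  assumes "determined (Suc t) A" "t \<le> T"
  shows "measure_pmf.prob (W T) {(x, y). A x y} = measure_pmf.prob (W t) {(x, y). A x y}"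
  using prob_W_marginal[OF assms(1), of "T - t"] assms(2) by simp

lemma prob_hit_at:
  assumes "xs \<in> set_pmf (walk s)"
  shows "measure_pmf.prob (walk_ext st L xs) {zs. zs ! (s + L) = v} \<le> q"
proof -
  have "measure_pmf.prob (walk_ext st L xs) {zs. zs ! (s + L) = v} \<le> measure_pmf.prob (walk_ext st L xs) {zs. last zs = v}"
  proof (rule prob_mono_support)
    fix zs assume "zs \<in> set_pmf (walk_ext st L xs)" "zs ! (s + L) = v"
    moreover from this have "length zs = Suc (s + L)" using walk_ext_walk[OF assms] walk_length by blast
    ultimately show "last zs = v" by (simp add: last_conv_nth flip: length_greater_0_conv)
  qed
  then show ?thesis using hit_L[OF assms, of v] by linarith
qed

lemma prob_hit_short:
  assumes "xs \<in> set_pmf (walk s)"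
  shows "measure_pmf.prob (walk_ext st l xs) {zs. zs ! (s + l) = v} \<le> a"
proof -
  have "measure_pmf.prob (walk_ext st l xs) {zs. zs ! (s + l) = v} \<le> measure_pmf.prob (walk_ext st l xs) {zs. last zs = v}"
  proof (rule prob_mono_support)
    fix zs assume "zs \<in> set_pmf (walk_ext st l xs)" "zs ! (s + l) = v"
    moreover from this have "length zs = Suc (s + l)" using walk_ext_walk[OF assms] walk_length by blast
    ultimately show "last zs = v" by (simp add: last_conv_nth flip: length_greater_0_conv)
  qed
  then show ?thesis using hit_l[OF assms, of v] by linarith
qed

text \<open>A return within fewer than l steps is impossible. For an older time j, stop the walk l
  steps before the end: the position at j is then a fixed target, and \<open>hit_l\<close> applies.
  A union bound over the window of L times finishes.\<close>

lemma prob_self_hit: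
  assumes xs: "xs \<in> set_pmf (walk s)"
  shows "measure_pmf.prob (walk_ext st L xs) {zs. \<exists>j\<in>{s..<s + L}. zs ! (s + L) = zs ! j} \<le> real L * a"
proof -
  have "measure_pmf.prob (walk_ext st L xs) {zs. zs ! (s + L) = zs ! j} \<le> a" if j: "j \<in> {s..<s + L}" for j
  proof (cases "j + l \<le> s + L")
    case False
    have "measure_pmf.prob (walk_ext st L xs) {zs. zs ! (s + L) = zs ! j} \<le> measure_pmf.prob (walk_ext st L xs) {zs. False}"
    proof (rule prob_mono_support)
      fix zs assume "zs \<in> set_pmf (walk_ext st L xs)" "zs ! (s + L) = zs ! j"
      then show False using gap[OF walk_ext_walk[OF xs], of zs L j "s + L"] j False by auto
    qed
    then show ?thesis using pos by simp
  next
    case True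
    define r where "r = L - l"
    have r: "L = r + l" "j \<le> s + r" using True j by (auto simp: r_def)
    have "measure_pmf.prob (bind_pmf (walk_ext st r xs) (walk_ext st l)) {zs. zs ! (s + L) = zs ! j} \<le> a"
    proof (rule prob_bind_le_const)
      fix ys assume ys: "ys \<in> set_pmf (walk_ext st r xs)"
      then have yw: "ys \<in> set_pmf (walk (s + r))" using walk_ext_walk[OF xs] by blast
      have "measure_pmf.prob (walk_ext st l ys) {zs. zs ! (s + L) = zs ! j}
          \<le> measure_pmf.prob (walk_ext st l ys) {zs. zs ! (s + r + l) = ys ! j}"
      proof (rule prob_mono_support)
        fix zs assume "zs \<in> set_pmf (walk_ext st l ys)" "zs ! (s + L) = zs ! j"
        moreover from this have "take (length ys) zs = ys" using walk_ext_prefix by blast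
        moreover have "j < length ys" using walk_length[OF yw] r by simp
        ultimately show "zs ! (s + r + l) = ys ! j" using r(1) by (metis add.assoc nth_take)
      qed
      also have "\<dots> \<le> a" by (rule prob_hit_short[OF yw])
      finally show "measure_pmf.prob (walk_ext st l ys) {zs. zs ! (s + L) = zs ! j} \<le> a" .
    qed
    then show ?thesis using walk_ext_add[of st r l xs] r(1) by simp
  qed
  then have "measure_pmf.prob (walk_ext st L xs) {zs. \<exists>j\<in>{s..<s + L}. zs ! (s + L) = zs ! j} \<le> real (card {s..<s + L}) * a"
    by (intro prob_Ex_le) auto
  then show ?thesis by simp
qed

text \<open>Bound for finding one walk in a heavy bin after L steps: B bins heavy at the start, the
  walk's own recent positions, and the recent positions of the other walk.\<close>

definition "eta B = q * B + real L * a + real L * q"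

lemma eta_nonneg: "B \<ge> 0 \<Longrightarrow> eta B \<ge> 0"
  using pos by (simp add: eta_def)

text \<open>The other trajectory w is an arbitrary fixed list, so the bound can be used
  conditionally on the whole other walk.\<close>

lemma prob_hit_set:
  assumes xs: "xs \<in> set_pmf (walk s)" and S: "finite S" "real (card S) \<le> B"
  shows "measure_pmf.prob (walk_ext st L xs)
    {zs. zs ! (s + L) \<in> S \<or> (\<exists>j\<in>{s..<s + L}. zs ! (s + L) = zs ! j) \<or> (\<exists>j\<in>{s..<s + L}. zs ! (s + L) = w ! j)} \<le> eta B"
proof -
  have "measure_pmf.prob (walk_ext st L xs) {zs. \<exists>v\<in>S. zs ! (s + L) = v} \<le> real (card S) * q"
    by (rule prob_Ex_le[OF S(1) prob_hit_at[OF xs]])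
  also have "\<dots> \<le> q * B" using S(2) pos by (subst mult.commute) (intro mult_left_mono)
  finally have 1: "measure_pmf.prob (walk_ext st L xs) {zs. zs ! (s + L) \<in> S} \<le> q * B" by simp
  have 2: "measure_pmf.prob (walk_ext st L xs) {zs. \<exists>j\<in>{s..<s + L}. zs ! (s + L) = w ! j} \<le> real L * q"
    using prob_Ex_le[of "{s..<s + L}", OF _ prob_hit_at[OF xs]] by simp
  show ?thesis
    using 1 2 prob_self_hit[OF xs] unfolding eta_def
    by (intro order.trans[OF prob_Un_le[where P = "\<lambda>zs. zs ! (s + L) \<in> S"]]
        order.trans[OF add_left_mono[OF prob_Un_le]]) linarith
qed

lemma W_ext_heavy_cases:
  assumes xs: "xs \<in> set_pmf (walk s)" and ys: "ys \<in> set_pmf (walk s)" and xy: "(x, y) \<in> set_pmf (W_ext L xs ys)"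
    and v: "v \<in> heavy tie i (s + L) x y"
  shows "v \<in> heavy tie i s xs ys \<or> (\<exists>j\<in>{s..<s + L}. v = x ! j) \<or> (\<exists>j\<in>{s..<s + L}. v = y ! j)"
proof (cases "v \<in> heavy tie i s x y")
  case True
  have "determined (Suc s) (\<lambda>x y. v \<in> heavy tie i s x y)"
    by (rule determined_mono[OF determined_heavy[of s "\<lambda>S. v \<in> S" tie i]]) simp
  then show ?thesis using W_ext_determined[OF xs ys xy] True by blast
next
  case False
  from heavy_new[OF v False] show ?thesis by fastforce
qed


text \<open>For a product bound the event for x must not mention y. So x meeting the recent path of
  y is split off at cost L * q; otherwise x satisfies \<open>g\<close> on its own, and given x, the
  event for y has probability at most \<open>eta B\<close>.\<close>

lemma prob_both_heavy:
  assumes xs: "xs \<in> set_pmf (walk s)" and ys: "ys \<in> set_pmf (walk s)"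
    and i: "i > 0" and B: "real (card (heavy tie i s xs ys)) \<le> B"
  shows "measure_pmf.prob (W_ext L xs ys)
    {(x, y). x ! (s + L) \<in> heavy tie i (s + L) x y \<and> y ! (s + L) \<in> heavy tie i (s + L) x y}
      \<le> (eta B)\<^sup>2 + real L * q"
proof -
  define S where "S = heavy tie i s xs ys"
  define g where "g z \<longleftrightarrow> z ! (s + L) \<in> S \<or> (\<exists>j\<in>{s..<s + L}. z ! (s + L) = z ! j)" for z
  define cr where "cr z w \<longleftrightarrow> (\<exists>j\<in>{s..<s + L}. z ! (s + L) = w ! j)" for z w :: "'a list"
  have S: "finite S" "real (card S) \<le> B" using finite_heavy[OF i] B by (auto simp: S_def)
  have B0: "B \<ge> 0" using S(2) by linarith
  note e0 = eta_nonneg[OF B0]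
  have h: "measure_pmf.prob (walk_ext st L zs) {z. g z \<or> cr z w} \<le> eta B" if "zs \<in> set_pmf (walk s)" for zs w
    using prob_hit_set[OF that S] unfolding g_def cr_def by (simp add: disj_assoc)
  have hg: "measure_pmf.prob (walk_ext st L zs) {z. g z} \<le> eta B" if "zs \<in> set_pmf (walk s)" for zs
    by (rule order.trans[OF prob_mono_support h[OF that, of undefined]]) auto
  have hc: "measure_pmf.prob (walk_ext st L xs) {z. cr z w} \<le> real L * q" for w
    using prob_Ex_le[of "{s..<s + L}", OF _ prob_hit_at[OF xs]] unfolding cr_def by simp
  let ?M = "walk_ext st L xs" and ?N = "walk_ext st L ys"
  have "measure_pmf.prob (W_ext L xs ys)
      {(x, y). x ! (s + L) \<in> heavy tie i (s + L) x y \<and> y ! (s + L) \<in> heavy tie i (s + L) x y}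
    \<le> measure_pmf.prob (W_ext L xs ys) {w. (case w of (x, y) \<Rightarrow> g x \<and> (g y \<or> cr y x)) \<or> (case w of (x, y) \<Rightarrow> cr x y)}"
    proof (rule prob_mono_support)
      fix w assume w: "w \<in> set_pmf (W_ext L xs ys)"
        "case w of (x, y) \<Rightarrow> x ! (s + L) \<in> heavy tie i (s + L) x y \<and> y ! (s + L) \<in> heavy tie i (s + L) x y"
      obtain x y where xy: "w = (x, y)" by (cases w)
      show "(case w of (x, y) \<Rightarrow> g x \<and> (g y \<or> cr y x)) \<or> (case w of (x, y) \<Rightarrow> cr x y)"
        using W_ext_heavy_cases[OF xs ys, of x y] w unfolding xy g_def cr_def S_def prod.case by blast
    qed
  also have "\<dots> \<le> measure_pmf.prob (W_ext L xs ys) {(x, y). g x \<and> (g y \<or> cr y x)}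
      + measure_pmf.prob (W_ext L xs ys) {(x, y). cr x y}"
    by (rule order.trans[OF prob_Un_le]) simp
  also have "measure_pmf.prob (W_ext L xs ys) {(x, y). g x \<and> (g y \<or> cr y x)} \<le> eta B * measure_pmf.prob ?M {x. g x}"
    unfolding W_ext_def by (rule prob_pair_le[OF h[OF ys] e0])
  also have "\<dots> \<le> eta B * eta B" using hg[OF xs] e0 by (intro mult_left_mono)
  also have "measure_pmf.prob (W_ext L xs ys) {(x, y). cr x y} = measure_pmf.prob (pair_pmf ?N ?M) {(y, x). True \<and> cr x y}"
    unfolding W_ext_def by (subst prob_pair_swap) simp
  also have "\<dots> \<le> real L * q * measure_pmf.prob ?N {y. True}"
    by (rule prob_pair_le[OF hc]) (use pos in simp)
  finally show ?thesis by (simp add: power2_eq_square)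
qed

text \<open>Condition on the walk that hits v, which costs q; given its trajectory the other walk is
  in a heavy bin with probability at most \<open>eta B\<close>. The factor 2 is for the choice of
  the visiting walk.\<close>

lemma prob_high_visit:
  assumes xs: "xs \<in> set_pmf (walk s)" and ys: "ys \<in> set_pmf (walk s)"
    and i: "i > 0" and B: "real (card (heavy tie i s xs ys)) \<le> B"
  shows "measure_pmf.prob (W_ext L xs ys) {(x, y). high_visit tie i v (s + L) x y} \<le> 2 * q * eta B"
proof -
  define S where "S = heavy tie i s xs ys"
  define g where "g z w \<longleftrightarrow> z ! (s + L) \<in> S \<or> (\<exists>j\<in>{s..<s + L}. z ! (s + L) = z ! j)
    \<or> (\<exists>j\<in>{s..<s + L}. z ! (s + L) = w ! j)" for z w
  have S: "finite S" "real (card S) \<le> B" using finite_heavy[OF i] B by (auto simp: S_def)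
  have B0: "B \<ge> 0" using S(2) by linarith
  note e0 = eta_nonneg[OF B0]
  have h: "measure_pmf.prob (walk_ext st L zs) {z. g z w} \<le> eta B" if "zs \<in> set_pmf (walk s)" for zs w
    using prob_hit_set[OF that S] unfolding g_def .
  let ?M = "walk_ext st L xs" and ?N = "walk_ext st L ys"
  have "measure_pmf.prob (W_ext L xs ys) {w. case w of (x, y) \<Rightarrow> high_visit tie i v (s + L) x y}
    \<le> measure_pmf.prob (W_ext L xs ys) {w. (case w of (x, y) \<Rightarrow> x ! (s + L) = v \<and> g y x)
        \<or> (case w of (x, y) \<Rightarrow> y ! (s + L) = v \<and> g x y)}"
  proof (rule prob_mono_support)
    fix w assume w: "w \<in> set_pmf (W_ext L xs ys)" "case w of (x, y) \<Rightarrow> high_visit tie i v (s + L) x y"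
    obtain x y where xy: "w = (x, y)" by (cases w)
    show "(case w of (x, y) \<Rightarrow> x ! (s + L) = v \<and> g y x) \<or> (case w of (x, y) \<Rightarrow> y ! (s + L) = v \<and> g x y)"
      using W_ext_heavy_cases[OF xs ys, of x y] w unfolding xy g_def S_def prod.case high_visit_def by blast
  qed
  also have "\<dots> \<le> measure_pmf.prob (W_ext L xs ys) {(x, y). x ! (s + L) = v \<and> g y x}
      + measure_pmf.prob (W_ext L xs ys) {(x, y). y ! (s + L) = v \<and> g x y}"
    by (rule order.trans[OF prob_Un_le]) simp
  also have "measure_pmf.prob (W_ext L xs ys) {(x, y). x ! (s + L) = v \<and> g y x}
      \<le> eta B * measure_pmf.prob ?M {x. x ! (s + L) = v}"
    unfolding W_ext_def by (rule prob_pair_le[OF h[OF ys] e0])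
  also have "\<dots> \<le> eta B * q" using prob_hit_at[OF xs] e0 by (intro mult_left_mono)
  also have "measure_pmf.prob (W_ext L xs ys) {(x, y). y ! (s + L) = v \<and> g x y}
      = measure_pmf.prob (pair_pmf ?N ?M) {(y, x). y ! (s + L) = v \<and> g x y}"
    unfolding W_ext_def by (rule prob_pair_swap)
  also have "\<dots> \<le> eta B * measure_pmf.prob ?N {y. y ! (s + L) = v}"
    by (rule prob_pair_le[OF h[OF xs] e0])
  also have "\<dots> \<le> eta B * q" using prob_hit_at[OF ys] e0 by (intro mult_left_mono)
  finally show ?thesis by simp
qed

text \<open>Meant for gaps between l and L, where no mixing is available: the heaviness of the other
  bin is given up and only the visit to v is counted.\<close>

lemma prob_visit_short:
  assumes xs: "xs \<in> set_pmf (walk s)" and ys: "ys \<in> set_pmf (walk s)"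
  shows "measure_pmf.prob (W_ext l xs ys) {(x, y). high_visit tie i v (s + l) x y} \<le> 2 * a"
proof -
  let ?M = "walk_ext st l xs" and ?N = "walk_ext st l ys"
  have "measure_pmf.prob (W_ext l xs ys) {w. case w of (x, y) \<Rightarrow> high_visit tie i v (s + l) x y}
    \<le> measure_pmf.prob (W_ext l xs ys) {w. (case w of (x, y) \<Rightarrow> x ! (s + l) = v \<and> True)
        \<or> (case w of (x, y) \<Rightarrow> y ! (s + l) = v \<and> True)}"
    by (rule prob_mono_support) (auto simp: high_visit_def)
  also have "\<dots> \<le> measure_pmf.prob (W_ext l xs ys) {(x, y). x ! (s + l) = v \<and> True}
      + measure_pmf.prob (W_ext l xs ys) {(x, y). y ! (s + l) = v \<and> True}"
    by (rule order.trans[OF prob_Un_le]) simp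
  also have "measure_pmf.prob (W_ext l xs ys) {(x, y). x ! (s + l) = v \<and> True}
      \<le> 1 * measure_pmf.prob ?M {x. x ! (s + l) = v}"
    unfolding W_ext_def by (rule prob_pair_le) simp_all
  also have "measure_pmf.prob (W_ext l xs ys) {(x, y). y ! (s + l) = v \<and> True}
      = measure_pmf.prob (pair_pmf ?N ?M) {(y, x). y ! (s + l) = v \<and> True}"
    unfolding W_ext_def by (rule prob_pair_swap)
  also have "\<dots> \<le> 1 * measure_pmf.prob ?N {y. y ! (s + l) = v}"
    by (rule prob_pair_le) simp_all
  finally show ?thesis using prob_hit_short[OF xs, of v] prob_hit_short[OF ys, of v] by simp
qed


section \<open>Growth of the heavy sets from one level to the next\<close>

text \<open>The bound on the heavy set L steps earlier is built into the event. Its conditional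
  probability is then small for every past, since the event is impossible when the bound
  fails.\<close>

definition joint_heavy :: "nat \<Rightarrow> real \<Rightarrow> nat \<Rightarrow> 'a list \<Rightarrow> 'a list \<Rightarrow> bool" where
  "joint_heavy i B t x y \<longleftrightarrow> (x ! t \<in> heavy tie i t x y \<and> y ! t \<in> heavy tie i t x y)
     \<and> real (card (heavy tie i (t - L) x y)) \<le> B"

text \<open>The times are r+L, ..., r+mL; starting at r+L leaves for each of them a conditioning
  time L steps before.\<close>

definition joint_count :: "nat \<Rightarrow> real \<Rightarrow> nat \<Rightarrow> nat \<Rightarrow> 'a list \<Rightarrow> 'a list \<Rightarrow> nat" where
  "joint_count i B r m x y = card {k. k < m \<and> joint_heavy i B (r + Suc k * L) x y}"

lemma determined_card_heavy: "s \<le> t \<Longrightarrow> determined t (\<lambda>x y. real (card (heavy tie i s x y)) \<le> B)"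
  by (rule determined_mono[OF determined_heavy[of s "\<lambda>S. real (card S) \<le> B" tie i]])

lemma determined_joint_heavy: "determined (Suc t) (joint_heavy i B t)"
  unfolding joint_heavy_def[abs_def]
  by (intro determined_conj[OF determined_both_heavy determined_card_heavy]) simp

lemma determined_joint_count: "determined (Suc (r + m * L)) (\<lambda>x y. F (joint_count i B r m x y))"
  unfolding determined_def
proof (intro allI impI)
  fix xs ys xs' ys' :: "'a list"
  let ?t = "Suc (r + m * L)"
  assume a: "?t \<le> length xs" "?t \<le> length ys" "?t \<le> length xs'" "?t \<le> length ys'"
      "take ?t xs = take ?t xs'" "take ?t ys = take ?t ys'"
  have "joint_heavy i B (r + Suc k * L) xs ys = joint_heavy i B (r + Suc k * L) xs' ys'" if "k < m" for k
  proof -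
    have "Suc k * L \<le> m * L" using that by (intro mult_le_mono1) simp
    then have "determined ?t (joint_heavy i B (r + Suc k * L))"
      by (intro determined_mono[OF determined_joint_heavy]) simp
    then show ?thesis by (rule determinedD[OF _ a])
  qed
  then have "{k. k < m \<and> joint_heavy i B (r + Suc k * L) xs ys} = {k. k < m \<and> joint_heavy i B (r + Suc k * L) xs' ys'}"
    by blast
  then show "F (joint_count i B r m xs ys) = F (joint_count i B r m xs' ys')"
    by (simp add: joint_count_def)
qed

lemma prob_joint_heavy:
  assumes "xs \<in> set_pmf (walk s)" "ys \<in> set_pmf (walk s)" "i > 0"
  shows "measure_pmf.prob (W_ext L xs ys) {(x, y). joint_heavy i B (s + L) x y} \<le> (eta B)\<^sup>2 + real L * q"
proof (cases "real (card (heavy tie i s xs ys)) \<le> B")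
  case True
  have "measure_pmf.prob (W_ext L xs ys) {(x, y). joint_heavy i B (s + L) x y}
    \<le> measure_pmf.prob (W_ext L xs ys)
    {(x, y). x ! (s + L) \<in> heavy tie i (s + L) x y \<and> y ! (s + L) \<in> heavy tie i (s + L) x y}"
    by (rule measure_pmf.finite_measure_mono) (auto simp: joint_heavy_def)
  then show ?thesis using prob_both_heavy[OF assms True] by linarith
next
  case False
  have "measure_pmf.prob (W_ext L xs ys) {w. case w of (x, y) \<Rightarrow> joint_heavy i B (s + L) x y}
     \<le> measure_pmf.prob (W_ext L xs ys) {w. False}"
  proof (rule prob_mono_support)
    fix w assume w: "w \<in> set_pmf (W_ext L xs ys)" "case w of (x, y) \<Rightarrow> joint_heavy i B (s + L) x y"
    obtain x y where xy: "w = (x, y)" by (cases w)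
    have "determined (Suc s) (\<lambda>x y. real (card (heavy tie i s x y)) \<le> B)" by (rule determined_card_heavy) simp
    from W_ext_determined[OF assms(1,2) _ this, of x y] w show False
      unfolding xy joint_heavy_def using False by simp
  qed
  then show ?thesis using pos by (simp add: add_nonneg_nonneg order.trans[of _ 0])
qed

lemma joint_count_Suc:
  "joint_count i B r (Suc m) x y = joint_count i B r m x y + (if joint_heavy i B (r + Suc m * L) x y then 1 else 0)"
proof -
  have "{k. k < Suc m \<and> joint_heavy i B (r + Suc k * L) x y} =
    (if joint_heavy i B (r + Suc m * L) x y then insert m {k. k < m \<and> joint_heavy i B (r + Suc k * L) x y}
     else {k. k < m \<and> joint_heavy i B (r + Suc k * L) x y})"
    by (auto simp: less_Suc_eq)
  then show ?thesis unfolding joint_count_def by (auto simp del: mult_Suc)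
qed

text \<open>Conditionally on the past up to \<open>L\<close> steps earlier each event \<^const>\<open>joint_heavy\<close> has small
  probability; along a residue class modulo \<open>L\<close> these bounds multiply.\<close>

lemma joint_count_exp_moment:
  assumes i: "i > 0" and p: "p = (eta B)\<^sup>2 + real L * q"
  shows "(\<integral>\<^sup>+w. ennreal (2 ^ joint_count i B r m (fst w) (snd w)) \<partial>W (r + m * L)) \<le> ennreal ((1 + p) ^ m)"
proof (induction m)
  case 0
  show ?case by (simp add: joint_count_def measure_pmf.emeasure_space_1[simplified])
next
  case (Suc m)
  have p0: "p \<ge> 0" using pos by (simp add: p)
  define s where "s = r + m * L"
  have sS: "r + Suc m * L = s + L" by (simp add: s_def)
  have "(\<integral>\<^sup>+w. ennreal (2 ^ joint_count i B r (Suc m) (fst w) (snd w)) \<partial>W (r + Suc m * L))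
     = (\<integral>\<^sup>+v. \<integral>\<^sup>+w. ennreal (2 ^ joint_count i B r (Suc m) (fst w) (snd w)) \<partial>(case v of (xs, ys) \<Rightarrow> W_ext L xs ys) \<partial>W s)"
    unfolding sS W_add by simp
  also have "\<dots> \<le> (\<integral>\<^sup>+v. ennreal (2 ^ joint_count i B r m (fst v) (snd v)) * ennreal (1 + p) \<partial>W s)"
  proof (intro nn_integral_mono_AE AE_pmfI)
    fix v assume "v \<in> set_pmf (W s)"
    then obtain xs ys where v: "v = (xs, ys)" "xs \<in> set_pmf (walk s)" "ys \<in> set_pmf (walk s)"
      unfolding W_def by (cases v) auto
    let ?c = "ennreal (2 ^ joint_count i B r m xs ys)"
    let ?E = "{(x, y). joint_heavy i B (s + L) x y}"
    have "(\<integral>\<^sup>+w. ennreal (2 ^ joint_count i B r (Suc m) (fst w) (snd w)) \<partial>W_ext L xs ys)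
      \<le> (\<integral>\<^sup>+w. ?c * (1 + indicator ?E w) \<partial>W_ext L xs ys)"
    proof (intro nn_integral_mono_AE AE_pmfI)
      fix w assume w: "w \<in> set_pmf (W_ext L xs ys)"
      obtain x y where xy: "w = (x, y)" by (cases w)
      have "determined (Suc s) (\<lambda>x y. joint_count i B r m x y = joint_count i B r m xs ys)"
        using determined_joint_count[of r m "\<lambda>c. c = joint_count i B r m xs ys"] by (simp add: s_def)
      then have c: "joint_count i B r m x y = joint_count i B r m xs ys"
        using W_ext_determined[OF v(2,3)] w xy by blast
      show "ennreal (2 ^ joint_count i B r (Suc m) (fst w) (snd w)) \<le> ?c * (1 + indicator ?E w)"
        unfolding joint_count_Suc sS xy fst_conv snd_conv c
        by (auto simp: ennreal_mult[symmetric] mult.commute ennreal_power[symmetric] simp del: ennreal_power)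
    qed
    also have "\<dots> = ?c * (1 + emeasure (W_ext L xs ys) ?E)"
      by (simp add: nn_integral_cmult nn_integral_add measure_pmf.emeasure_space_1[simplified])
    also have "\<dots> \<le> ?c * ennreal (1 + p)"
    proof (intro mult_left_mono)
      have "emeasure (W_ext L xs ys) ?E \<le> ennreal p"
        using prob_joint_heavy[OF v(2,3) i, of B] unfolding measure_pmf.emeasure_eq_measure p by (rule ennreal_leI)
      then have "1 + emeasure (W_ext L xs ys) ?E \<le> 1 + ennreal p" by (intro add_left_mono)
      then show "1 + emeasure (W_ext L xs ys) ?E \<le> ennreal (1 + p)" using p0 by (simp add: ennreal_plus)
    qed simp
    finally show "(\<integral>\<^sup>+w. ennreal (2 ^ joint_count i B r (Suc m) (fst w) (snd w)) \<partial>(case v of (xs, ys) \<Rightarrow> W_ext L xs ys))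
      \<le> ennreal (2 ^ joint_count i B r m (fst v) (snd v)) * ennreal (1 + p)"
      using v(1) by simp
  qed
  also have "\<dots> = (\<integral>\<^sup>+v. ennreal (2 ^ joint_count i B r m (fst v) (snd v)) \<partial>W s) * ennreal (1 + p)"
    by (rule nn_integral_multc) simp
  also have "\<dots> \<le> ennreal ((1 + p) ^ m) * ennreal (1 + p)"
    using Suc unfolding s_def by (rule mult_right_mono) simp
  also have "\<dots> = ennreal ((1 + p) ^ Suc m)" using p0 by (subst ennreal_mult[symmetric]) (auto simp: mult.commute)
  finally show ?case .
qed

text \<open>Markov's inequality for 2 to the power of the count.\<close>

lemma prob_joint_count_gt:
  assumes i: "i > 0" and p: "p = (eta B)\<^sup>2 + real L * q"
  shows "measure_pmf.prob (W (r + m * L)) {(x, y). z < real (joint_count i B r m x y)} \<le> 2 powr - z * (1 + p) ^ m"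
proof -
  have p0: "p \<ge> 0" using pos by (simp add: p)
  let ?E = "{(x, y). z < real (joint_count i B r m x y)}"
  have "emeasure (W (r + m * L)) ?E = (\<integral>\<^sup>+w. indicator ?E w \<partial>W (r + m * L))" by simp
  also have "\<dots> \<le> (\<integral>\<^sup>+w. ennreal (2 powr - z) * ennreal (2 ^ joint_count i B r m (fst w) (snd w)) \<partial>W (r + m * L))"
  proof (intro nn_integral_mono)
    fix w :: "'a list \<times> 'a list"
    obtain x y where xy: "w = (x, y)" by (cases w)
    show "indicator ?E w \<le> ennreal (2 powr - z) * ennreal (2 ^ joint_count i B r m (fst w) (snd w))"
    proof (cases "z < real (joint_count i B r m x y)")
      case True
      have "2 powr - z * 2 ^ joint_count i B r m x y = 2 powr (real (joint_count i B r m x y) - z)"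
        by (simp add: powr_diff powr_minus powr_realpow divide_simps)
      also have "\<dots> \<ge> 1" using True by (intro ge_one_powr_ge_zero) auto
      finally have "ennreal 1 \<le> ennreal (2 powr - z * 2 ^ joint_count i B r m x y)" by (rule ennreal_leI)
      then show ?thesis using True unfolding xy by (simp add: ennreal_mult)
    qed (simp add: xy)
  qed
  also have "\<dots> = ennreal (2 powr - z) * (\<integral>\<^sup>+w. ennreal (2 ^ joint_count i B r m (fst w) (snd w)) \<partial>W (r + m * L))"
    by (rule nn_integral_cmult) simp
  also have "\<dots> \<le> ennreal (2 powr - z) * ennreal ((1 + p) ^ m)"
    by (intro mult_left_mono joint_count_exp_moment[OF i p]) simp
  also have "\<dots> = ennreal (2 powr - z * (1 + p) ^ m)" using p0 by (simp add: ennreal_mult)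
  finally show ?thesis using p0 by (simp add: measure_pmf.emeasure_eq_measure)
qed

text \<open>Every new bin of level i+1 uses its own time at which both walks are heavy. The first L
  times account for the summand L; if each of the L residue classes counts at most z, the rest
  contribute at most L * z. A union bound over the classes gives the factor L.\<close>

lemma prob_heavy_growth:
  assumes i: "i > 0" and p: "p = (eta B)\<^sup>2 + real L * q" and m: "Suc T \<le> L * Suc m"
  shows "measure_pmf.prob (W T) {(x, y). real (card (heavy tie i (Suc T) x y)) \<le> B \<and>
      real L + real L * z < real (card (heavy tie (Suc i) (Suc T) x y))}
    \<le> real L * (2 powr - z * (1 + p) ^ m)"
proof -
  define n where "n = Suc T"
  let ?T = "L * Suc m"
  have det: "determined n (\<lambda>x y. real (card (heavy tie i n x y)) \<le> B \<and> real L + real L * z < real (card (heavy tie (Suc i) n x y)))"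
    using determined_conj[OF determined_card_heavy[of n n i B]
       determined_heavy[of n "\<lambda>S. real L + real L * z < real (card S)" tie "Suc i"]] by simp
  \<comment> \<open>The horizon is lengthened so that every residue class r < L has its full m
    sampling times; the event in question ignores the additional steps.\<close>
  have "measure_pmf.prob (W T) {(x, y). real (card (heavy tie i n x y)) \<le> B \<and> real L + real L * z < real (card (heavy tie (Suc i) n x y))}
    = measure_pmf.prob (W ?T) {(x, y). real (card (heavy tie i n x y)) \<le> B \<and> real L + real L * z < real (card (heavy tie (Suc i) n x y))}"
    by (rule prob_W_marginal_le[symmetric]) (use det m n_def in simp_all)
  also have "\<dots> \<le> measure_pmf.prob (W ?T) {w. \<exists>r\<in>{..<L}. case w of (x, y) \<Rightarrow> z < real (joint_count i B r m x y)}"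
  proof (rule measure_pmf.finite_measure_mono; safe?)
    fix x y
    assume c: "real (card (heavy tie i n x y)) \<le> B" "real L + real L * z < real (card (heavy tie (Suc i) n x y))"
    show "\<exists>r\<in>{..<L}. z < real (joint_count i B r m x y)"
    proof (rule ccontr)
      assume "\<not> ?thesis"
      then have z: "real (joint_count i B r m x y) \<le> z" if "r < L" for r using that by (auto simp: not_less)
      let ?D = "{t. t < n \<and> x ! t \<in> heavy tie i t x y \<and> y ! t \<in> heavy tie i t x y}"
      let ?C = "\<lambda>r. {k. k < m \<and> joint_heavy i B (r + Suc k * L) x y}"
      have "?D \<subseteq> {..<L} \<union> (\<Union>r\<in>{..<L}. (\<lambda>k. r + Suc k * L) ` ?C r)"
      proof
        fix t assume t: "t \<in> ?D"
        show "t \<in> {..<L} \<union> (\<Union>r\<in>{..<L}. (\<lambda>k. r + Suc k * L) ` ?C r)"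
        proof (cases "t < L")
          case False
          \<comment> \<open>The shift by one matches the sampling times, which start at r+L.\<close>
          define k where "k = t div L - 1"
          have "t div L \<ge> 1" using False pos(2) by (simp add: div_greater_zero_iff Suc_le_eq)
          then have k: "t = t mod L + Suc k * L" unfolding k_def by simp
          have "t < Suc m * L" using t m n_def by (simp add: mult.commute)
          then have "t div L < Suc m" using pos(2) by (simp add: less_mult_imp_div_less)
          then have km: "k < m" using \<open>t div L \<ge> 1\<close> by (simp add: k_def)
          \<comment> \<open>The heavy set at the end contains all earlier ones, so on this event the
            condition built into \<open>joint_heavy\<close> is automatic.\<close>
          have "card (heavy tie i (t - L) x y) \<le> card (heavy tie i n x y)"
            using t by (intro card_mono finite_heavy[OF i] heavy_mono) auto
          then have "joint_heavy i B t x y" using t c(1) unfolding joint_heavy_def by auto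
          then have "joint_heavy i B (t mod L + Suc k * L) x y" by (subst k[symmetric])
          then have "k \<in> ?C (t mod L)" using km by blast
          then have "t mod L + Suc k * L \<in> (\<Union>r\<in>{..<L}. (\<lambda>k. r + Suc k * L) ` ?C r)"
            using pos(2) by (intro UN_I[of "t mod L"] imageI) auto
          then show ?thesis by (subst k) (rule UnI2)
        qed simp
      qed
      then have "card ?D \<le> card ({..<L} \<union> (\<Union>r\<in>{..<L}. (\<lambda>k. r + Suc k * L) ` ?C r))"
        by (intro card_mono) auto
      also have "\<dots> \<le> card {..<L} + card (\<Union>r\<in>{..<L}. (\<lambda>k. r + Suc k * L) ` ?C r)" by (rule card_Un_le)
      also have "card (\<Union>r\<in>{..<L}. (\<lambda>k. r + Suc k * L) ` ?C r) \<le> (\<Sum>r<L. card ((\<lambda>k. r + Suc k * L) ` ?C r))"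
        by (rule card_UN_le) simp
      also have "\<dots> \<le> (\<Sum>r<L. joint_count i B r m x y)"
        unfolding joint_count_def by (intro sum_mono card_image_le) simp
      finally have "card ?D \<le> L + (\<Sum>r<L. joint_count i B r m x y)" by simp
      then have "real (card (heavy tie (Suc i) n x y)) \<le> real L + (\<Sum>r<L. real (joint_count i B r m x y))"
        using card_heavy_Suc_le[of tie i n x y] by (simp flip: of_nat_sum of_nat_add)
      also have "(\<Sum>r<L. real (joint_count i B r m x y)) \<le> (\<Sum>r<L. z)" using z by (intro sum_mono) simp
      finally show False using c(2) by simp
    qed
  qed simp
  also have "\<dots> \<le> real (card {..<L}) * (2 powr - z * (1 + p) ^ m)"
  proof (rule prob_Ex_le)
    fix r assume r: "r \<in> {..<L}"
    have "r + m * L \<le> ?T" using r by (simp add: mult.commute)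
    then show "measure_pmf.prob (W ?T) {w. case w of (x, y) \<Rightarrow> z < real (joint_count i B r m x y)} \<le> 2 powr - z * (1 + p) ^ m"
      using prob_W_marginal_le[OF determined_joint_count[of r m "\<lambda>c. z < real c" i B], of ?T]
        prob_joint_count_gt[OF i p, of r m z] by simp
  qed simp
  finally show ?thesis by (simp add: n_def)
qed


section \<open>Bins that collect many more balls\<close>

text \<open>The same truncation as in \<open>joint_heavy\<close>, now for visits to a fixed
  bin.\<close>

definition low_visit :: "nat \<Rightarrow> real \<Rightarrow> 'a \<Rightarrow> nat \<Rightarrow> 'a list \<Rightarrow> 'a list \<Rightarrow> bool" where
  "low_visit i B v t x y \<longleftrightarrow> high_visit tie i v t x y \<and> real (card (heavy tie i (t - L) x y)) \<le> B"

lemma determined_low_visit: "determined (Suc t) (low_visit i B v t)"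
  unfolding low_visit_def[abs_def]
  by (intro determined_conj[OF determined_high_visit determined_card_heavy]) simp

lemma determined_low_chain: "determined (Suc t) (\<lambda>x y. visit_chain l (\<lambda>t. low_visit i B v t x y) j t)"
  by (rule determined_visit_chain[OF determined_low_visit pos(1)])

text \<open>The conditioning time must not precede s, so that the chain up to s is already known. If
  t is at least L after s, condition L steps before t and use mixing together with heaviness;
  otherwise condition l steps before t and use the girth bound alone.\<close>

lemma prob_chain_step:
  fixes v :: 'a and j :: nat
  assumes i: "i > 0" and B: "B \<ge> 0" and T: "t \<le> T" and s: "s + l \<le> t"
  defines "A \<equiv> \<lambda>s x y. visit_chain l (\<lambda>t. low_visit i B v t x y) j s"
  shows "measure_pmf.prob (W T) {(x, y). A s x y \<and> low_visit i B v t x y}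
    \<le> (2 * q * eta B + (if t < s + L then 2 * a else 0)) * measure_pmf.prob (W T) {(x, y). A s x y}"
proof -
  have dA: "determined (Suc s) (A s)" unfolding A_def by (rule determined_low_chain)
  have dL: "determined (Suc t) (\<lambda>x y. A s x y \<and> low_visit i B v t x y)"
    by (intro determined_conj determined_low_visit determined_mono[OF dA]) (use s in simp)
  have e0: "q * eta B \<ge> 0" using eta_nonneg[OF B] pos by simp
  have m1: "measure_pmf.prob (W T) {(x, y). A s x y \<and> low_visit i B v t x y}
      = measure_pmf.prob (W t) {(x, y). A s x y \<and> low_visit i B v t x y}"
    by (rule prob_W_marginal_le[OF dL T])
  have m2: "measure_pmf.prob (W u) {(x, y). A s x y} = measure_pmf.prob (W T) {(x, y). A s x y}"
    if "s \<le> u" "u \<le> T" for u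
    using prob_W_marginal_le[OF dA, of u] prob_W_marginal_le[OF dA, of T] that by simp
  show ?thesis
  proof (cases "t < s + L")
    case True
    define u where "u = t - l"
    have u: "t = u + l" "s \<le> u" "u \<le> T" using s T by (auto simp: u_def)
    have "measure_pmf.prob (W t) {(x, y). A s x y \<and> low_visit i B v t x y}
      \<le> 2 * a * measure_pmf.prob (W u) {(x, y). A s x y}"
      unfolding u(1)
    proof (rule prob_W_cond)
      show "determined (Suc u) (A s)" by (rule determined_mono[OF dA]) (use u in simp)
      fix xs ys assume w: "xs \<in> set_pmf (walk u)" "ys \<in> set_pmf (walk u)"
      have "measure_pmf.prob (W_ext l xs ys) {(x, y). low_visit i B v (u + l) x y}
         \<le> measure_pmf.prob (W_ext l xs ys) {(x, y). high_visit tie i v (u + l) x y}"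
        by (rule measure_pmf.finite_measure_mono) (auto simp: low_visit_def)
      then show "measure_pmf.prob (W_ext l xs ys) {(x, y). low_visit i B v (u + l) x y} \<le> 2 * a"
        using prob_visit_short[OF w, of i v] by linarith
    qed (use pos in simp)
    also have "\<dots> \<le> (2 * q * eta B + 2 * a) * measure_pmf.prob (W u) {(x, y). A s x y}"
      using e0 by (intro mult_right_mono) auto
    finally show ?thesis using m1 m2[OF u(2,3)] True by simp
  next
    case False
    define u where "u = t - L"
    have u: "t = u + L" "s \<le> u" "u \<le> T" using False T by (auto simp: u_def)
    let ?D = "\<lambda>x y. A s x y \<and> real (card (heavy tie i u x y)) \<le> B"
    have "measure_pmf.prob (W t) {(x, y). A s x y \<and> low_visit i B v t x y}
        \<le> measure_pmf.prob (W t) {(x, y). ?D x y \<and> high_visit tie i v t x y}"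
      by (rule measure_pmf.finite_measure_mono) (auto simp: low_visit_def u_def)
    also have "\<dots> \<le> 2 * q * eta B * measure_pmf.prob (W u) {(x, y). ?D x y}"
      unfolding u(1)
    proof (rule prob_W_cond)
      show "determined (Suc u) ?D"
        by (intro determined_conj determined_mono[OF dA] determined_card_heavy) (use u in simp_all)
      fix xs ys assume w: "xs \<in> set_pmf (walk u)" "ys \<in> set_pmf (walk u)" "?D xs ys"
      then show "measure_pmf.prob (W_ext L xs ys) {(x, y). high_visit tie i v (u + L) x y} \<le> 2 * q * eta B"
        by (intro prob_high_visit i) auto
    qed (use e0 in simp)
    also have "\<dots> \<le> 2 * q * eta B * measure_pmf.prob (W u) {(x, y). A s x y}"
      using e0 by (intro mult_left_mono measure_pmf.finite_measure_mono) auto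
    finally show ?thesis using m1 m2[OF u(2,3)] False by simp
  qed
qed

text \<open>The union bound over the preceding visit iterates a kernel in (s, t). Its sum over t is
  bounded uniformly in s, because the weak bound 2a applies to at most L times after s; each further
  visit thus costs one fixed factor.\<close>

lemma prob_chain_sum:
  fixes v :: 'a and T :: nat
  assumes i: "i > 0" and B: "B \<ge> 0"
  defines "P \<equiv> \<lambda>j t. measure_pmf.prob (W T) {(x, y). visit_chain l (\<lambda>t. low_visit i B v t x y) j t}"
  shows "(\<Sum>t<Suc T. P j t) \<le> real (Suc T) * (real (Suc T) * (2 * q * eta B) + real L * (2 * a)) ^ j"
proof (induction j)
  case 0
  have "(\<Sum>t<Suc T. P 0 t) \<le> (\<Sum>t<Suc T. 1)" unfolding P_def by (intro sum_mono) simp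
  then show ?case by simp
next
  case (Suc j)
  let ?e = "2 * q * eta B"
  \<comment> \<open>The condition s <= t is added so that the kernel is also summable over those
    pairs that no chain uses.\<close>
  let ?k = "\<lambda>s t. ?e + (if s \<le> t \<and> t < s + L then 2 * a else 0)"
  have e0: "?e \<ge> 0" using eta_nonneg[OF B] pos by simp
  have P0: "P j s \<ge> 0" for s by (simp add: P_def)
  have 1: "P (Suc j) t \<le> (\<Sum>s<Suc T. ?k s t * P j s)" if t: "t < Suc T" for t
  proof -
    let ?I = "{s. s + l \<le> t}"
    have fin: "finite ?I" by (rule finite_subset[of _ "{..t}"]) auto
    have "P (Suc j) t = measure_pmf.prob (W T)
      (\<Union>s\<in>?I. {(x, y). visit_chain l (\<lambda>t. low_visit i B v t x y) j s \<and> low_visit i B v t x y})"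
      unfolding P_def by (rule arg_cong[where f = "measure_pmf.prob (W T)"]) auto
    also have "\<dots> \<le> (\<Sum>s\<in>?I. measure_pmf.prob (W T) {(x, y). visit_chain l (\<lambda>t. low_visit i B v t x y) j s \<and> low_visit i B v t x y})"
      using fin by (intro measure_pmf.finite_measure_subadditive_finite) auto
    also have "\<dots> \<le> (\<Sum>s\<in>?I. ?k s t * P j s)"
    proof (intro sum_mono)
      fix s assume "s \<in> ?I"
      then have s: "s + l \<le> t" "s \<le> t" by auto
      show "measure_pmf.prob (W T) {(x, y). visit_chain l (\<lambda>t. low_visit i B v t x y) j s \<and> low_visit i B v t x y} \<le> ?k s t * P j s"
        using prob_chain_step[OF i B _ s(1), of T v j] t s(2) unfolding P_def by (simp add: less_Suc_eq_le)
    qed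
    also have "\<dots> \<le> (\<Sum>s<Suc T. ?k s t * P j s)"
      using t e0 pos P0 by (intro sum_mono2) (auto intro!: mult_nonneg_nonneg add_nonneg_nonneg)
    finally show ?thesis .
  qed
  have 2: "(\<Sum>t<Suc T. ?k s t) \<le> real (Suc T) * ?e + real L * (2 * a)" for s
  proof -
    have "(\<Sum>t<Suc T. if s \<le> t \<and> t < s + L then 2 * a else 0) = (\<Sum>t\<in>{t. t < Suc T \<and> s \<le> t \<and> t < s + L}. 2 * a)"
      by (subst sum.inter_filter[symmetric]) (auto intro!: sum.cong)
    also have "\<dots> = real (card {t. t < Suc T \<and> s \<le> t \<and> t < s + L}) * (2 * a)" by simp
    also have "\<dots> \<le> real (card {s..<s + L}) * (2 * a)"
      using pos by (intro mult_right_mono of_nat_mono card_mono) auto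
    finally show ?thesis by (simp add: sum.distrib del: sum.lessThan_Suc)
  qed
  have "(\<Sum>t<Suc T. P (Suc j) t) \<le> (\<Sum>t<Suc T. \<Sum>s<Suc T. ?k s t * P j s)"
    using 1 by (intro sum_mono) auto
  also have "\<dots> = (\<Sum>s<Suc T. (\<Sum>t<Suc T. ?k s t) * P j s)"
    by (subst sum.swap) (simp only: sum_distrib_right)
  also have "\<dots> \<le> (\<Sum>s<Suc T. (real (Suc T) * ?e + real L * (2 * a)) * P j s)"
    by (intro sum_mono mult_right_mono 2 P0)
  also have "\<dots> = (real (Suc T) * ?e + real L * (2 * a)) * (\<Sum>s<Suc T. P j s)" by (simp only: sum_distrib_left)
  also have "\<dots> \<le> (real (Suc T) * ?e + real L * (2 * a)) * (real (Suc T) * (real (Suc T) * ?e + real L * (2 * a)) ^ j)"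
    using Suc e0 pos by (intro mult_left_mono) auto
  finally show ?case by (simp add: mult_ac)
qed

lemma prob_load_growth:
  assumes i: "i > 0" and B: "B \<ge> 0"
  shows "measure_pmf.prob (W T) {(x, y). real (card (heavy tie i (Suc T) x y)) \<le> B \<and> i + 2 * K < load tie x y (Suc T) v}
    \<le> real (Suc T) * (real (Suc T) * (2 * q * eta B) + real L * (2 * a)) ^ K"
proof -
  have "measure_pmf.prob (W T) {w. case w of (x, y) \<Rightarrow> real (card (heavy tie i (Suc T) x y)) \<le> B \<and> i + 2 * K < load tie x y (Suc T) v}
      \<le> measure_pmf.prob (W T) {w. \<exists>t\<in>{..<Suc T}. case w of (x, y) \<Rightarrow> visit_chain l (\<lambda>t. low_visit i B v t x y) K t}"
  proof (rule prob_mono_support)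
    fix w assume w: "w \<in> set_pmf (W T)"
      "case w of (x, y) \<Rightarrow> real (card (heavy tie i (Suc T) x y)) \<le> B \<and> i + 2 * K < load tie x y (Suc T) v"
    obtain x y where xy: "w = (x, y)" by (cases w)
    have x: "x \<in> set_pmf (walk T)" "y \<in> set_pmf (walk T)" using w(1) unfolding xy W_def by auto
    have c: "real (card (heavy tie i (Suc T) x y)) \<le> B" "i + 2 * K < load tie x y (Suc T) v"
      using w(2) unfolding xy by auto
    have "\<exists>t<Suc T. visit_chain l (\<lambda>t. high_visit tie i v t x y) K t"
      using gap[OF x(1)] gap[OF x(2)] by (intro load_imp_visit_chain[OF _ _ c(2)]) auto
    then obtain t where t: "t < Suc T" "visit_chain l (\<lambda>t. high_visit tie i v t x y) K t" by blast
    \<comment> \<open>Few heavy bins at the end means few at all earlier times, so each high visit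
      is a low visit.\<close>
    have lo: "low_visit i B v t x y" if "t < Suc T" "high_visit tie i v t x y" for t
    proof -
      have "card (heavy tie i (t - L) x y) \<le> card (heavy tie i (Suc T) x y)"
        using that(1) by (intro card_mono finite_heavy[OF i] heavy_mono) auto
      then show ?thesis using c(1) that(2) by (simp add: low_visit_def)
    qed
    have "visit_chain l (\<lambda>t. low_visit i B v t x y) j t"
      if "t < Suc T" "visit_chain l (\<lambda>t. high_visit tie i v t x y) j t" for j t
      using that
    proof (induction j arbitrary: t)
      case (Suc j)
      then obtain s where s: "s + l \<le> t" "visit_chain l (\<lambda>t. high_visit tie i v t x y) j s" by auto
      moreover have "visit_chain l (\<lambda>t. low_visit i B v t x y) j s" using Suc.IH[OF _ s(2)] s(1) Suc.prems(1) by simp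
      ultimately show ?case using lo[OF Suc.prems(1)] Suc.prems(2) by auto
    qed (simp add: lo)
    then show "\<exists>t\<in>{..<Suc T}. case w of (x, y) \<Rightarrow> visit_chain l (\<lambda>t. low_visit i B v t x y) K t"
      using t unfolding xy by auto
  qed
  also have "{w. \<exists>t\<in>{..<Suc T}. case w of (x, y) \<Rightarrow> visit_chain l (\<lambda>t. low_visit i B v t x y) K t}
    = (\<Union>t\<in>{..<Suc T}. {(x, y). visit_chain l (\<lambda>t. low_visit i B v t x y) K t})" by auto
  also have "measure_pmf.prob (W T) \<dots> \<le> (\<Sum>t<Suc T. measure_pmf.prob (W T) {(x, y). visit_chain l (\<lambda>t. low_visit i B v t x y) K t})"
    by (intro measure_pmf.finite_measure_subadditive_finite) auto
  also have "\<dots> \<le> real (Suc T) * (real (Suc T) * (2 * q * eta B) + real L * (2 * a)) ^ K"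
    by (rule prob_chain_sum[OF i B])
  finally show ?thesis by simp
qed

text \<open>Either some level j < J is the first to break its bound, or level i+J obeys it and a bin
  still gains more than 2K balls. Level i never breaks its bound: by counting balls at most (T+1)/i
  bins reach load i.\<close>

lemma prob_load_exceeds:
  fixes B z :: "nat \<Rightarrow> real"
  assumes i: "i > 0" and V: "finite V" and m: "Suc T \<le> L * Suc m"
    and B0: "real (Suc T) \<le> real i * B 0"
    and BS: "\<And>j. j < J \<Longrightarrow> real L + real L * z j \<le> B (Suc j)"
    and BJ: "B J \<ge> 0"
  shows "measure_pmf.prob (W T) {(x, y). \<exists>v\<in>V. i + J + 2 * K < load tie x y (Suc T) v}
    \<le> (\<Sum>j<J. real L * (2 powr - z j * (1 + ((eta (B j))\<^sup>2 + real L * q)) ^ m))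
      + real (card V) * (real (Suc T) * (real (Suc T) * (2 * q * eta (B J)) + real L * (2 * a)) ^ K)"
proof -
  let ?G = "\<lambda>j. {(x, y). real (card (heavy tie (i + j) (Suc T) x y)) \<le> B j \<and>
      real L + real L * z j < real (card (heavy tie (i + Suc j) (Suc T) x y))}"
  let ?H = "\<lambda>v. {(x, y). real (card (heavy tie (i + J) (Suc T) x y)) \<le> B J \<and> i + J + 2 * K < load tie x y (Suc T) v}"
  have "{(x, y). \<exists>v\<in>V. i + J + 2 * K < load tie x y (Suc T) v} \<subseteq> (\<Union>j\<in>{..<J}. ?G j) \<union> (\<Union>v\<in>V. ?H v)"
  proof safe
    fix x y v
    assume v: "v \<in> V" "i + J + 2 * K < load tie x y (Suc T) v" and nH: "(x, y) \<notin> (\<Union>v\<in>V. ?H v)"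
    show "(x, y) \<in> (\<Union>j\<in>{..<J}. ?G j)"
    proof (rule ccontr)
      assume nG: "(x, y) \<notin> (\<Union>j\<in>{..<J}. ?G j)"
      have "real (card (heavy tie (i + j) (Suc T) x y)) \<le> B j" if "j \<le> J" for j
        using that
      proof (induction j)
        case 0
        have "real i * real (card (heavy tie i (Suc T) x y)) \<le> real i * B 0"
          using card_heavy_le[OF i, of tie "Suc T" x y] B0 by (metis of_nat_le_iff of_nat_mult order.trans)
        then show ?case using i by simp
      next
        case (Suc j)
        then have "real (card (heavy tie (i + Suc j) (Suc T) x y)) \<le> real L + real L * z j" using nG by force
        then show ?case using BS[of j] Suc.prems by simp
      qed
      then show False using nH v by auto
    qed
  qed
  then have "measure_pmf.prob (W T) {(x, y). \<exists>v\<in>V. i + J + 2 * K < load tie x y (Suc T) v}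
      \<le> measure_pmf.prob (W T) ((\<Union>j\<in>{..<J}. ?G j) \<union> (\<Union>v\<in>V. ?H v))"
    by (intro measure_pmf.finite_measure_mono) auto
  also have "\<dots> \<le> measure_pmf.prob (W T) (\<Union>j\<in>{..<J}. ?G j) + measure_pmf.prob (W T) (\<Union>v\<in>V. ?H v)"
    by (rule measure_Un_le) auto
  also have "measure_pmf.prob (W T) (\<Union>j\<in>{..<J}. ?G j) \<le> (\<Sum>j<J. measure_pmf.prob (W T) (?G j))"
    by (intro measure_pmf.finite_measure_subadditive_finite) auto
  also have "\<dots> \<le> (\<Sum>j<J. real L * (2 powr - z j * (1 + ((eta (B j))\<^sup>2 + real L * q)) ^ m))"
    using i by (intro sum_mono) (simp only: add_Suc_right, rule prob_heavy_growth[OF _ refl m], simp)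
  also have "measure_pmf.prob (W T) (\<Union>v\<in>V. ?H v) \<le> (\<Sum>v\<in>V. measure_pmf.prob (W T) (?H v))"
    using V by (intro measure_pmf.finite_measure_subadditive_finite) auto
  also have "\<dots> \<le> real (card V) * (real (Suc T) * (real (Suc T) * (2 * q * eta (B J)) + real L * (2 * a)) ^ K)"
    using i BJ by (intro sum_bounded_above prob_load_growth) auto
  finally show ?thesis by simp
qed

end


section \<open>Non-backtracking paths\<close>

fun nb_path :: "'a pair_pre_digraph \<Rightarrow> 'a list \<Rightarrow> bool" where
  "nb_path G (x # y # z # zs) \<longleftrightarrow> (x, y) \<in> parcs G \<and> x \<noteq> z \<and> nb_path G (y # z # zs)"
| "nb_path G [x, y] \<longleftrightarrow> (x, y) \<in> parcs G"
| "nb_path G xs \<longleftrightarrow> True"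

text \<open>The two pieces overlap in an edge, not just a vertex: that is what excludes backtracking
  at the junction.\<close>

lemma nb_path_append:
  "nb_path G (xs @ [u, v]) \<Longrightarrow> nb_path G (u # v # ys) \<Longrightarrow> nb_path G (xs @ u # v # ys)"
proof (induction xs)
  case (Cons x xs)
  then show ?case by (cases xs rule: remdups_adj.cases) auto
qed simp

lemma nb_path_Cons: "nb_path G (x # xs) \<Longrightarrow> nb_path G xs"
  by (cases "(G, x # xs)" rule: nb_path.cases) auto

lemma nb_path_drop: "nb_path G xs \<Longrightarrow> nb_path G (drop m xs)"
proof (induction xs arbitrary: m)
  case (Cons x xs)
  then show ?case by (cases m) (auto dest: nb_path_Cons)
qed simp

lemma nb_path_rev: "pair_graph G \<Longrightarrow> nb_path G xs \<Longrightarrow> nb_path G (rev xs)"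
proof (induction G xs rule: nb_path.induct)
  case (1 G x y z zs)
  note sym = pair_graph_basics(6)[OF 1(2), THEN iffD1]
  have "nb_path G (rev zs @ [z, y])" using 1 by simp
  moreover have "(y, z) \<in> parcs G" using 1(3) nb_path.simps(2) by (cases zs) auto
  then have "nb_path G (z # y # [x])" using 1(3) by (auto intro: sym)
  ultimately show ?case using nb_path_append[of G "rev zs" z y "[x]"] by simp
next
  case (2 G x y)
  then show ?case by (auto intro: pair_graph_basics(6)[THEN iffD1])
qed simp_all

lemma nb_path_take:
  assumes "pair_graph G" "nb_path G xs" shows "nb_path G (take m xs)"
proof (cases "m \<le> length xs")
  case True
  have "nb_path G (rev (drop (length xs - m) (rev xs)))"
    by (intro nb_path_rev nb_path_drop assms)
  then show ?thesis using True by (simp add: rev_drop)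
qed (simp add: assms(2))

lemma nb_path_snoc:
  assumes "nb_path G xs" "xs \<noteq> []" "v \<in> nb_steps G xs"
  shows "nb_path G (xs @ [v])"
proof (cases "length xs \<ge> 2")
  case False
  then obtain x where "xs = [x]" using assms(2) by (cases xs) (auto simp: Suc_le_eq)
  then show ?thesis using assms(3) by (simp add: nb_steps_def)
next
  case True
  obtain xs' x where x: "xs = xs' @ [x]" using assms(2) by (cases xs rule: rev_cases) auto
  obtain ys p where y: "xs' = ys @ [p]" using True x by (cases xs' rule: rev_cases) auto
  have xs: "xs = ys @ [p, x]" using x y by simp
  have v: "(x, v) \<in> parcs G" "v \<noteq> p" using assms(3) True by (auto simp: nb_steps_def xs nth_append)
  have "nb_path G (drop (length ys) xs)" using nb_path_drop[OF assms(1)] .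
  then have "nb_path G (p # x # [v])" using v unfolding xs by simp
  then have "nb_path G (ys @ p # x # [v])" using assms(1) unfolding xs by (rule nb_path_append[rotated])
  then show ?thesis unfolding xs by simp
qed

text \<open>Zipping the vertex list with its shift yields the arc list on which
  \<open>cycle\<close>, and hence \<open>girth\<close>, is defined.\<close>

lemma closed_list_cycle:
  assumes G: "pair_graph G" and "length zs \<ge> 1" "last zs = u" "distinct zs"
    and adj: "\<And>i. i < length zs \<Longrightarrow> ((u # zs) ! i, zs ! i) \<in> parcs G"
  shows "pre_digraph.cycle (with_proj G) (zip (u # zs) zs)"
proof -
  interpret pair_graph G by fact
  have pc: "pcas u (zip (u # zs) zs) (last (u # zs))" for u :: 'a and zs
    by (induction zs arbitrary: u) auto
  have pv: "pawalk_verts u (zip (u # zs) zs) = u # zs" for u :: 'a and zs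
    by (induction zs arbitrary: u) auto
  have "set (zip (u # zs) zs) \<subseteq> parcs G"
    using adj by (auto simp: set_zip)
  moreover have "u \<in> pverts G" using adj[of 0] assms(2) pair_graph_basics(3)[OF G] by force
  moreover have "zs \<noteq> []" using assms(2) by auto
  ultimately show ?thesis
    using pc[of u zs] assms(3,4) unfolding cycle_def awalk_def
    by (intro exI[of _ u]) (auto simp: pv neq_Nil_conv)
qed

lemma nb_path_adj: "nb_path G xs \<Longrightarrow> Suc i < length xs \<Longrightarrow> (xs ! i, xs ! Suc i) \<in> parcs G"
proof (induction G xs arbitrary: i rule: nb_path.induct)
  case (1 G x y z zs)
  then show ?case by (cases i) auto
qed auto

text \<open>Take the shortest suffix with a repetition: its head recurs in a distinct tail, and the
  piece up to the recurrence is a closed walk without other repetitions. It has length at least 3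
  and contradicts the girth.\<close>

lemma nb_path_distinct:
  assumes G: "pair_graph G" and g: "enat m < girth G"
  shows "nb_path G xs \<Longrightarrow> length xs \<le> Suc m \<Longrightarrow> distinct xs"
proof (induction xs)
  case (Cons x ys)
  have d: "distinct ys" using Cons nb_path_Cons by force
  have "x \<notin> set ys"
  proof
    assume "x \<in> set ys"
    then obtain i where i: "i < length ys" "ys ! i = x" by (auto simp: in_set_conv_nth)
    define zs where "zs = take (Suc i) ys"
    have len: "length zs = Suc i" using i by (simp add: zs_def)
    have ne: "ys \<noteq> []" using i by auto
    have "((x # zs) ! j, zs ! j) \<in> parcs G" if "j < length zs" for j
      using nb_path_adj[OF Cons.prems(1), of j] that i ne by (cases j) (simp_all add: zs_def)
    moreover have "last zs = x" using i by (simp add: zs_def take_Suc_conv_app_nth)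
    moreover have "distinct zs" using d by (simp add: zs_def)
    ultimately have cyc: "pre_digraph.cycle (with_proj G) (zip (x # zs) zs)"
      using len by (intro closed_list_cycle[OF G]) auto
    \<comment> \<open>Length 1 would be a loop, and length 2, excluded next, an immediate
      backtrack.\<close>
    have "i \<noteq> 0" using nb_path_adj[OF Cons.prems(1), of 0] i pair_graph_basics(5)[OF G, of x] ne by (cases i) auto
    moreover have "i \<noteq> 1"
    proof
      assume "i = 1"
      then obtain y zs' where "ys = y # x # zs'" using i
        by (cases ys; cases "tl ys") auto
      then show False using Cons.prems(1) by simp
    qed
    ultimately have "3 \<le> length (zip (x # zs) zs)" using len by simp
    then have "girth G \<le> enat (length (zip (x # zs) zs))"
      unfolding girth_def using cyc by (intro Inf_lower CollectI exI[of _ "zip (x # zs) zs"] conjI refl)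
    also have "\<dots> = enat (Suc i)" using len by simp
    also have "\<dots> \<le> enat m" using i Cons.prems(2) by simp
    finally show False using g by simp
  qed
  then show ?case using d by simp
qed simp

text \<open>If the penultimate vertices differ, one path followed by the reverse of the other does
  not backtrack at the common end. It has at most 2l edges and meets its starting vertex again,
  against \<open>nb_path_distinct\<close>. If they agree, shorten both paths.\<close>

lemma nb_path_unique:
  assumes G: "pair_graph G" and g: "enat (2 * l + 1) < girth G"
  shows "nb_path G xs \<Longrightarrow> nb_path G ys \<Longrightarrow> length xs = Suc r \<Longrightarrow> length ys = Suc r \<Longrightarrow> r \<le> l \<Longrightarrow>
    hd xs = hd ys \<Longrightarrow> last xs = last ys \<Longrightarrow> xs = ys"
proof (induction r arbitrary: xs ys)
  case 0
  then show ?case by (auto simp: length_Suc_conv)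
next
  case (Suc r)
  obtain xs' v where x: "xs = xs' @ [v]" using Suc.prems(3) by (cases xs rule: rev_cases) auto
  obtain ys' w where y: "ys = ys' @ [w]" using Suc.prems(4) by (cases ys rule: rev_cases) auto
  have wv: "w = v" using Suc.prems(7) x y by simp
  have len: "length xs' = Suc r" "length ys' = Suc r" using Suc.prems x y by auto
  have nb: "nb_path G xs'" "nb_path G ys'"
    using nb_path_take[OF G Suc.prems(1), of "Suc r"] nb_path_take[OF G Suc.prems(2), of "Suc r"] x y len by auto
  have hd: "hd xs' = hd ys'" using Suc.prems(6) x y len by (cases xs'; cases ys') auto
  have "last xs' = last ys'"
  proof (rule ccontr)
    assume ne: "last xs' \<noteq> last ys'"
    obtain xs'' p where xp: "xs' = xs'' @ [p]" using len by (cases xs' rule: rev_cases) auto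
    obtain ys'' q where yq: "ys' = ys'' @ [q]" using len by (cases ys' rule: rev_cases) auto
    have e: "xs = xs'' @ [p, v]" "ys = ys'' @ [q, v]" using x y xp yq wv by auto
    have "nb_path G (rev ys)" by (rule nb_path_rev[OF G Suc.prems(2)])
    then have r: "nb_path G (v # q # rev ys'')" using e by simp
    have "nb_path G (drop (length xs'') xs)" by (rule nb_path_drop[OF Suc.prems(1)])
    then have "nb_path G (p # v # q # rev ys'')" using r ne xp yq e by auto
    with Suc.prems(1) have "nb_path G (xs'' @ p # v # q # rev ys'')"
      unfolding e by (rule nb_path_append)
    moreover have "length (xs'' @ p # v # q # rev ys'') \<le> Suc (2 * l + 1)"
      using len Suc.prems(5) xp yq by simp
    ultimately have d: "distinct (xs'' @ p # v # q # rev ys'')" using nb_path_distinct[OF G g] by blast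
    have "hd xs' \<in> set (xs'' @ [p])" "hd ys' \<in> set (q # rev ys'')"
      unfolding xp yq by (cases xs''; simp) (cases ys''; simp)
    moreover have "set (xs'' @ [p]) \<inter> set (q # rev ys'') = {}" using d by auto
    ultimately show False unfolding hd by blast
  qed
  then have "xs' = ys'" using Suc.IH[OF nb len] Suc.prems(5) hd by simp
  then show ?case using x y wv by simp
qed

section \<open>The non-backtracking walk on a regular graph\<close>

definition nb_step_pmf :: "'a pair_pre_digraph \<Rightarrow> 'a list \<Rightarrow> 'a pmf" where
  "nb_step_pmf G xs = pmf_of_set (nb_steps G xs)"

definition nb_init :: "'a pair_pre_digraph \<Rightarrow> 'a list pmf" where
  "nb_init G = map_pmf (\<lambda>v. [v]) (pmf_of_set (pverts G))"

lemma nb_walk_eq: "nb_walk G t = bind_pmf (nb_init G) (walk_ext (nb_step_pmf G) t)"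
proof (induction t)
  case 0
  show ?case by (simp add: nb_init_def bind_return_pmf')
next
  case (Suc t)
  have "nb_walk G (Suc t) = bind_pmf (bind_pmf (nb_init G) (walk_ext (nb_step_pmf G) t))
      (\<lambda>xs. map_pmf (\<lambda>v. xs @ [v]) (nb_step_pmf G xs))"
    unfolding nb_walk.simps Suc nb_step_pmf_def[symmetric] by (rule refl)
  also have "\<dots> = bind_pmf (nb_init G) (walk_ext (nb_step_pmf G) (Suc t))"
    unfolding bind_assoc_pmf by (intro bind_pmf_cong refl) simp
  finally show ?case .
qed

definition nb_traj :: "'a pair_pre_digraph \<Rightarrow> 'a list \<Rightarrow> bool" where
  "nb_traj G xs \<longleftrightarrow> xs \<noteq> [] \<and> set xs \<subseteq> pverts G \<and> nb_path G xs"

lemma nb_steps_card: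
  assumes reg: "regular_graph k G" and xs: "nb_traj G xs"
  shows "finite (nb_steps G xs)" "card (nb_steps G xs) = (if 2 \<le> length xs then k - 1 else k)"
proof -
  have G: "pair_graph G" using reg by (simp add: regular_graph_def)
  have l: "last xs \<in> pverts G" using xs unfolding nb_traj_def by (meson last_in_set subsetD)
  note nbs = regular_graph_neighbours[OF reg l]
  show "finite (nb_steps G xs)" unfolding nb_steps_def using nbs by simp
  show "card (nb_steps G xs) = (if 2 \<le> length xs then k - 1 else k)"
  proof (cases "2 \<le> length xs")
    case True
    have "(xs ! (length xs - 2), xs ! Suc (length xs - 2)) \<in> parcs G"
      using xs True unfolding nb_traj_def by (intro nb_path_adj) auto
    moreover have "Suc (length xs - 2) = length xs - 1" using True by simp
    ultimately have "(last xs, xs ! (length xs - 2)) \<in> parcs G"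
      using xs pair_graph_basics(6)[OF G] unfolding nb_traj_def by (simp add: last_conv_nth)
    then show ?thesis using True nbs unfolding nb_steps_def by (simp add: card_Diff_singleton)
  qed (use nbs in \<open>simp add: nb_steps_def\<close>)
qed

lemma nb_step_pmf_support:
  assumes "regular_graph k G" "k \<ge> 2" "nb_traj G xs"
  shows "nb_steps G xs \<noteq> {}" "set_pmf (nb_step_pmf G xs) = nb_steps G xs"
proof -
  have "card (nb_steps G xs) > 0" using nb_steps_card[OF assms(1,3)] assms(2) by auto
  then show "nb_steps G xs \<noteq> {}" by auto
  then show "set_pmf (nb_step_pmf G xs) = nb_steps G xs"
    unfolding nb_step_pmf_def by (intro set_pmf_of_set nb_steps_card(1)[OF assms(1,3)])
qed

lemma nb_traj_snoc:
  assumes "regular_graph k G" "nb_traj G xs" "v \<in> nb_steps G xs"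
  shows "nb_traj G (xs @ [v])"
  using assms nb_path_snoc[of G xs v] pair_graph_basics(4)[of G "last xs" v]
  unfolding nb_traj_def regular_graph_def by (auto simp: nb_steps_def)

lemma walk_ext_traj:
  assumes "regular_graph k G" "k \<ge> 2" "nb_traj G xs"
  shows "zs \<in> set_pmf (walk_ext (nb_step_pmf G) r xs) \<Longrightarrow> nb_traj G zs"
proof (induction r arbitrary: zs)
  case (Suc r)
  then obtain ys v where y: "ys \<in> set_pmf (walk_ext (nb_step_pmf G) r xs)"
    "v \<in> set_pmf (nb_step_pmf G ys)" "zs = ys @ [v]" by auto
  then show ?case using nb_traj_snoc[OF assms(1) Suc.IH[OF y(1)]] nb_step_pmf_support(2)[OF assms(1,2) Suc.IH[OF y(1)]] by simp
qed (use assms in simp)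

lemma nb_init_traj:
  assumes "regular_graph k G" "pverts G \<noteq> {}" "xs \<in> set_pmf (nb_init G)"
  shows "length xs = 1" "nb_traj G xs"
  using assms pair_graph_basics(1)[of G] unfolding nb_init_def nb_traj_def regular_graph_def by auto

lemma prob_bind_uniform:
  assumes "finite S" "S \<noteq> {}"
  shows "measure_pmf.prob (bind_pmf (pmf_of_set S) f) X = (\<Sum>w\<in>S. measure_pmf.prob (f w) X) / real (card S)"
proof -
  have "emeasure (bind_pmf (pmf_of_set S) f) X = (\<Sum>w\<in>S. emeasure (f w) X) / ennreal (real (card S))"
    using assms by (simp add: nn_integral_pmf_of_set ennreal_of_nat_eq_real_of_nat)
  also have "\<dots> = ennreal ((\<Sum>w\<in>S. measure_pmf.prob (f w) X) / real (card S))"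
    using assms by (simp add: measure_pmf.emeasure_eq_measure sum_ennreal divide_ennreal sum_nonneg card_gt_0_iff)
  finally show ?thesis by (simp add: measure_pmf.emeasure_eq_measure sum_nonneg)
qed

lemma walk_ext_point_prob:
  assumes reg: "regular_graph k G" "k \<ge> 2" and xs: "nb_traj G xs"
  shows "measure_pmf.prob (walk_ext (nb_step_pmf G) r xs) {zs} \<le> 1 / real (k - 1) ^ r"
proof (induction r arbitrary: zs)
  case 0
  show ?case by simp
next
  case (Suc r)
  have "measure_pmf.prob (walk_ext (nb_step_pmf G) (Suc r) xs) {zs}
     \<le> 1 / real (k - 1) * measure_pmf.prob (walk_ext (nb_step_pmf G) r xs) {ys. ys = butlast zs}"
    unfolding walk_ext.simps
  proof (rule prob_bind_le)
    fix ys assume ys: "ys \<in> set_pmf (walk_ext (nb_step_pmf G) r xs)" "ys = butlast zs"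
    note t = walk_ext_traj[OF reg xs ys(1)]
    have c: "k - 1 \<le> card (nb_steps G ys)" "card (nb_steps G ys) > 0" using nb_steps_card[OF reg(1) t] reg(2) by auto
    have "measure_pmf.prob (map_pmf (\<lambda>v. ys @ [v]) (nb_step_pmf G ys)) {zs}
      \<le> measure_pmf.prob (nb_step_pmf G ys) {last zs}"
      by (simp, intro measure_pmf.finite_measure_mono) auto
    also have "\<dots> \<le> 1 / real (card (nb_steps G ys))"
      unfolding nb_step_pmf_def measure_pmf_single
      using nb_steps_card(1)[OF reg(1) t] nb_step_pmf_support(1)[OF reg t] by (simp add: indicator_def)
    also have "\<dots> \<le> 1 / real (k - 1)" using c reg(2) by (intro divide_left_mono) auto
    finally show "measure_pmf.prob (map_pmf (\<lambda>v. ys @ [v]) (nb_step_pmf G ys)) {zs} \<le> 1 / real (k - 1)" .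
  qed (auto simp: measure_pmf_zero_iff)
  also have "\<dots> \<le> 1 / real (k - 1) * (1 / real (k - 1) ^ r)"
    using Suc[of "butlast zs"] by (intro mult_left_mono) auto
  finally show ?case by simp
qed

text \<open>At most one continuation of length l ends at v, so the event is a single trajectory, and
  each of its steps has probability at most 1/(k-1).\<close>

lemma prob_hit_girth:
  assumes reg: "regular_graph k G" "k \<ge> 2" and xs: "nb_traj G xs" and g: "enat (2 * l + 1) < girth G"
  shows "measure_pmf.prob (walk_ext (nb_step_pmf G) l xs) {zs. last zs = v} \<le> 1 / real (k - 1) ^ l"
proof (cases "\<exists>zs\<in>set_pmf (walk_ext (nb_step_pmf G) l xs). last zs = v")
  case False
  then have "measure_pmf.prob (walk_ext (nb_step_pmf G) l xs) {zs. last zs = v} = 0"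
    by (auto simp: measure_pmf_zero_iff)
  then show ?thesis by simp
next
  case True
  have G: "pair_graph G" using reg by (simp add: regular_graph_def)
  obtain zs where zs: "zs \<in> set_pmf (walk_ext (nb_step_pmf G) l xs)" "last zs = v" using True by blast
  have "measure_pmf.prob (walk_ext (nb_step_pmf G) l xs) {ys. last ys = v}
     \<le> measure_pmf.prob (walk_ext (nb_step_pmf G) l xs) {ys. ys = zs}"
  proof (rule prob_mono_support)
    fix ys assume ys: "ys \<in> set_pmf (walk_ext (nb_step_pmf G) l xs)" "last ys = v"
    \<comment> \<open>Dropping m vertices keeps the last vertex of xs, which is thus a common
      starting point of the continuations.\<close>
    define m where "m = length xs - 1"
    have x: "xs \<noteq> []" "length xs = Suc m" using xs by (auto simp: nb_traj_def m_def)
    have *: "length w = Suc m + l" "take (Suc m) w = xs" "nb_path G (drop m w)" "hd (drop m w) = last xs"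
      "last (drop m w) = last w"
      if w: "w \<in> set_pmf (walk_ext (nb_step_pmf G) l xs)" for w
    proof -
      show 1: "length w = Suc m + l" "take (Suc m) w = xs" using walk_ext_prefix[OF w] x by auto
      show "nb_path G (drop m w)" using walk_ext_traj[OF reg xs w] nb_path_drop by (auto simp: nb_traj_def)
      show "last (drop m w) = last w" using 1 by simp
      have "hd (drop m w) = w ! m" using 1 by (simp add: hd_drop_conv_nth)
      also have "\<dots> = xs ! m" using 1(2) by (metis lessI nth_take)
      finally show "hd (drop m w) = last xs" using x by (simp add: last_conv_nth)
    qed
    have "drop m ys = drop m zs"
      using *[OF ys(1)] *[OF zs(1)] ys(2) zs(2) by (intro nb_path_unique[OF G g, of _ _ l]) auto
    moreover have "take m ys = take m zs"
      using arg_cong[OF *(2)[OF ys(1)], of "take m"] arg_cong[OF *(2)[OF zs(1)], of "take m"] by (simp add: min_def)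
    ultimately show "ys = zs" by (metis append_take_drop_id)
  qed
  then show ?thesis using walk_ext_point_prob[OF reg xs, of l zs] by simp
qed

lemma nb_path_gap:
  assumes G: "pair_graph G" and g: "enat (2 * l + 1) < girth G" and xs: "nb_path G xs"
    and j: "j < j'" "j' < length xs" "xs ! j = xs ! j'"
  shows "j + l \<le> j'"
proof (rule ccontr)
  assume "\<not> ?thesis"
  then have lt: "j' - j < l" using j by simp
  let ?ys = "take (Suc (j' - j)) (drop j xs)"
  have "nb_path G ?ys" by (intro nb_path_take[OF G] nb_path_drop xs)
  moreover have "length ?ys \<le> Suc (2 * l + 1)" using lt by simp
  ultimately have d: "distinct ?ys" using nb_path_distinct[OF G g] by blast
  have "?ys ! 0 = xs ! j" "?ys ! (j' - j) = xs ! j'" using j by auto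
  then have "?ys ! 0 = ?ys ! (j' - j)" using j by simp
  moreover have "length ?ys = Suc (j' - j)" using j by simp
  ultimately show False using nth_eq_iff_index_eq[OF d, of 0 "j' - j"] j(1) by simp
qed


section \<open>Counting non-backtracking paths\<close>

text \<open>\<open>nb_cont G t p u v\<close> counts the continuations to \<open>v\<close> of a walk that has just stepped from \<open>p\<close> to \<open>u\<close>.\<close>

primrec nb_cont :: "'a pair_pre_digraph \<Rightarrow> nat \<Rightarrow> 'a \<Rightarrow> 'a \<Rightarrow> 'a \<Rightarrow> nat" where
  "nb_cont G 0 = (\<lambda>p u v. of_bool (u = v))"
| "nb_cont G (Suc t) = (\<lambda>p u v. \<Sum>w\<in>{w. (u, w) \<in> parcs G} - {p}. nb_cont G t u w v)"

fun nb_count :: "'a pair_pre_digraph \<Rightarrow> nat \<Rightarrow> 'a \<Rightarrow> 'a \<Rightarrow> nat" where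
  "nb_count G 0 u v = of_bool (u = v)"
| "nb_count G (Suc t) u v = (\<Sum>w\<in>{w. (u, w) \<in> parcs G}. nb_cont G t u w v)"

text \<open>Paths from u are sorted by whether their first step goes to p.\<close>

lemma nb_count_split:
  assumes "regular_graph k G" "(u, p) \<in> parcs G"
  shows "nb_count G (Suc t) u v = nb_cont G (Suc t) p u v + nb_cont G t u p v"
proof -
  have G: "pair_graph G" using assms(1) by (simp add: regular_graph_def)
  have "finite {w. (u, w) \<in> parcs G}"
    by (rule regular_graph_neighbours(1)[OF assms(1) pair_graph_basics(3)[OF G assms(2)]])
  moreover have "p \<in> {w. (u, w) \<in> parcs G}" using assms(2) by simp
  ultimately have "(\<Sum>w\<in>{w. (u, w) \<in> parcs G}. nb_cont G t u w v)
      = nb_cont G t u p v + (\<Sum>w\<in>{w. (u, w) \<in> parcs G} - {p}. nb_cont G t u w v)"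
    by (rule sum.remove)
  then show ?thesis by (simp only: nb_count.simps nb_cont.simps add.commute)
qed

lemma nb_cont_le_count:
  assumes "regular_graph k G" "u \<in> pverts G"
  shows "nb_cont G t p u v \<le> nb_count G t u v"
  using regular_graph_neighbours(1)[OF assms] by (cases t) (auto intro!: sum_mono2)

text \<open>A path of positive length from u is counted for every neighbour w except its own first
  step, hence k-1 times; the empty path is counted k times. This is the source of the exceptional
  coefficient in \<open>nb_poly\<close>.\<close>

lemma sum_nb_cont_back:
  assumes reg: "regular_graph k G" and u: "u \<in> pverts G" and k: "k \<ge> 1"
  shows "(\<Sum>w\<in>{w. (u, w) \<in> parcs G}. real (nb_cont G t w u v)) =
    (if t = 0 then real k else real k - 1) * real (nb_count G t u v)"
proof (cases t)
  case 0
  then show ?thesis using regular_graph_neighbours[OF reg u] by simp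
next
  case (Suc s)
  have "(\<Sum>w\<in>{w. (u, w) \<in> parcs G}. real (nb_cont G t w u v))
    = (\<Sum>w\<in>{w. (u, w) \<in> parcs G}. real (nb_count G t u v) - real (nb_cont G s u w v))"
  proof (intro sum.cong refl)
    fix w assume "w \<in> {w. (u, w) \<in> parcs G}"
    then have "nb_count G t u v = nb_cont G t w u v + nb_cont G s u w v"
      unfolding Suc by (intro nb_count_split[OF reg]) simp
    then show "real (nb_cont G t w u v) = real (nb_count G t u v) - real (nb_cont G s u w v)" by linarith
  qed
  also have "\<dots> = real k * real (nb_count G t u v) - real (nb_count G t u v)"
    using regular_graph_neighbours[OF reg u] unfolding Suc by (simp add: sum_subtractf)
  finally show ?thesis using Suc by (simp add: algebra_simps)
qed

text \<open>Prepend a step from u to w to a path from w, and discard those that return to u at once;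
  the discarded ones are summed by \<open>sum_nb_cont_back\<close>.\<close>

lemma nb_count_rec:
  assumes reg: "regular_graph k G" and u: "u \<in> pverts G" and k: "k \<ge> 1"
  shows "real (nb_count G (Suc (Suc t)) u v) = (\<Sum>w\<in>{w. (u, w) \<in> parcs G}. real (nb_count G (Suc t) w v))
    - (if t = 0 then real k else real k - 1) * real (nb_count G t u v)"
proof -
  have G: "pair_graph G" using reg by (simp add: regular_graph_def)
  have "real (nb_count G (Suc (Suc t)) u v) = (\<Sum>w\<in>{w. (u, w) \<in> parcs G}. real (nb_cont G (Suc t) u w v))" by simp
  also have "\<dots> = (\<Sum>w\<in>{w. (u, w) \<in> parcs G}. real (nb_count G (Suc t) w v) - real (nb_cont G t w u v))"
  proof (intro sum.cong refl)
    fix w assume "w \<in> {w. (u, w) \<in> parcs G}"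
    then have "(w, u) \<in> parcs G" using pair_graph_basics(6)[OF G, of u w] by simp
    then have "nb_count G (Suc t) w v = nb_cont G (Suc t) u w v + nb_cont G t w u v"
      by (rule nb_count_split[OF reg])
    then show "real (nb_cont G (Suc t) u w v) = real (nb_count G (Suc t) w v) - real (nb_cont G t w u v)" by linarith
  qed
  also have "\<dots> = (\<Sum>w\<in>{w. (u, w) \<in> parcs G}. real (nb_count G (Suc t) w v))
      - (\<Sum>w\<in>{w. (u, w) \<in> parcs G}. real (nb_cont G t w u v))" by (rule sum_subtractf)
  finally show ?thesis unfolding sum_nb_cont_back[OF reg u k] .
qed

lemma adjacency_matrix_mult:
  assumes G: "pair_graph G" and n: "n = card (pverts G)" and M: "M \<in> carrier_mat n n"
    and f: "\<And>i. i < n \<Longrightarrow> M $$ (i, j) = f (vertex_list G ! i)" and ij: "i < n" "j < n"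
  shows "(adjacency_matrix G * M) $$ (i, j) = (\<Sum>w\<in>{w. (vertex_list G ! i, w) \<in> parcs G}. f w)"
proof -
  let ?u = "vertex_list G ! i"
  have A: "adjacency_matrix G \<in> carrier_mat n n" using adjacency_matrix_index(2) n by auto
  have "(adjacency_matrix G * M) $$ (i, j) = (\<Sum>m<n. adjacency_matrix G $$ (i, m) * M $$ (m, j))"
    using A M ij by (simp add: scalar_prod_def lessThan_atLeast0)
  also have "\<dots> = (\<Sum>m<card (pverts G). if (?u, vertex_list G ! m) \<in> parcs G then f (vertex_list G ! m) else 0)"
    using f ij n by (intro sum.cong) (auto simp: adjacency_matrix_index)
  also have "\<dots> = (\<Sum>w\<in>pverts G. if (?u, w) \<in> parcs G then f w else 0)"
    by (rule sum.reindex_bij_betw[OF vertex_list(4)[OF G], of "\<lambda>w. if (?u, w) \<in> parcs G then f w else 0"])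
  also have "\<dots> = (\<Sum>w\<in>{w. (?u, w) \<in> parcs G}. f w)"
    using pair_graph_basics(1,4)[OF G] by (subst sum.inter_filter[symmetric]) (auto intro!: sum.cong)
  finally show ?thesis .
qed

lemma nb_mat_index:
  assumes reg: "regular_graph k G" and n: "n = card (pverts G)" and k: "k \<ge> 1"
  shows "i < n \<Longrightarrow> j < n \<Longrightarrow> nb_mat n (real k - 1) (adjacency_matrix G) t $$ (i, j)
    = real (nb_count G t (vertex_list G ! i) (vertex_list G ! j))"
proof (induction t arbitrary: i j rule: less_induct)
  case (less t)
  let ?N = "nb_mat n (real k - 1) (adjacency_matrix G)"
  have G: "pair_graph G" using reg by (simp add: regular_graph_def)
  have A: "adjacency_matrix G \<in> carrier_mat n n" using adjacency_matrix_index(2) n by auto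
  have c: "?N t \<in> carrier_mat n n" for t by (rule mat_fun_carrier[OF mat_fun_nb A])
  have u: "vertex_list G ! i \<in> pverts G" using vertex_list(2,3)[OF G] less.prems n by (metis nth_mem)
  have id: "1\<^sub>m n $$ (i, j) = real (nb_count G 0 (vertex_list G ! i) (vertex_list G ! j))"
    if "i < n" "j < n" for i j
    using vertex_list[OF G] that n by (auto simp: nth_eq_iff_index_eq)
  \<comment> \<open>The two nontrivial clauses of \<open>nb_mat\<close> are merged into the shape of
    \<open>nb_count_rec\<close>.\<close>
  have rec: "?N (Suc (Suc s)) = adjacency_matrix G * ?N (Suc s) - (if s = 0 then real k else real k - 1) \<cdot>\<^sub>m ?N s" for s
    by (cases s) auto
  consider "t = 0" | "t = 1" | s where "t = Suc (Suc s)" by (metis One_nat_def not0_implies_Suc)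
  then show ?case
  proof cases
    case 1
    then show ?thesis using id less.prems by simp
  next
    case 2
    have "(adjacency_matrix G * 1\<^sub>m n) $$ (i, j)
      = (\<Sum>w\<in>{w. (vertex_list G ! i, w) \<in> parcs G}. real (nb_count G 0 w (vertex_list G ! j)))"
      using less.prems by (intro adjacency_matrix_mult[OF G n] id) auto
    then show ?thesis using 2 by simp
  next
    case 3
    have "(adjacency_matrix G * ?N (Suc s)) $$ (i, j)
      = (\<Sum>w\<in>{w. (vertex_list G ! i, w) \<in> parcs G}. real (nb_count G (Suc s) w (vertex_list G ! j)))"
      using less.prems 3 by (intro adjacency_matrix_mult[OF G n c] less.IH) auto
    moreover have "?N s $$ (i, j) = real (nb_count G s (vertex_list G ! i) (vertex_list G ! j))"
      using less.prems 3 by (intro less.IH) auto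
    moreover have "?N t $$ (i, j) = (adjacency_matrix G * ?N (Suc s)) $$ (i, j)
        - (if s = 0 then real k else real k - 1) * ?N s $$ (i, j)"
      unfolding 3 rec using less.prems c[of s] c[of "Suc s"] A by simp
    ultimately show ?thesis unfolding 3 nb_count_rec[OF reg u k] by simp
  qed
qed

text \<open>One squared deviation is bounded by the sum of all n^2 of them, hence the factor sqrt n
  in front of R.\<close>

lemma nb_count_mixing:
  assumes reg: "regular_graph k G" and k: "k \<ge> 1" and uv: "u \<in> pverts G" "v \<in> pverts G"
    and lam: "expansion G \<le> lam" "lam < real k"
    and R: "\<And>x. \<bar>x\<bar> \<le> lam \<Longrightarrow> \<bar>nb_poly (real k - 1) t x\<bar> \<le> R" and "R \<ge> 0"
  shows "real (nb_count G t u v) \<le> nb_poly (real k - 1) t (real k) / real (card (pverts G)) + sqrt (real (card (pverts G))) * R"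
proof -
  define n where "n = card (pverts G)"
  have G: "pair_graph G" using reg by (simp add: regular_graph_def)
  have n0: "n > 0" using uv pair_graph_basics(1)[OF G] unfolding n_def by (auto simp: card_gt_0_iff)
  let ?M = "nb_mat n (real k - 1) (adjacency_matrix G) t"
  let ?c = "nb_poly (real k - 1) t (real k) / real n"
  obtain i where i: "i < n" "vertex_list G ! i = u"
    using vertex_list[OF G] uv(1) unfolding n_def by (metis in_set_conv_nth)
  obtain j where j: "j < n" "vertex_list G ! j = v"
    using vertex_list[OF G] uv(2) unfolding n_def by (metis in_set_conv_nth)
  have "(?M $$ (i, j) - ?c)\<^sup>2 \<le> (\<Sum>j<n. (?M $$ (i, j) - ?c)\<^sup>2)"
    by (rule member_le_sum[where f = "\<lambda>j. (?M $$ (i, j) - ?c)\<^sup>2"]) (use j in auto)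
  also have "\<dots> \<le> (\<Sum>i<n. \<Sum>j<n. (?M $$ (i, j) - ?c)\<^sup>2)"
    by (rule member_le_sum[where f = "\<lambda>i. \<Sum>j<n. (?M $$ (i, j) - ?c)\<^sup>2"]) (use i in \<open>auto intro: sum_nonneg\<close>)
  also have "\<dots> \<le> real n * R\<^sup>2"
    by (rule regular_graph_frobenius_bound(2)[OF reg n_def n0 lam mat_fun_nb R])
  also have "\<dots> = (sqrt (real n) * R)\<^sup>2" by (simp add: power_mult_distrib)
  finally have "\<bar>?M $$ (i, j) - ?c\<bar> \<le> sqrt (real n) * R"
    using assms(8) by (metis abs_le_square_iff abs_of_nonneg mult_nonneg_nonneg of_nat_0_le_iff real_sqrt_ge_zero)
  then show ?thesis
    using nb_mat_index[OF reg n_def k i(1) j(1), of t, unfolded i(2) j(2)] unfolding n_def by linarith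
qed

text \<open>The first step is peeled off instead of the last, since \<open>nb_cont\<close> recurses
  that way. With a previous vertex known, each step is uniform over exactly k-1 choices.\<close>

lemma prob_hit_cont:
  assumes reg: "regular_graph k G" "k \<ge> 2"
  shows "nb_traj G xs \<Longrightarrow> 2 \<le> length xs \<Longrightarrow>
    measure_pmf.prob (walk_ext (nb_step_pmf G) r xs) {zs. last zs = v}
      \<le> real (nb_cont G r (xs ! (length xs - 2)) (last xs) v) / real (k - 1) ^ r"
proof (induction r arbitrary: xs)
  case 0
  then show ?case by (simp add: indicator_def)
next
  case (Suc r)
  let ?S = "nb_steps G xs"
  note S = nb_steps_card[OF reg(1) Suc.prems(1)] nb_step_pmf_support(1)[OF reg Suc.prems(1)]
  have ne: "xs \<noteq> []" using Suc.prems by auto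
  have "walk_ext (nb_step_pmf G) (Suc r) xs = bind_pmf (walk_ext (nb_step_pmf G) 1 xs) (walk_ext (nb_step_pmf G) r)"
    using walk_ext_add[of "nb_step_pmf G" 1 r xs] by simp
  also have "\<dots> = bind_pmf (pmf_of_set ?S) (\<lambda>w. walk_ext (nb_step_pmf G) r (xs @ [w]))"
    by (simp add: bind_return_pmf bind_map_pmf nb_step_pmf_def)
  finally have "measure_pmf.prob (walk_ext (nb_step_pmf G) (Suc r) xs) {zs. last zs = v}
     = (\<Sum>w\<in>?S. measure_pmf.prob (walk_ext (nb_step_pmf G) r (xs @ [w])) {zs. last zs = v}) / real (card ?S)"
    using prob_bind_uniform[OF S(1,3)] by simp
  also have "\<dots> \<le> (\<Sum>w\<in>?S. real (nb_cont G r (last xs) w v) / real (k - 1) ^ r) / real (card ?S)"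
  proof (intro divide_right_mono sum_mono)
    fix w assume w: "w \<in> ?S"
    have "(xs @ [w]) ! (length (xs @ [w]) - 2) = last xs"
      using ne by (simp add: nth_append last_conv_nth)
    then show "measure_pmf.prob (walk_ext (nb_step_pmf G) r (xs @ [w])) {zs. last zs = v}
       \<le> real (nb_cont G r (last xs) w v) / real (k - 1) ^ r"
      using Suc.IH[OF nb_traj_snoc[OF reg(1) Suc.prems(1) w]] Suc.prems(2) by simp
  qed simp
  also have "\<dots> = real (\<Sum>w\<in>?S. nb_cont G r (last xs) w v) / real (k - 1) ^ Suc r"
    using S(2) Suc.prems(2) by (simp add: sum_divide_distrib[symmetric])
  also have "(\<Sum>w\<in>?S. nb_cont G r (last xs) w v) = nb_cont G (Suc r) (xs ! (length xs - 2)) (last xs) v"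
    using Suc.prems(2) by (simp add: nb_steps_def)
  finally show ?case .
qed

text \<open>Forgetting the previous vertex makes the bound depend only on the current one. A walk
  that has not yet moved has k choices for its first step.\<close>

lemma prob_hit_count:
  assumes reg: "regular_graph k G" "k \<ge> 2" and xs: "nb_traj G xs"
  shows "measure_pmf.prob (walk_ext (nb_step_pmf G) r xs) {zs. last zs = v}
      \<le> real (nb_count G r (last xs) v) / real (k - 1) ^ r"
proof (cases "2 \<le> length xs")
  case True
  have "last xs \<in> pverts G" using xs unfolding nb_traj_def by (meson last_in_set subsetD)
  then have "real (nb_cont G r (xs ! (length xs - 2)) (last xs) v) / real (k - 1) ^ r
     \<le> real (nb_count G r (last xs) v) / real (k - 1) ^ r"
    by (intro divide_right_mono of_nat_mono nb_cont_le_count[OF reg(1)]) auto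
  then show ?thesis using prob_hit_cont[OF reg xs True, of r v] by linarith
next
  case False
  have "xs \<noteq> []" using xs by (simp add: nb_traj_def)
  then obtain u us where "xs = u # us" by (cases xs) auto
  then have u: "xs = [u]" using False by (cases us) auto
  show ?thesis
  proof (cases r)
    case 0
    then show ?thesis by (simp add: indicator_def)
  next
    case (Suc s)
    let ?S = "nb_steps G xs"
    note S = nb_steps_card[OF reg(1) xs] nb_step_pmf_support(1)[OF reg xs]
    have "walk_ext (nb_step_pmf G) (Suc s) xs = bind_pmf (walk_ext (nb_step_pmf G) 1 xs) (walk_ext (nb_step_pmf G) s)"
      using walk_ext_add[of "nb_step_pmf G" 1 s xs] by simp
    also have "\<dots> = bind_pmf (pmf_of_set ?S) (\<lambda>w. walk_ext (nb_step_pmf G) s (xs @ [w]))"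
      by (simp add: bind_return_pmf bind_map_pmf nb_step_pmf_def)
    finally have "measure_pmf.prob (walk_ext (nb_step_pmf G) (Suc s) xs) {zs. last zs = v}
       = (\<Sum>w\<in>?S. measure_pmf.prob (walk_ext (nb_step_pmf G) s (xs @ [w])) {zs. last zs = v}) / real (card ?S)"
      using prob_bind_uniform[OF S(1,3)] by simp
    also have "\<dots> \<le> (\<Sum>w\<in>?S. real (nb_cont G s u w v) / real (k - 1) ^ s) / real (card ?S)"
    proof (intro divide_right_mono sum_mono)
      fix w assume "w \<in> ?S"
      from prob_hit_cont[OF reg nb_traj_snoc[OF reg(1) xs this], of s v]
      show "measure_pmf.prob (walk_ext (nb_step_pmf G) s (xs @ [w])) {zs. last zs = v}
         \<le> real (nb_cont G s u w v) / real (k - 1) ^ s" by (simp add: u)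
    qed simp
    \<comment> \<open>The k choices of the first step are weakened to k-1, to unify both
      cases.\<close>
    also have "\<dots> \<le> (\<Sum>w\<in>?S. real (nb_cont G s u w v) / real (k - 1) ^ s) / real (k - 1)"
    proof (rule divide_left_mono)
      show "real (k - 1) \<le> real (card ?S)" using S(2) False by simp
      show "0 < real (card ?S) * real (k - 1)" using S(2) False reg(2) by simp
    qed (intro sum_nonneg divide_nonneg_nonneg zero_le_power of_nat_0_le_iff)
    finally have le: "measure_pmf.prob (walk_ext (nb_step_pmf G) (Suc s) xs) {zs. last zs = v}
       \<le> (\<Sum>w\<in>?S. real (nb_cont G s u w v) / real (k - 1) ^ s) / real (k - 1)" .
    have "nb_count G (Suc s) (last xs) v = (\<Sum>w\<in>?S. nb_cont G s u w v)"
      by (simp add: u nb_steps_def)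
    then have "real (nb_count G (Suc s) (last xs) v) / real (k - 1) ^ Suc s
       = (\<Sum>w\<in>?S. real (nb_cont G s u w v)) / real (k - 1) ^ Suc s"
      by (simp only: of_nat_sum)
    also have "\<dots> = (\<Sum>w\<in>?S. real (nb_cont G s u w v) / real (k - 1) ^ s) / real (k - 1)"
      unfolding sum_divide_distrib[symmetric] by (simp add: field_simps)
    finally show ?thesis unfolding Suc using le by (simp only:)
  qed
qed


section \<open>Asymptotics\<close>

context walk_pair
begin

text \<open>With \<open>b j = exp (- 2 ^ j) / D\<close>, so that \<open>D * b j ^ 2 = b (Suc j)\<close>, at most \<open>n * b j\<close> bins are expected
  to have load at least \<open>i + j\<close>, as long as \<open>b j\<close> exceeds the error terms bounded by \<open>\<beta>\<close>.\<close>

lemma prob_load_concrete: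
  fixes C D \<beta> :: real and n :: nat
  assumes n: "n = Suc T" and q: "q = C / real n" and D: "D = 4 * ((C + 1)\<^sup>2 + 1) + 1"
    and i: "D * exp 1 \<le> real i" and V: "finite V" "card V = n"
    and \<beta>: "\<beta> > 0" "\<beta> \<le> exp (- (2 ^ J)) / D"
    and h: "real L * a + real L * q \<le> \<beta>" "real L * q \<le> \<beta>\<^sup>2" "real L \<le> real n * \<beta>\<^sup>2"
  shows "measure_pmf.prob (W T) {(x, y). \<exists>v\<in>V. i + J + 2 * K < load tie x y n v}
    \<le> real J * (real L * exp (- (real n * \<beta>\<^sup>2 / real L)))
      + real n * (real n * (2 * C * (C + 1) * exp (- (2 ^ J)) + 2 * (real L * a)) ^ K)"
proof -
  define P where "P = (C + 1)\<^sup>2 + 1"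
  have n0: "real n > 0" using n by simp
  have C0: "C \<ge> 0" using pos(4) n0 unfolding q by (simp add: zero_le_divide_iff)
  \<comment> \<open>In D = 4P+1 the part 4P pays for L * \<open>z j\<close>, and the 1 for the first
    L times.\<close>
  have P: "P \<ge> 1" "D = 4 * P + 1" unfolding P_def D by simp_all
  have D1: "D \<ge> 1" "D > 0" using P by simp_all
  define b where "b j = exp (- (2 ^ j)) / D" for j :: nat
  have bS: "b (Suc j) = D * (b j)\<^sup>2" for j
  proof -
    have "exp (- (2 ^ Suc j :: real)) = exp (- (2 ^ j)) * exp (- (2 ^ j))"
      by (simp add: exp_add[symmetric])
    then show ?thesis using D1 by (simp add: b_def power2_eq_square)
  qed
  have b0: "b j > 0" for j using D1 by (simp add: b_def)
  have b\<beta>: "\<beta> \<le> b j" if "j \<le> J" for j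
  proof -
    have "(2::real) ^ j \<le> 2 ^ J" using that by (intro power_increasing) auto
    then have "b J \<le> b j" using D1 by (simp add: b_def divide_right_mono)
    then show ?thesis using \<beta>(2) unfolding b_def by linarith
  qed
  have b\<beta>2: "\<beta>\<^sup>2 \<le> (b j)\<^sup>2" if "j \<le> J" for j
    using b\<beta>[OF that] \<beta>(1) by (intro power_mono) auto
  \<comment> \<open>The error terms of \<open>eta\<close> are at most \<beta>, hence at most
    \<open>b j\<close> while j <= J.\<close>
  have eta: "eta (real n * b j) \<le> (C + 1) * b j" if "j \<le> J" for j
  proof -
    have "eta (real n * b j) = C * b j + (real L * a + real L * q)"
      unfolding eta_def using n0 by (simp add: q)
    also have "\<dots> \<le> C * b j + b j" using h(1) b\<beta>[OF that] by linarith
    finally show ?thesis by (simp add: algebra_simps)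
  qed
  have eta0: "eta (real n * b j) \<ge> 0" for j using b0[of j] by (intro eta_nonneg) simp
  have p: "(eta (real n * b j))\<^sup>2 + real L * q \<le> P * (b j)\<^sup>2" if "j \<le> J" for j
  proof -
    have "(eta (real n * b j))\<^sup>2 \<le> ((C + 1) * b j)\<^sup>2" using eta[OF that] eta0 by (intro power_mono)
    also have "\<dots> = (C + 1)\<^sup>2 * (b j)\<^sup>2" by (rule power_mult_distrib)
    finally show ?thesis using h(2) b\<beta>2[OF that] unfolding P_def distrib_right by linarith
  qed
  \<comment> \<open>P times the square of \<open>b j\<close> times n/L bounds the mean m * p of one
    count. Four times that makes 2 powr -z beat (1+p)^m, because 4 ln 2 >= 2.\<close>
  define z where "z j = 4 * P * (b j)\<^sup>2 * real n / real L" for j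
  define m where "m = n div L"
  have L0: "real L > 0" using pos(2) by simp
  have m: "n \<le> L * Suc m" "real m \<le> real n / real L"
  proof -
    have "n < Suc m * L" unfolding m_def using pos(2) by (metis dividend_less_div_times mult_Suc)
    then show "n \<le> L * Suc m" by (simp add: mult.commute)
    show "real m \<le> real n / real L" unfolding m_def by (rule of_nat_div_le_of_nat)
  qed
  have summand: "real L * (2 powr - z j * (1 + ((eta (real n * b j))\<^sup>2 + real L * q)) ^ m)
      \<le> real L * exp (- (real n * \<beta>\<^sup>2 / real L))" if "j \<le> J" for j
  proof -
    let ?p = "(eta (real n * b j))\<^sup>2 + real L * q"
    let ?y = "(b j)\<^sup>2 * real n / real L"
    have y0: "?y \<ge> 0" by simp
    have p0: "?p \<ge> 0" using pos by simp
    have "(1 + ?p) ^ m \<le> exp ?p ^ m" using p0 by (intro power_mono exp_ge_add_one_self) auto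
    also have "\<dots> = exp (real m * ?p)" by (rule exp_of_nat_mult[symmetric])
    also have "\<dots> \<le> exp (P * ?y)"
    proof -
      have "real m * ?p \<le> (real n / real L) * (P * (b j)\<^sup>2)"
        using m(2) p[OF that] p0 L0 by (intro mult_mono) auto
      then show ?thesis by (simp add: mult_ac)
    qed
    finally have 1: "(1 + ?p) ^ m \<le> exp (P * ?y)" .
    have "(2::real) powr - z j = exp (- (4 * P * ?y * ln 2))" by (simp add: powr_def z_def mult_ac)
    also have "\<dots> \<le> exp (- (2 * (P * ?y)))"
    proof -
      have "1 / 2 \<le> ln (2::real)" using ln2_ge_two_thirds by simp
      then have "4 * (P * ?y) * (1 / 2) \<le> 4 * (P * ?y) * ln 2" using P y0 by (intro mult_left_mono) auto
      then show ?thesis by (simp add: mult_ac)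
    qed
    finally have 2: "(2::real) powr - z j \<le> exp (- (2 * (P * ?y)))" .
    have "2 powr - z j * (1 + ?p) ^ m \<le> exp (- (2 * (P * ?y))) * exp (P * ?y)"
      using 1 2 p0 by (intro mult_mono) auto
    also have "\<dots> = exp (- (P * ?y))" by (simp add: exp_add[symmetric])
    also have "\<dots> \<le> exp (- (real n * \<beta>\<^sup>2 / real L))"
    proof -
      have "real n * \<beta>\<^sup>2 / real L \<le> ?y"
        using b\<beta>2[OF that] n0 L0 by (simp add: divide_right_mono mult.commute mult_left_mono)
      also have "\<dots> \<le> P * ?y" using mult_right_mono[OF P(1) y0] by simp
      finally show ?thesis by simp
    qed
    finally show ?thesis using L0 by simp
  qed
  have "measure_pmf.prob (W T) {(x, y). \<exists>v\<in>V. i + J + 2 * K < load tie x y (Suc T) v}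
    \<le> (\<Sum>j<J. real L * (2 powr - z j * (1 + ((eta (real n * b j))\<^sup>2 + real L * q)) ^ m))
      + real (card V) * (real (Suc T) * (real (Suc T) * (2 * q * eta (real n * b J)) + real L * (2 * a)) ^ K)"
  proof (rule prob_load_exceeds[where B = "\<lambda>j. real n * b j"])
    have "0 < D * exp 1" using D1 by simp
    then show "i > 0" using i by (cases i) auto
    show "finite V" by (rule V)
    show "Suc T \<le> L * Suc m" using m n by simp
    \<comment> \<open>At most n/i bins reach load i, and i >= D e makes this at most n *
      \<open>b 0\<close>.\<close>
    have "real n * (D * exp 1) \<le> real n * real i" using i n0 by simp
    then have "real n \<le> real i * (real n * (exp (- 1) / D))" using D1 by (simp add: exp_minus field_simps)
    then show "real (Suc T) \<le> real i * (real n * b 0)" using n by (simp add: b_def)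
    show "real n * b J \<ge> 0" using b0[of J] by simp
  next
    fix j assume j: "j < J"
    have "real L \<le> real n * (b j)\<^sup>2"
      using h(3) b\<beta>2[of j] j n0 by (meson less_imp_le mult_left_mono order.trans)
    moreover have "real L * z j = 4 * P * (real n * (b j)\<^sup>2)" using L0 by (simp add: z_def)
    ultimately show "real L + real L * z j \<le> real n * b (Suc j)"
      unfolding bS P(2) by (simp add: algebra_simps)
  qed
  also have "(\<Sum>j<J. real L * (2 powr - z j * (1 + ((eta (real n * b j))\<^sup>2 + real L * q)) ^ m))
      \<le> real J * (real L * exp (- (real n * \<beta>\<^sup>2 / real L)))"
    using sum_bounded_above[of "{..<J}", OF summand] by simp
  also have "real (card V) * (real (Suc T) * (real (Suc T) * (2 * q * eta (real n * b J)) + real L * (2 * a)) ^ K)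
      \<le> real n * (real n * (2 * C * (C + 1) * exp (- (2 ^ J)) + 2 * (real L * a)) ^ K)"
  proof -
    have "real n * (2 * q * eta (real n * b J)) = 2 * C * eta (real n * b J)" using n0 by (simp add: q)
    also have "\<dots> \<le> 2 * C * ((C + 1) * b J)" using eta[of J] C0 by (intro mult_left_mono) auto
    also have "b J \<le> exp (- (2 ^ J))" unfolding b_def using D1 by (simp add: divide_le_eq_1 field_simps)
    finally have le: "real n * (2 * q * eta (real n * b J)) \<le> 2 * C * ((C + 1) * exp (- (2 ^ J)))"
      using C0 by (simp add: mult_left_mono)
    have nn: "real n * (2 * q * eta (real n * b J)) + real L * (2 * a) \<ge> 0" using eta0[of J] pos by simp
    have eq: "2 * C * (C + 1) * exp (- (2 ^ J)) + 2 * (real L * a)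
      = 2 * C * ((C + 1) * exp (- (2 ^ J))) + real L * (2 * a)" by simp
    show ?thesis unfolding V(2) n[symmetric] eq
      using le nn by (intro mult_left_mono power_mono) auto
  qed
  finally show ?thesis unfolding n[symmetric] by simp
qed

end

section \<open>Regular expanders\<close>

lemma expander_sequence_gap:
  assumes "expander_sequence k N G" "k > 0"
  obtains lam n0 where "0 \<le> lam" "lam < real k" "\<And>n. n \<in> N \<Longrightarrow> n \<ge> n0 \<Longrightarrow> expansion (G n) \<le> lam"
    "\<And>n. n \<in> N \<Longrightarrow> regular_graph k (G n) \<and> card (pverts (G n)) = n"
proof -
  have reg: "\<And>n. n \<in> N \<Longrightarrow> regular_graph k (G n) \<and> card (pverts (G n)) = n"
    and lim: "Limsup (inf sequentially (principal N)) (\<lambda>n. ereal (expansion (G n))) < ereal (real k)"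
    using assms(1) by (auto simp: expander_sequence_def)
  obtain y where y: "Limsup (inf sequentially (principal N)) (\<lambda>n. ereal (expansion (G n))) < y" "y < ereal (real k)"
    using dense[OF lim] by blast
  define lam where "lam = max 0 (real_of_ereal y)"
  have "y \<noteq> \<infinity>" "y \<noteq> - \<infinity>" using y by auto
  then have ylam: "y = ereal (real_of_ereal y)" by (cases y) auto
  have "real_of_ereal y < real k" using y(2) by (subst (asm) ylam) simp
  then have lam: "0 \<le> lam" "lam < real k" using assms(2) by (auto simp: lam_def)
  have "eventually (\<lambda>n. ereal (expansion (G n)) < y) (inf sequentially (principal N))"
    by (rule Limsup_lessD[OF y(1)])
  then have "eventually (\<lambda>n. n \<in> N \<longrightarrow> ereal (expansion (G n)) < y) sequentially"
    by (simp add: eventually_inf_principal)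
  then obtain n0 where n0: "\<And>n. n \<ge> n0 \<Longrightarrow> n \<in> N \<Longrightarrow> ereal (expansion (G n)) < y"
    by (auto simp: eventually_sequentially)
  have "expansion (G n) \<le> lam" if "n \<in> N" "n \<ge> n0" for n
  proof -
    have "ereal (expansion (G n)) < ereal (real_of_ereal y)" using n0[OF that(2,1)] ylam by simp
    then show ?thesis by (simp add: lam_def)
  qed
  then show ?thesis using that[OF lam _ reg] by blast
qed

section \<open>Exclusion of degrees one and two\<close>

text \<open>Natural numbers satisfy c <= c^2, so the entry sum n f(k) is at most the squared
  Frobenius norm. For fixed f and n tending to infinity this forces f(k) <= R^2, which a suitable f
  violates.\<close>

lemma natural_mat_fun_bound:
  assumes reg: "regular_graph k G" and n: "n = card (pverts G)" "n > 0"
    and lam: "expansion G \<le> lam" "lam < real k"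
    and M: "mat_fun n (adjacency_matrix G) f M"
    and R: "\<And>x. \<bar>x\<bar> \<le> lam \<Longrightarrow> \<bar>f x\<bar> \<le> R"
    and nat: "\<And>i j. i < n \<Longrightarrow> j < n \<Longrightarrow> M $$ (i, j) \<in> \<nat>"
  shows "real n * f (real k) \<le> (f (real k))\<^sup>2 + real n * R\<^sup>2"
proof -
  have A: "adjacency_matrix G \<in> carrier_mat n n" using adjacency_matrix_index(2) n by auto
  have rs: "(\<Sum>j<n. M $$ (i, j)) = f (real k)" if "i < n" for i
    by (rule mat_fun_row_sum[OF M A]) (use adjacency_matrix_row_sum[OF reg] n that in auto)
  have "real n * f (real k) = (\<Sum>i<n. \<Sum>j<n. M $$ (i, j))" using rs by simp
  also have "\<dots> \<le> (\<Sum>i<n. \<Sum>j<n. (M $$ (i, j))\<^sup>2)"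
  proof (intro sum_mono)
    fix i j assume "i \<in> {..<n}" "j \<in> {..<n}"
    then obtain c where c: "M $$ (i, j) = real c" using nat[of i j] by (auto elim: Nats_cases)
    have "c \<le> c\<^sup>2" by (cases c) (auto simp: power2_eq_square)
    then show "M $$ (i, j) \<le> (M $$ (i, j))\<^sup>2" unfolding c by (simp flip: of_nat_power)
  qed
  also have "\<dots> \<le> (f (real k))\<^sup>2 + real n * R\<^sup>2"
    by (rule regular_graph_frobenius_bound(1)[OF reg n lam M R])
  finally show ?thesis .
qed

text \<open>A conserved quantity of the recurrence for d = 1. For x = 2 cos \<theta> and t >= 1 one
  has \<open>nb_poly 1 t x\<close> = 2 cos(t \<theta>), and the constant is 4 sin^2
  \<theta>.\<close>

lemma nb_poly_one_energy:
  "(nb_poly 1 (Suc (Suc t)) x)\<^sup>2 + (nb_poly 1 (Suc t) x)\<^sup>2 - x * nb_poly 1 (Suc t) x * nb_poly 1 (Suc (Suc t)) x = 4 - x\<^sup>2"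
proof (induction t)
  case 0
  show ?case by (simp add: power2_eq_square algebra_simps)
next
  case (Suc t)
  have "nb_poly 1 (Suc (Suc (Suc t))) x = x * nb_poly 1 (Suc (Suc t)) x - nb_poly 1 (Suc t) x" by simp
  then show ?case using Suc unfolding \<open>nb_poly 1 (Suc (Suc (Suc t))) x = _\<close>
    by (simp add: power2_eq_square algebra_simps del: nb_poly.simps)
qed

text \<open>Completing the square in the conserved quantity shows |2 cos(t \<theta>)| <= 2 without
  trigonometry.\<close>

lemma nb_poly_one_bound:
  assumes "\<bar>x\<bar> < 2" shows "\<bar>nb_poly 1 (Suc t) x\<bar> \<le> 2"
proof -
  let ?a = "nb_poly 1 (Suc t) x" and ?b = "nb_poly 1 (Suc (Suc t)) x"
  have x2: "x\<^sup>2 < 4" using assms abs_square_less_1[of "x / 2"] by (simp add: power_divide)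
  have "(?b - x * ?a / 2)\<^sup>2 + ?a\<^sup>2 * (4 - x\<^sup>2) / 4 = 4 - x\<^sup>2"
    using nb_poly_one_energy[of t x] by (simp add: power2_eq_square field_simps del: nb_poly.simps)
  then have "?a\<^sup>2 * (4 - x\<^sup>2) / 4 \<le> 4 - x\<^sup>2" by (smt (verit) zero_le_power2)
  then have "?a\<^sup>2 * (4 - x\<^sup>2) \<le> 2\<^sup>2 * (4 - x\<^sup>2)" by simp
  moreover have "4 - x\<^sup>2 > 0" using x2 by simp
  ultimately have "?a\<^sup>2 \<le> 2\<^sup>2" by (rule mult_right_le_imp_le)
  then show ?thesis by (metis abs_le_square_iff abs_numeral)
qed

text \<open>For \<open>k = 2\<close> these Dirichlet kernels stay bounded away from the point 2, where they are unbounded in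
  \<open>m\<close>; comparing Frobenius norms this contradicts a spectral gap, which is why \<open>k \<ge> 3\<close> below.\<close>

primrec dirichlet_poly :: "nat \<Rightarrow> real \<Rightarrow> real" where
  "dirichlet_poly 0 x = 1"
| "dirichlet_poly (Suc m) x = dirichlet_poly m x - (- 1) * nb_poly 1 (Suc m) x"

text \<open>Addition is written as subtraction with coefficient -1 to fit the constructor
  \<open>lin\<close> of \<open>mat_fun\<close>.\<close>

primrec dirichlet_mat :: "nat \<Rightarrow> real mat \<Rightarrow> nat \<Rightarrow> real mat" where
  "dirichlet_mat n A 0 = 1\<^sub>m n"
| "dirichlet_mat n A (Suc m) = dirichlet_mat n A m - (- 1) \<cdot>\<^sub>m nb_mat n 1 A (Suc m)"

lemma mat_fun_dirichlet: "mat_fun n A (dirichlet_poly m) (dirichlet_mat n A m)"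
proof (induction m)
  case 0
  have "dirichlet_poly 0 = (\<lambda>_. 1)" by auto
  then show ?case using mat_fun.one by simp
next
  case (Suc m)
  have "dirichlet_poly (Suc m) = (\<lambda>x. dirichlet_poly m x - (- 1) * nb_poly 1 (Suc m) x)" by auto
  then show ?case unfolding dirichlet_mat.simps by (simp only:) (intro mat_fun.lin Suc mat_fun_nb)
qed

text \<open>Multiplying by 2-x turns the recurrence into second differences, and the sum
  telescopes.\<close>

lemma dirichlet_poly_closed:
  "(2 - x) * dirichlet_poly (Suc m) x = nb_poly 1 (Suc m) x - nb_poly 1 (Suc (Suc m)) x"
proof (induction m)
  case 0
  show ?case by (simp add: algebra_simps)
next
  case (Suc m)
  have "(2 - x) * dirichlet_poly (Suc (Suc m)) x
      = (2 - x) * dirichlet_poly (Suc m) x + (2 - x) * nb_poly 1 (Suc (Suc m)) x"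
    unfolding dirichlet_poly.simps(2)[of "Suc m"] by (simp add: algebra_simps del: nb_poly.simps dirichlet_poly.simps)
  moreover have "nb_poly 1 (Suc (Suc (Suc m))) x = x * nb_poly 1 (Suc (Suc m)) x - nb_poly 1 (Suc m) x" by simp
  ultimately show ?case using Suc by (simp add: algebra_simps del: nb_poly.simps dirichlet_poly.simps)
qed

lemma dirichlet_poly_two: "dirichlet_poly m 2 = 2 * real m + 1"
proof (induction m)
  case (Suc m)
  have "nb_poly 1 (Suc m) 2 = 2" using nb_poly_eval[of 1 m] by simp
  then show ?case using Suc by (simp del: nb_poly.simps)
qed simp

lemma dirichlet_poly_bound:
  assumes "\<bar>x\<bar> \<le> lam" "lam < 2"
  shows "\<bar>dirichlet_poly (Suc m) x\<bar> \<le> 4 / (2 - lam)"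
proof -
  have x: "\<bar>x\<bar> < 2" "2 - lam > 0" "2 - x \<ge> 2 - lam" using assms by auto
  have "\<bar>nb_poly 1 (Suc m) x - nb_poly 1 (Suc (Suc m)) x\<bar> \<le> 4"
    using nb_poly_one_bound[OF x(1), of m] nb_poly_one_bound[OF x(1), of "Suc m"] by linarith
  then have "\<bar>2 - x\<bar> * \<bar>dirichlet_poly (Suc m) x\<bar> \<le> 4"
    unfolding dirichlet_poly_closed[symmetric] abs_mult .
  moreover have "(2 - lam) * \<bar>dirichlet_poly (Suc m) x\<bar> \<le> \<bar>2 - x\<bar> * \<bar>dirichlet_poly (Suc m) x\<bar>"
    using x by (intro mult_right_mono) auto
  ultimately show ?thesis using x(2) by (simp add: field_simps)
qed

lemma expander_degree_ge_3:
  assumes "infinite N" and ex: "expander_sequence k N G" and "k > 0"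
  shows "k \<ge> 3"
proof (rule ccontr)
  assume "\<not> ?thesis"
  then have "k = 1 \<or> k = 2" using assms(3) by auto
  obtain lam n0 where lam: "0 \<le> lam" "lam < real k"
    and E: "\<And>n. n \<in> N \<Longrightarrow> n \<ge> n0 \<Longrightarrow> expansion (G n) \<le> lam"
    and reg: "\<And>n. n \<in> N \<Longrightarrow> regular_graph k (G n) \<and> card (pverts (G n)) = n"
    using expander_sequence_gap[OF ex assms(3)] by metis
  have large: "\<exists>n\<in>N. n > 0 \<and> n \<ge> n0 \<and> real n > B" for B :: real
  proof -
    obtain n where "n \<in> N" "n > max n0 (nat \<lceil>\<bar>B\<bar>\<rceil>)" using assms(1) by (meson infinite_nat_iff_unbounded)
    then show ?thesis by (intro bexI[of _ n]) (auto, linarith)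
  qed
  from \<open>k = 1 \<or> k = 2\<close> show False
  proof
    assume k: "k = 1"
    \<comment> \<open>For degree 1 the adjacency matrix itself, f(x) = x, already gives the
      contradiction.\<close>
    have l1: "lam\<^sup>2 < 1" using lam k abs_square_less_1[of lam] by simp
    obtain n where n: "n \<in> N" "n > 0" "n \<ge> n0" "real n > 1 / (1 - lam\<^sup>2)" using large by blast
    note rn = conjunct1[OF reg[OF n(1)]] conjunct2[OF reg[OF n(1)], symmetric]
    have nb: "nb_mat n (real k - 1) (adjacency_matrix (G n)) 1 $$ (i, j) \<in> \<nat>" if "i < n" "j < n" for i j
      unfolding nb_mat_index[OF rn assms(3)[folded Suc_le_eq One_nat_def] that] by (rule of_nat_in_Nats)
    have "real n * nb_poly (real k - 1) 1 (real k) \<le> (nb_poly (real k - 1) 1 (real k))\<^sup>2 + real n * lam\<^sup>2"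
      by (rule natural_mat_fun_bound[OF rn n(2) E[OF n(1,3)] lam(2) mat_fun_nb _ nb]) simp_all
    then have "real n * (1 - lam\<^sup>2) \<le> 1" using k by (simp add: algebra_simps)
    then show False using n(4) l1 by (simp add: field_simps)
  next
    assume k: "k = 2"
    define R where "R = 4 / (2 - lam)"
    \<comment> \<open>Chosen independently of n so that f(2) = 2m+1 exceeds R^2 by at least 1; the
      summand 1 also makes m positive, as \<open>dirichlet_poly_bound\<close> requires.\<close>
    define m where "m = nat \<lceil>R\<^sup>2\<rceil> + 1"
    have m: "2 * real m + 1 \<ge> R\<^sup>2 + 1" 
      using real_nat_ceiling_ge[of "R\<^sup>2"] unfolding m_def of_nat_add of_nat_1 by (smt (verit) of_nat_0_le_iff)
    obtain n where n: "n \<in> N" "n > 0" "n \<ge> n0" "real n > (2 * real m + 1)\<^sup>2" using large by blast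
    note rn = conjunct1[OF reg[OF n(1)]] conjunct2[OF reg[OF n(1)], symmetric]
    have A: "adjacency_matrix (G n) \<in> carrier_mat n n" using adjacency_matrix_index(2)[of "G n"] reg[OF n(1)] by simp
    have nb: "nb_mat n 1 (adjacency_matrix (G n)) t $$ (i, j) \<in> \<nat>" if "i < n" "j < n" for i j t
    proof -
      have "nb_mat n (real k - 1) (adjacency_matrix (G n)) t $$ (i, j) \<in> \<nat>"
        unfolding nb_mat_index[OF rn assms(3)[folded Suc_le_eq One_nat_def] that] by (rule of_nat_in_Nats)
      then show ?thesis using k by simp
    qed
    have c: "nb_mat n 1 (adjacency_matrix (G n)) t \<in> carrier_mat n n" for t by (rule mat_fun_carrier[OF mat_fun_nb A])
    have c': "dirichlet_mat n (adjacency_matrix (G n)) t \<in> carrier_mat n n" for t by (rule mat_fun_carrier[OF mat_fun_dirichlet A])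
    have d: "dirichlet_mat n (adjacency_matrix (G n)) t $$ (i, j) \<in> \<nat>" if "i < n" "j < n" for i j t
    proof (induction t)
      case (Suc t)
      have "dirichlet_mat n (adjacency_matrix (G n)) (Suc t) $$ (i, j)
        = dirichlet_mat n (adjacency_matrix (G n)) t $$ (i, j) + nb_mat n 1 (adjacency_matrix (G n)) (Suc t) $$ (i, j)"
        using c[of "Suc t"] c'[of t] that by (simp del: nb_mat.simps)
      then show ?case using Suc nb[OF that, of "Suc t"] by (simp del: nb_mat.simps dirichlet_mat.simps)
    qed (use that in simp)
    have "m = Suc (m - 1)" by (simp add: m_def)
    then have R: "\<bar>dirichlet_poly m x\<bar> \<le> R" if "\<bar>x\<bar> \<le> lam" for x
      using dirichlet_poly_bound[OF that, of "m - 1"] lam k unfolding R_def by simp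
    have "real n * dirichlet_poly m (real k) \<le> (dirichlet_poly m (real k))\<^sup>2 + real n * R\<^sup>2"
      by (rule natural_mat_fun_bound[OF rn n(2) E[OF n(1,3)] lam(2) mat_fun_dirichlet R d])
    then have le: "real n * (2 * real m + 1) \<le> (2 * real m + 1)\<^sup>2 + real n * R\<^sup>2"
      using dirichlet_poly_two[of m] k by simp
    have "real n * (R\<^sup>2 + 1) \<le> real n * (2 * real m + 1)" using m by (intro mult_left_mono) auto
    then have "real n \<le> (2 * real m + 1)\<^sup>2" using le by (simp add: algebra_simps)
    then show False using n(4) by linarith
  qed
qed

section \<open>Mixing in logarithmic time\<close>

lemma expander_count_bound:
  assumes k: "k \<ge> 3" and lam: "0 \<le> lam" "lam < real k"
  shows "\<exists>c C. 0 < c \<and> 0 < C \<and> (\<forall>(G :: 'a pair_pre_digraph) n u v.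
    regular_graph k G \<longrightarrow> card (pverts G) = n \<longrightarrow> expansion G \<le> lam \<longrightarrow> u \<in> pverts G \<longrightarrow> v \<in> pverts G \<longrightarrow> 2 \<le> n \<longrightarrow>
     real (nb_count G (nat \<lceil>c * ln (real n)\<rceil>) u v) / real (k - 1) ^ nat \<lceil>c * ln (real n)\<rceil> \<le> C / real n)"
proof -
  define d where "d = real k - 1"
  have d: "d > 1" "lam < d + 1" "real (k - 1) = d" using k lam by (auto simp: d_def of_nat_diff)
  obtain C1 \<sigma> where C1: "0 < \<sigma>" "\<sigma> < 1" "C1 > 0" "\<And>t x. \<bar>x\<bar> \<le> lam \<Longrightarrow> \<bar>nb_poly d t x\<bar> \<le> C1 * \<sigma> ^ t * d ^ t"
    using nb_poly_bound[OF d(1,2)] by blast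
  \<comment> \<open>This makes \<sigma>^L at most n^(-2) for L >= c ln n, which leaves room for the
    factor sqrt n.\<close>
  define c where "c = 2 / ln (1 / \<sigma>)"
  have ls: "ln (1 / \<sigma>) > 0" using C1 by simp
  have c: "c > 0" using ls by (simp add: c_def)
  have "real (nb_count G (nat \<lceil>c * ln (real n)\<rceil>) u v) / real (k - 1) ^ nat \<lceil>c * ln (real n)\<rceil> \<le> (2 + C1) / real n"
    if reg: "regular_graph k G" and n: "card (pverts G) = n" "2 \<le> n" and E: "expansion G \<le> lam"
      and uv: "u \<in> pverts G" "v \<in> pverts G" for G :: "'a pair_pre_digraph" and n u v
  proof -
    define L where "L = nat \<lceil>c * ln (real n)\<rceil>"
    have ln0: "ln (real n) > 0" using n by simp
    have Lc: "real L \<ge> c * ln (real n)" "L \<ge> 1"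
      unfolding L_def using mult_pos_pos[OF c ln0] by linarith+
    obtain t where t: "L = Suc t" using Lc(2) by (cases L) auto
    have dk: "d + 1 = real k" by (simp add: d_def)
    have "real (nb_count G L u v) \<le> nb_poly d L (real k) / real n + sqrt (real n) * (C1 * \<sigma> ^ L * d ^ L)"
      using nb_count_mixing[OF reg _ uv E lam(2), of L "C1 * \<sigma> ^ L * d ^ L"] C1 d k n unfolding d_def by auto
    also have "nb_poly d L (real k) = (d + 1) * d ^ t" unfolding t dk[symmetric] by (rule nb_poly_eval)
    finally have "real (nb_count G L u v) / d ^ L \<le> ((d + 1) * d ^ t / real n + sqrt (real n) * (C1 * \<sigma> ^ L * d ^ L)) / d ^ L"
      using d by (intro divide_right_mono) auto
    also have "\<dots> = (d + 1) / d / real n + sqrt (real n) * (C1 * \<sigma> ^ L)"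
      using d n unfolding t by (simp add: field_simps)
    also have "(d + 1) / d / real n \<le> 2 / real n"
      using d n by (intro divide_right_mono) (auto simp: field_simps)
    also have "sqrt (real n) * (C1 * \<sigma> ^ L) \<le> C1 / real n"
    proof -
      have "\<sigma> ^ L = exp (real L * ln \<sigma>)" using C1 by (simp add: exp_of_nat_mult)
      also have "\<dots> \<le> exp (- (2 * ln (real n)))"
      proof -
        have "c * ln (real n) * ln (1 / \<sigma>) \<le> real L * ln (1 / \<sigma>)" using Lc(1) ls by (intro mult_right_mono) auto
        moreover have "c * ln (real n) * ln (1 / \<sigma>) = 2 * ln (real n)" using ls by (simp add: c_def)
        moreover have "real L * ln (1 / \<sigma>) = - (real L * ln \<sigma>)" using C1 by (simp add: ln_div)
        ultimately have "real L * ln \<sigma> \<le> - (2 * ln (real n))" by linarith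
        then show ?thesis by simp
      qed
      also have "\<dots> = 1 / (real n)\<^sup>2"
      proof -
        have "exp (2 * ln (real n)) = (real n)\<^sup>2" by (subst exp_double) (use n in simp)
        then show ?thesis by (simp add: exp_minus inverse_eq_divide)
      qed
      finally have s: "\<sigma> ^ L \<le> 1 / (real n)\<^sup>2" .
      have "sqrt (real n) \<le> sqrt ((real n)\<^sup>2)" using n by (intro real_sqrt_le_mono self_le_power) auto
      then have "sqrt (real n) \<le> real n" by simp
      then have "sqrt (real n) * (C1 * \<sigma> ^ L) \<le> real n * (C1 * (1 / (real n)\<^sup>2))"
        using s C1 by (intro mult_mono) auto
      also have "\<dots> = C1 / real n" using n by (simp add: power2_eq_square)
      finally show ?thesis .
    qed
    finally show ?thesis unfolding L_def[symmetric] d(3) by (simp add: add_divide_distrib)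
  qed
  then show ?thesis using c C1(3) by (intro exI[of _ c] exI[of _ "2 + C1"]) auto
qed


text \<open>The first three facts are the hypotheses of \<open>prob_load_concrete\<close> with x for
  n and a <= n^(-4\<epsilon>). The fourth bounds the cost of one further visit, the fifth the total
  failure probability.\<close>

lemma eventual_error_bounds:
  fixes \<epsilon> c C D E :: real
  assumes \<epsilon>: "0 < \<epsilon>" "\<epsilon> < 1 / 4" and c: "c > 0" and C: "C > 0" and D: "D > 0" and E: "E > 0"
  shows "eventually (\<lambda>x. (c * ln x + 1) * (x powr (- (4 * \<epsilon>)) + C / x) \<le> x powr (- \<epsilon>) / D) at_top"
    and "eventually (\<lambda>x. (c * ln x + 1) * (C / x) \<le> (x powr (- \<epsilon>) / D)\<^sup>2) at_top"
    and "eventually (\<lambda>x. c * ln x + 1 \<le> x * (x powr (- \<epsilon>) / D)\<^sup>2) at_top"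
    and "eventually (\<lambda>x. E * x powr (- (\<epsilon> / 2)) + 2 * ((c * ln x + 1) * x powr (- (4 * \<epsilon>))) \<le> x powr (- (\<epsilon> / 4))) at_top"
    and "((\<lambda>x. ln x * ((c * ln x + 1) * exp (- (x * (x powr (- \<epsilon>) / D)\<^sup>2 / (c * ln x + 1)))) + 1 / x) \<longlongrightarrow> 0) at_top"
proof -
  show "eventually (\<lambda>x. (c * ln x + 1) * (x powr (- (4 * \<epsilon>)) + C / x) \<le> x powr (- \<epsilon>) / D) at_top"
    using assms by real_asymp
  show "eventually (\<lambda>x. (c * ln x + 1) * (C / x) \<le> (x powr (- \<epsilon>) / D)\<^sup>2) at_top"
    using assms by real_asymp
  show "eventually (\<lambda>x. c * ln x + 1 \<le> x * (x powr (- \<epsilon>) / D)\<^sup>2) at_top"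
    using assms by real_asymp
  show "eventually (\<lambda>x. E * x powr (- (\<epsilon> / 2)) + 2 * ((c * ln x + 1) * x powr (- (4 * \<epsilon>))) \<le> x powr (- (\<epsilon> / 4))) at_top"
    using assms by real_asymp
  show "((\<lambda>x. ln x * ((c * ln x + 1) * exp (- (x * (x powr (- \<epsilon>) / D)\<^sup>2 / (c * ln x + 1)))) + 1 / x) \<longlongrightarrow> 0) at_top"
    using assms by real_asymp
qed

section \<open>Maximum load\<close>

lemma walk_pair_nb:
  assumes reg: "regular_graph k G" and k: "k \<ge> 3" and ne: "pverts G \<noteq> {}"
    and g: "enat (2 * l + 1) < girth G" and l: "l > 0" and L: "L > 0" and q: "q \<ge> 0"
    and cnt: "\<And>u v. u \<in> pverts G \<Longrightarrow> v \<in> pverts G \<Longrightarrow> real (nb_count G L u v) / real (k - 1) ^ L \<le> q"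
  shows "walk_pair (nb_step_pmf G) (nb_init G) l L (1 / real (k - 1) ^ l) q"
proof -
  have G: "pair_graph G" using reg by (simp add: regular_graph_def)
  have k2: "k \<ge> 2" using k by simp
  have traj: "nb_traj G xs" "length xs = Suc t"
    if "xs \<in> set_pmf (bind_pmf (nb_init G) (walk_ext (nb_step_pmf G) t))" for xs t
  proof -
    from that obtain ys where y: "ys \<in> set_pmf (nb_init G)" "xs \<in> set_pmf (walk_ext (nb_step_pmf G) t ys)" by auto
    note i = nb_init_traj[OF reg ne y(1)]
    show "nb_traj G xs" by (rule walk_ext_traj[OF reg k2 i(2) y(2)])
    show "length xs = Suc t" using walk_ext_prefix[OF y(2)] i(1) by simp
  qed
  show ?thesis
  proof
    fix xs assume "xs \<in> set_pmf (nb_init G)"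
    then show "length xs = 1" by (rule nb_init_traj[OF reg ne])
  next
    fix xs t v assume "xs \<in> set_pmf (bind_pmf (nb_init G) (walk_ext (nb_step_pmf G) t))"
    then show "measure_pmf.prob (walk_ext (nb_step_pmf G) l xs) {zs. last zs = v} \<le> 1 / real (k - 1) ^ l"
      by (intro prob_hit_girth[OF reg k2 _ g] traj)
  next
    fix xs t v assume xs: "xs \<in> set_pmf (bind_pmf (nb_init G) (walk_ext (nb_step_pmf G) t))"
    note tr = traj(1)[OF xs]
    have last: "last zs \<in> pverts G" if "nb_traj G zs" for zs
      using that unfolding nb_traj_def by (meson last_in_set subsetD)
    show "measure_pmf.prob (walk_ext (nb_step_pmf G) L xs) {zs. last zs = v} \<le> q"
    proof (cases "v \<in> pverts G")
      case True
      then show ?thesis using prob_hit_count[OF reg k2 tr, of L v] cnt[OF last[OF tr] True] by linarith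
    next
      case False
      then have "measure_pmf.prob (walk_ext (nb_step_pmf G) L xs) {zs. last zs = v} = 0"
        using walk_ext_traj[OF reg k2 tr] last unfolding measure_pmf_zero_iff by blast
      then show ?thesis using q by simp
    qed
  next
    fix xs t j j'
    assume xs: "xs \<in> set_pmf (bind_pmf (nb_init G) (walk_ext (nb_step_pmf G) t))"
      and j: "j < j'" "j' \<le> t" "xs ! j = xs ! j'"
    show "j + l \<le> j'"
      using traj[OF xs] j by (intro nb_path_gap[OF G g, of xs]) (auto simp: nb_traj_def)
  qed (use l L q in simp_all)
qed

lemma max_load_prob_ge:
  assumes "pair_graph G" "pverts G \<noteq> {}"
  shows "1 - measure_pmf.prob (two_walks G) {(x, y). \<exists>v\<in>pverts G. b < load tie x y (card (pverts G)) v}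
    \<le> measure_pmf.prob (two_walks G) {(x, y). max_load G tie x y \<le> b}"
proof -
  let ?E = "{(x, y). \<exists>v\<in>pverts G. b < load tie x y (card (pverts G)) v}"
  have "1 - measure_pmf.prob (two_walks G) ?E = measure_pmf.prob (two_walks G) (UNIV - ?E)"
    using measure_pmf.prob_compl[of ?E "two_walks G"] by simp
  also have "\<dots> \<le> measure_pmf.prob (two_walks G) {(x, y). max_load G tie x y \<le> b}"
  proof (rule measure_pmf.finite_measure_mono)
    show "UNIV - ?E \<subseteq> {(x, y). max_load G tie x y \<le> b}"
      using assms(2) pair_graph_basics(1)[OF assms(1)]
      unfolding max_load_def by (auto simp: not_less)
  qed simp
  finally show ?thesis .
qed

theorem theorem4:
  fixes \<alpha> :: real and k :: nat and N :: "nat set"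
    and G :: "nat \<Rightarrow> 'a pair_pre_digraph"
    and tie :: "nat \<Rightarrow> ('a \<times> 'a) list \<Rightarrow> bool"
  assumes "\<alpha> > 0" and "k > 0"
    and "infinite N" and "0 \<notin> N"
    and "expander_sequence k N G"
    and "\<And>n. n \<in> N \<Longrightarrow>
           enat (nat (2 * \<lceil>\<alpha> * log (real k - 1) (real n)\<rceil> + 1)) < girth (G n)"
  shows "\<exists>C::real.
    ((\<lambda>n. measure_pmf.prob (two_walks (G n))
            {(w1, w2). real (max_load (G n) (tie n) w1 w2) \<le> log 2 (ln (real n)) + C})
      \<longlongrightarrow> 1) (inf sequentially (principal N))"
proof -
  have k3: "k \<ge> 3" by (rule expander_degree_ge_3[OF assms(3,5,2)])
  define d where "d = real k - 1"
  have d: "d \<ge> 2" "real (k - 1) = d" using k3 by (auto simp: d_def of_nat_diff)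
  obtain lam n0 where lam: "0 \<le> lam" "lam < real k"
    and E: "\<And>n. n \<in> N \<Longrightarrow> n \<ge> n0 \<Longrightarrow> expansion (G n) \<le> lam"
    and reg: "\<And>n. n \<in> N \<Longrightarrow> regular_graph k (G n) \<and> card (pverts (G n)) = n"
    by (rule expander_sequence_gap[OF assms(5,2)]) blast
  obtain c C where c: "0 < c" and C: "0 < C" and cnt: "\<forall>(G :: 'a pair_pre_digraph) n u v.
    regular_graph k G \<longrightarrow> card (pverts G) = n \<longrightarrow> expansion G \<le> lam \<longrightarrow> u \<in> pverts G \<longrightarrow> v \<in> pverts G \<longrightarrow> 2 \<le> n \<longrightarrow>
     real (nb_count G (nat \<lceil>c * ln (real n)\<rceil>) u v) / real (k - 1) ^ nat \<lceil>c * ln (real n)\<rceil> \<le> C / real n"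
    using expander_count_bound[OF k3 lam, where ?'a = 'a] by (elim exE conjE) (rule that)
  \<comment> \<open>Then 4\<epsilon> <= \<alpha>, so a <= n^(-4\<epsilon>) even after a factor log n
    is far below \<beta> = n^(-\<epsilon>)/D, and \<epsilon> < 1/4 does the same for errors of order
    (log n)/n against the square of \<beta>.\<close>
  define \<epsilon> where "\<epsilon> = min \<alpha> 1 / 5"
  have \<epsilon>: "0 < \<epsilon>" "\<epsilon> < 1 / 4" "4 * \<epsilon> \<le> \<alpha>" using assms(1) by (auto simp: \<epsilon>_def min_def)
  define D where "D = 4 * ((C + 1)\<^sup>2 + 1) + 1"
  have D: "D \<ge> 1" by (simp add: D_def)
  \<comment> \<open>K factors n^(-\<epsilon>/4) give at most n^(-3); two factors n, for the bin and
    the last visiting time, leave 1/n.\<close>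
  define K where "K = nat \<lceil>12 / \<epsilon>\<rceil>"
  define i where "i = nat \<lceil>D * exp 1\<rceil>"
  define \<Lambda> where "\<Lambda> = (\<lambda>x. c * ln x + 1)"
  define \<beta> where "\<beta> = (\<lambda>x. x powr (- \<epsilon>) / D)"
  define g where "g = (\<lambda>x. ln x * (\<Lambda> x * exp (- (x * (\<beta> x)\<^sup>2 / \<Lambda> x))) + 1 / x)"
  \<comment> \<open>The largest J with 2^J <= \<epsilon> ln n: then \<open>exp (- (2 ^ J))\<close>
    lies between n^(-\<epsilon>) and n^(-\<epsilon>/2), so the levels stay above \<beta> while the
    last one is a negative power of n.\<close>
  define J where "J = (\<lambda>n. nat \<lfloor>log 2 (\<epsilon> * ln (real n))\<rfloor>)"
  have E0: "2 * C * (C + 1) > 0" using C by simp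
  have D0: "D > 0" using D by simp
  have big: "eventually (\<lambda>x::real. x \<ge> 2 \<and> \<epsilon> * ln x \<ge> 1) at_top"
  proof (intro eventually_conj eventually_ge_at_top)
    show "eventually (\<lambda>x. \<epsilon> * ln x \<ge> 1) at_top" using \<epsilon>(1) by real_asymp
  qed
  have "eventually (\<lambda>x. (x \<ge> 2 \<and> \<epsilon> * ln x \<ge> 1)
      \<and> (c * ln x + 1) * (x powr (- (4 * \<epsilon>)) + C / x) \<le> \<beta> x
      \<and> (c * ln x + 1) * (C / x) \<le> (\<beta> x)\<^sup>2
      \<and> c * ln x + 1 \<le> x * (\<beta> x)\<^sup>2
      \<and> 2 * C * (C + 1) * x powr (- (\<epsilon> / 2)) + 2 * ((c * ln x + 1) * x powr (- (4 * \<epsilon>))) \<le> x powr (- (\<epsilon> / 4))) at_top"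
    unfolding \<beta>_def by (intro eventually_conj big eventual_error_bounds[OF \<epsilon>(1,2) c C D0 E0])
  from eventually_compose_filterlim[OF this filterlim_real_sequentially]
  obtain n1 where n1: "\<And>n. n \<ge> n1 \<Longrightarrow> (real n \<ge> 2 \<and> \<epsilon> * ln (real n) \<ge> 1)
      \<and> \<Lambda> (real n) * (real n powr (- (4 * \<epsilon>)) + C / real n) \<le> \<beta> (real n)
      \<and> \<Lambda> (real n) * (C / real n) \<le> (\<beta> (real n))\<^sup>2
      \<and> \<Lambda> (real n) \<le> real n * (\<beta> (real n))\<^sup>2
      \<and> 2 * C * (C + 1) * real n powr (- (\<epsilon> / 2)) + 2 * (\<Lambda> (real n) * real n powr (- (4 * \<epsilon>))) \<le> real n powr (- (\<epsilon> / 4))"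
    unfolding \<Lambda>_def by (auto simp: eventually_sequentially)
  have main: "1 - g (real n) \<le> measure_pmf.prob (two_walks (G n))
      {(w1, w2). real (max_load (G n) (tie n) w1 w2) \<le> log 2 (ln (real n)) + real (i + 2 * K)}"
    if nN: "n \<in> N" and nn: "n \<ge> n0" "n \<ge> n1" for n
  proof -
    note rg = conjunct1[OF reg[OF nN]] and cd = conjunct2[OF reg[OF nN]]
    have G: "pair_graph (G n)" using rg by (simp add: regular_graph_def)
    define x where "x = real n"
    have x: "x \<ge> 2" "\<epsilon> * ln x \<ge> 1"
      and h1: "\<Lambda> x * (x powr (- (4 * \<epsilon>)) + C / x) \<le> \<beta> x"
      and h2: "\<Lambda> x * (C / x) \<le> (\<beta> x)\<^sup>2"
      and h3: "\<Lambda> x \<le> x * (\<beta> x)\<^sup>2"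
      and h4: "2 * C * (C + 1) * x powr (- (\<epsilon> / 2)) + 2 * (\<Lambda> x * x powr (- (4 * \<epsilon>))) \<le> x powr (- (\<epsilon> / 4))"
      using n1[OF nn(2)] by (auto simp: x_def)
    have lnx: "ln x > 0" using x(1) by simp
    have n2: "2 \<le> n" using x(1) by (simp add: x_def)
    have ne: "pverts (G n) \<noteq> {}" using cd n2 by auto
    define L where "L = nat \<lceil>c * ln x\<rceil>"
    define l where "l = nat \<lceil>\<alpha> * log d x\<rceil>"
    define a where "a = 1 / real (k - 1) ^ l"
    have L: "L > 0" "real L \<le> \<Lambda> x"
    proof -
      have "c * ln x > 0" using c lnx by simp
      then show "L > 0" "real L \<le> \<Lambda> x" unfolding L_def \<Lambda>_def by linarith+
    qed
    have lg: "\<alpha> * log d x > 0" using assms(1) d x by simp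
    have l: "l > 0" "real l \<ge> \<alpha> * log d x" using lg unfolding l_def by linarith+
    have "nat (2 * \<lceil>\<alpha> * log (real k - 1) (real n)\<rceil> + 1) = 2 * l + 1"
      using lg unfolding l_def d_def x_def by (subst nat_add_distrib) (auto simp: nat_mult_distrib)
    then have gir: "enat (2 * l + 1) < girth (G n)" using assms(6)[OF nN] by simp
    have a0: "a \<ge> 0" by (simp add: a_def)
    have ax: "a \<le> x powr (- (4 * \<epsilon>))"
    proof -
      have "x powr \<alpha> = (d powr log d x) powr \<alpha>" using d x by simp
      also have "\<dots> = d powr (\<alpha> * log d x)" by (simp add: powr_powr mult.commute)
      also have "\<dots> \<le> d powr real l" using l(2) d by (intro powr_mono) auto
      also have "\<dots> = d ^ l" using d by (simp add: powr_realpow)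
      finally have "x powr \<alpha> \<le> d ^ l" .
      then have "a \<le> 1 / x powr \<alpha>" unfolding a_def d(2) using x d by (intro divide_left_mono) auto
      also have "\<dots> = x powr (- \<alpha>)" by (simp add: powr_minus_divide)
      also have "\<dots> \<le> x powr (- (4 * \<epsilon>))" using \<epsilon>(3) x by (intro powr_mono) auto
      finally show ?thesis .
    qed
    have J: "2 ^ J n \<le> \<epsilon> * ln x" "\<epsilon> * ln x / 2 \<le> 2 ^ J n" "real (J n) \<le> log 2 (\<epsilon> * ln x)"
    proof -
      have l0: "log 2 (\<epsilon> * ln x) \<ge> 0" using x(2) by simp
      then have f: "real (J n) \<le> log 2 (\<epsilon> * ln x)" "log 2 (\<epsilon> * ln x) \<le> real (J n) + 1"
        unfolding J_def x_def[symmetric] by linarith+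
      show "real (J n) \<le> log 2 (\<epsilon> * ln x)" by (rule f(1))
      have e: "2 powr log 2 (\<epsilon> * ln x) = \<epsilon> * ln x" using x(2) by (intro powr_log_cancel) auto
      have "(2::real) powr real (J n) \<le> 2 powr log 2 (\<epsilon> * ln x)" using f(1) by (intro powr_mono) auto
      then show "2 ^ J n \<le> \<epsilon> * ln x" unfolding e by (simp add: powr_realpow)
      have "2 powr log 2 (\<epsilon> * ln x) \<le> (2::real) powr (real (J n) + 1)" using f(2) by (intro powr_mono) auto
      then show "\<epsilon> * ln x / 2 \<le> 2 ^ J n" unfolding e by (simp add: powr_add powr_realpow)
    qed
    have xe: "x powr y = exp (y * ln x)" for y using x(1) by (simp add: powr_def)
    interpret walk_pair "nb_step_pmf (G n)" "nb_init (G n)" "tie n" l L a "C / real n"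
      unfolding a_def
    proof (rule walk_pair_nb[OF rg k3 ne gir l(1) L(1)])
      fix u v assume "u \<in> pverts (G n)" "v \<in> pverts (G n)"
      then show "real (nb_count (G n) L u v) / real (k - 1) ^ L \<le> C / real n"
        using cnt rg cd E[OF nN nn(1)] n2 unfolding L_def x_def by blast
    qed (use C in simp)
    have "n = Suc (n - 1)" using n2 by simp
    \<comment> \<open>After n-1 steps a trajectory has n positions, exactly those used by the n
      balls.\<close>
    have tw: "two_walks (G n) = W (n - 1)"
      unfolding two_walks_def W_def cd nb_walk_eq ..
    have "measure_pmf.prob (W (n - 1)) {(w1, w2). \<exists>v\<in>pverts (G n). i + J n + 2 * K < load (tie n) w1 w2 n v}
      \<le> real (J n) * (real L * exp (- (real n * (\<beta> x)\<^sup>2 / real L)))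
      + real n * (real n * (2 * C * (C + 1) * exp (- (2 ^ J n)) + 2 * (real L * a)) ^ K)"
    proof (rule prob_load_concrete)
      show "n = Suc (n - 1)" by fact
      show "C / real n = C / real n" ..
      show "D = 4 * ((C + 1)\<^sup>2 + 1) + 1" by (rule D_def)
      show "D * exp 1 \<le> real i" unfolding i_def by (rule real_nat_ceiling_ge)
      show "finite (pverts (G n))" by (rule pair_graph_basics(1)[OF G])
      show "card (pverts (G n)) = n" by (rule cd)
      show "\<beta> x > 0" using x D0 by (simp add: \<beta>_def)
      show "\<beta> x \<le> exp (- (2 ^ J n)) / D"
        unfolding \<beta>_def xe using J(1) D0 by (intro divide_right_mono) auto
      have "real L * a + real L * (C / real n) = real L * (a + C / x)" by (simp add: x_def distrib_left)
      also have "\<dots> \<le> \<Lambda> x * (x powr (- (4 * \<epsilon>)) + C / x)"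
        using L ax a0 C x by (intro mult_mono) auto
      finally show "real L * a + real L * (C / real n) \<le> \<beta> x" using h1 by linarith
      have "real L * (C / real n) \<le> \<Lambda> x * (C / x)"
        unfolding x_def[symmetric] using L(2) C x by (intro mult_right_mono) auto
      then show "real L * (C / real n) \<le> (\<beta> x)\<^sup>2" using h2 by linarith
      show "real L \<le> real n * (\<beta> x)\<^sup>2" using L(2) h3 by (simp add: x_def)
    qed
    also have "\<dots> \<le> g x"
      unfolding g_def
    proof (rule add_mono)
      have "real (J n) \<le> 2 ^ J n" by (rule of_nat_less_two_power[THEN less_imp_le])
      also have "\<dots> \<le> 1 * ln x" using J(1) \<epsilon>(2) lnx by (intro order.trans[OF J(1)] mult_right_mono) auto
      finally have JJ: "real (J n) \<le> ln x" by simp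
      have "x * (\<beta> x)\<^sup>2 / \<Lambda> x \<le> x * (\<beta> x)\<^sup>2 / real L"
        using L x by (intro divide_left_mono) auto
      then have "exp (- (x * (\<beta> x)\<^sup>2 / real L)) \<le> exp (- (x * (\<beta> x)\<^sup>2 / \<Lambda> x))" by simp
      then show "real (J n) * (real L * exp (- (real n * (\<beta> x)\<^sup>2 / real L)))
          \<le> ln x * (\<Lambda> x * exp (- (x * (\<beta> x)\<^sup>2 / \<Lambda> x)))"
        unfolding x_def[symmetric] using JJ L lnx by (intro mult_mono) auto
      let ?t = "2 * C * (C + 1) * exp (- (2 ^ J n)) + 2 * (real L * a)"
      have "exp (- (2 ^ J n)) \<le> x powr (- (\<epsilon> / 2))" unfolding xe using J(2) by simp
      then have "2 * C * (C + 1) * exp (- (2 ^ J n)) \<le> 2 * C * (C + 1) * x powr (- (\<epsilon> / 2))"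
        using E0 by (intro mult_left_mono) auto
      moreover have "real L * a \<le> \<Lambda> x * x powr (- (4 * \<epsilon>))" using L ax a0 by (intro mult_mono) auto
      ultimately have t: "?t \<le> x powr (- (\<epsilon> / 4))" using h4 by linarith
      have "?t \<ge> 0" using C a0 by (intro add_nonneg_nonneg mult_nonneg_nonneg) auto
      then have "?t ^ K \<le> (x powr (- (\<epsilon> / 4))) ^ K" using t by (intro power_mono)
      also have "\<dots> = x powr (- (\<epsilon> / 4) * real K)" using x by (simp add: powr_power mult.commute)
      also have "\<dots> \<le> x powr (- 3)"
      proof (rule powr_mono)
        have "12 / \<epsilon> \<le> real K" unfolding K_def by (rule real_nat_ceiling_ge)
        then have "\<epsilon> * (12 / \<epsilon>) \<le> \<epsilon> * real K" using \<epsilon>(1) by (intro mult_left_mono) auto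
        then show "- (\<epsilon> / 4) * real K \<le> - 3" using \<epsilon>(1) by simp
      qed (use x in simp)
      also have "\<dots> = 1 / x ^ 3" using x by (simp add: powr_minus_divide)
      finally have "x * (x * ?t ^ K) \<le> x * (x * (1 / x ^ 3))" using x by (intro mult_left_mono) auto
      also have "\<dots> = 1 / x" using x by (simp add: power3_eq_cube)
      finally show "real n * (real n * ?t ^ K) \<le> 1 / x" unfolding x_def[symmetric] .
    qed
    finally have "1 - g x \<le> measure_pmf.prob (two_walks (G n)) {(w1, w2). max_load (G n) (tie n) w1 w2 \<le> i + J n + 2 * K}"
      using max_load_prob_ge[OF G ne, of "i + J n + 2 * K" "tie n"] unfolding tw cd by linarith
    also have "\<dots> \<le> measure_pmf.prob (two_walks (G n))
      {(w1, w2). real (max_load (G n) (tie n) w1 w2) \<le> log 2 (ln (real n)) + real (i + 2 * K)}"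
    proof (rule measure_pmf.finite_measure_mono; safe?)
      fix w1 w2 assume m: "max_load (G n) (tie n) w1 w2 \<le> i + J n + 2 * K"
      \<comment> \<open>Since \<epsilon> < 1, J is at most log_2 log n with leading coefficient 1;
        only i + 2K remains as the additive constant.\<close>
      have "\<epsilon> * ln x \<le> 1 * ln x" using \<epsilon>(2) lnx by (intro mult_right_mono) auto
      then have "log 2 (\<epsilon> * ln x) \<le> log 2 (ln x)" using x(2) lnx by (subst log_le_cancel_iff) auto
      then have "real (J n) \<le> log 2 (ln x)" using J(3) by linarith
      moreover have "real (max_load (G n) (tie n) w1 w2) \<le> real (i + J n + 2 * K)" using m by (rule of_nat_mono)
      ultimately show "real (max_load (G n) (tie n) w1 w2) \<le> log 2 (ln (real n)) + real (i + 2 * K)"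
        by (simp add: x_def)
    qed simp
    finally show ?thesis by (simp add: x_def)
  qed
  have "((\<lambda>x. g x) \<longlongrightarrow> 0) at_top"
    unfolding g_def \<Lambda>_def \<beta>_def by (rule eventual_error_bounds(5)[OF \<epsilon>(1,2) c C D0 E0])
  then have "((\<lambda>n. g (real n)) \<longlongrightarrow> 0) sequentially"
    by (rule filterlim_compose[OF _ filterlim_real_sequentially])
  then have "((\<lambda>n. 1 - g (real n)) \<longlongrightarrow> 1 - 0) sequentially" by (intro tendsto_diff tendsto_const)
  then have lim: "((\<lambda>n. 1 - g (real n)) \<longlongrightarrow> 1) (inf sequentially (principal N))"
    by (intro tendsto_mono[OF inf_le1]) simp
  have "((\<lambda>n. measure_pmf.prob (two_walks (G n))
            {(w1, w2). real (max_load (G n) (tie n) w1 w2) \<le> log 2 (ln (real n)) + real (i + 2 * K)})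
      \<longlongrightarrow> 1) (inf sequentially (principal N))"
  proof (rule tendsto_sandwich[OF _ _ lim tendsto_const])
    show "eventually (\<lambda>n. 1 - g (real n) \<le> measure_pmf.prob (two_walks (G n))
      {(w1, w2). real (max_load (G n) (tie n) w1 w2) \<le> log 2 (ln (real n)) + real (i + 2 * K)})
      (inf sequentially (principal N))"
      unfolding eventually_inf_principal eventually_sequentially
      using main by (intro exI[of _ "max n0 n1"]) auto
  qed simp
  then show ?thesis by blast
qed

end
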